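(* Let $\mathcal{S}=\{(\overline{\bm y}_i,\overline{\bm c}_i)\}_{i=1}^{N_s}$ be a training dataset of pairs drawn i.i.d. from $\mathcal D$, each given by the linear measurement model $\overline{\bm y}_i=A\overline{\bm c}_i+\bm\nu_i$, and define $y_{\max}=\max_{1\le i\le N_s}\|\overline{\bm y}_i\|_2$. Suppose the boundedness assumption, the loss assumption and the scale-update assumption (all three stated in the context) hold. Let $\varepsilon\in(0,1)$. Then with probability at least $1-\varepsilon$, for all $\widehat{\bm c}\in\mathcal H^{(1)}_{\mathrm{CG}}$, $$\mathcal L(\widehat{\bm c})\le \mathcal L_{\mathcal S}(\widehat{\bm c})+\frac{8\tau c_{\max}}{\sqrt{N_s}}\Bigg(\sqrt{\dim(\mathcal P)}\sqrt{\ln\Big(e\Big(1+\tfrac{4p_{\max}(KJD+1)\kappa}{c_{\max}}\Big)\Big)}+\sum_{k=1}^K\sum_{j=1}^J\sum_{d=1}^D\sqrt{\alpha_d\ln\Big(e\Big(1+\tfrac{4\omega_d(KJD+1)\kappa_{k,d}^{(j)}}{c_{\max}}\Big)\Big)}\Bigg)+4c\sqrt{\frac{2\ln(4/\varepsilon)}{N_s}},$$ where $\dim(\mathcal P)=1,\ n,\ 2n-1,$ or $n(n+1)/2$ when $\mathcal P=\mathcal P_{\mathrm{const}},\mathcal P_{\mathrm{diag}},\mathcal P_{\mathrm{tri}}$, or $\mathcal P_{\mathrm{full}}$, respectively, and $$\kappa=z_\infty\big(c_1+p_{\max}y_{\max}\|A\|_\infty\big)\widehat c_1^{(K,J)}+z_\infty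 c_2,\qquad \kappa_{k,d}^{(j)}=z_\infty\big(c_1+p_{\max}y_{\max}\|A\|_\infty\big)\widehat c_{k,j,d,2}^{(K,J)},$$ with $$c_1=p_{\max}y_{\max}\|A\|_2\big(1+2z_\infty^2p_{\max}\|A\|_2^2\big),\qquad c_2=z_\infty y_{\max}\|A\|_2\,(p_{\max}/p_{\min})^2,$$ $$\widehat c_1^{(K,J)}=c_2\sum_{k=1}^K\widehat r_{k,2}^{(J)}\prod_{\ell=k+1}^K\big(\widehat r_{\ell,1}^{(J)}+\widehat r_{\ell,2}^{(J)}c_1\big),\qquad \widehat c_{k,j,d,2}^{(K,J)}=\widehat r_{k,d,3}^{(j,J)}\prod_{\ell=k+1}^K\big(\widehat r_{\ell,1}^{(J)}+\widehat r_{\ell,2}^{(J)}c_1\big),$$ $$\widehat r_{k,1}^{(J)}=\prod_{j=1}^Jr_{k,1}^{(j-1)},\qquad \widehat r_{k,2}^{(J)}=\sum_{j=1}^Jr_{k,2}^{(j-1)}\prod_{\ell=j}^{J-1}r_{k,1}^{(\ell)},\qquad \widehat r_{k,d,3}^{(j,J)}=r_{k,d,3}^{(j-1)}\prod_{\ell=j}^{J-1}r_{k,1}^{(\ell)}.$$ (Empty products equal $1$.)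
   Context: Notation. $\mathbb N[d]=\{1,\dots,d\}$. $\|\cdot\|_p$ is the $\ell_p$ norm on vectors and the induced operator norm on matrices. $\odot$ is the Hadamard product. $A\in\mathbb R^{m\times n}$ is a fixed measurement matrix and $A_{\bm z}=A\,\mathrm{Diag}(\bm z)$ for $\bm z\in\mathbb R^n$. $\mathcal P_{a,b}(x)=a+\mathrm{ReLU}(x-a)-\mathrm{ReLU}(x-b)$, applied componentwise. $\rho_b(\bm v)=\bm v/\max\{1,b^{-1}\|\bm v\|_2\}$ for $b>0$. SPD means symmetric positive definite. For an SPD matrix $P\in\mathbb R^{n\times n}$, $\mathcal T_{\bm y}(\bm z;P)=(A_{\bm z}^TA_{\bm z}+P^{-1})^{-1}A_{\bm z}^T\bm y$. Measurement model. $\bm y=A\bm c+\bm\nu$ with signal $\bm c=\bm z\odot\bm u\in\mathbb R^n$ and noise $\bm\nu\in\mathbb R^m$. $\mathcal D$ is the (unknown) joint distribution of $(\bm y,\bm c)$. Covariance classes. For scalars $0<p_{\min}\le p_{\max}$, $\mathcal P_{\mathrm{full}}$ is the set of SPD matrices $P\in\mathbb R^{n\times n}$ with $\|P\|_2\le p_{\max}$ and $\|P^{-1}\|_2\le p_{\min}^{-1}$; $\mathcal P_{\mathrm{const}}\subset\mathcal P_{\mathrm{diag}}\subset\mathcal P_{\mathrm{tri}}\subset\mathcal P_{\mathrm{full}}$ are its subsets of scaled identity, diagonal, and tridiagonal matrices. $\mathcal P$ denotes one of these four sets. The network G-CG-Net. Fix $K,J,D\ge1$, $z_\infty\ge0$,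 $c_{\max}>0$. The parameters are $\bm\Theta=\{P_u\}\cup\{\bm\theta_{k,d}^{(j)}: k\in\mathbb N[K],j\in\mathbb N[J],d\in\mathbb N[D]\}$ with $P_u\in\mathcal P$ and $\bm\theta_{k,d}^{(j)}\in\Omega_d=\{\bm\theta\in\mathbb R^{\alpha_d}:\|\bm\theta\|_{(d)}\le\omega_d\}$, where $\|\cdot\|_{(d)}$ is a norm and $\omega_d\ge0$. Write $\vartheta_k^{(j)}=(\bm\theta_{k,1}^{(j)},\dots,\bm\theta_{k,D}^{(j)})$. Given input $\bm y$ and scale-variable-descent updates $g_k^{(j)}(\bm z,\bm u)=g_k^{(j)}(\bm z,\bm u;\vartheta_k^{(j)})$ (maps $\mathbb R^n\times\mathbb R^n\to\mathbb R^n$ that may also depend on $\bm y$), the network computes: $Z_1^{(0)}=\mathcal Z_0=\mathcal P_{0,b}(A^T\bm y/\|A\|_2)$ for a fixed $b>0$; $U_0=\mathcal T_{\bm y}(\mathcal Z_0;P_u)$; for $k=1,\dots,K$: $Z_k^{(j)}=\mathcal P_{0,z_\infty}\big(g_k^{(j)}(Z_k^{(j-1)},U_{k-1};\vartheta_k^{(j)})\big)$ for $j=1,\dots,J$, then $U_k=\mathcal T_{\bm y}(Z_k^{(J)};P_u)$ and $Z_{k+1}^{(0)}=Z_k^{(J)}$. The output is $\widehat{\bm c}(\bm y;\bm\Theta)=\rho_{c_{\max}}(Z_K^{(J)}\odot U_K)$. The hypothesis class is $\mathcal H^{(1)}_{\mathrm{CG}}=\{\widehat{\bm c}(\cdot;\bm\Theta):P_u\in\mathcal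 P,\ \bm\theta_{k,d}^{(j)}\in\Omega_d\}$. Losses. For a loss function $L$: $\mathcal L_{\mathcal S}(\widehat{\bm c})=\frac1{N_s}\sum_{i=1}^{N_s}L(\widehat{\bm c}(\overline{\bm y}_i),\overline{\bm c}_i)$ and $\mathcal L(\widehat{\bm c})=\mathbb E_{(\bm y,\bm c)\sim\mathcal D}[L(\widehat{\bm c}(\bm y),\bm c)]$. Boundedness assumption. Almost surely: signals satisfy $\|\bm c\|_2\le c_{\max}$; scale variables (including the initial estimate $\mathcal Z_0$) satisfy $\|\bm z\|_\infty\le z_\infty$; $P_u\in\mathcal P$; and $\|\bm\theta_{k,d}^{(j)}\|_{(d)}\le\omega_d$. Loss assumption. For all $\bm x_1,\bm x_2,\bm x\in V$ (a vector space): $|L(\bm x_1,\bm x_2)|\le c$ and $|L(\bm x_1,\bm x)-L(\bm x_2,\bm x)|\le\tau\|\bm x_1-\bm x_2\|_2$, for constants $c,\tau\ge0$. Scale-update assumption. For every $\bm z_i\in\mathbb R^n$ ($i=1,2$) with $\|\bm z_i\|_\infty\le z_\infty$ and $\bm u_i=\mathcal T_{\bm y}(\bm z_i;P_i)$ with $P_i\in\mathcal P$ (where $\bm y$ is any of the training measurements $\overline{\bm y}_p$), and all parameters $\vartheta_k^{(j)},\widetilde\vartheta_k^{(j)}$, $$\|g_k^{(j)}(\bm z_1,\bm u_1;\vartheta_k^{(j)})-g_k^{(j)}(\bm z_2,\bm u_2;\widetilde\vartheta_k^{(j)})\|_2\le r_{k,1}^{(j-1)}\|\bm z_1-\bm z_2\|_2+r_{k,2}^{(j-1)}\|\bm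 u_1-\bm u_2\|_2+\sum_{d=1}^Dr_{k,d,3}^{(j-1)}\|\bm\theta_{k,d}^{(j)}-\widetilde{\bm\theta}_{k,d}^{(j)}\|_{(d)}$$ for non-negative constants $r_{k,1}^{(j-1)},r_{k,2}^{(j-1)},r_{k,d,3}^{(j-1)}$.
   Formalization: The scale-update assumption as stated (u_i = T_y(z_i;P_i), same z_i) makes the claim false for J ≥ 2; here, for j ≥ 2, it is required for u_i = T_y(w_i;P_i) with any w_i satisfying ‖w_i‖_∞ ≤ z_∞. For j = 1 it is unchanged. *)

theory Defs
  imports "HOL-Probability.Probability"
begin

text \<open>The Hadamard product of two vectors is the library's multiplication on
  \<^typ>\<open>real ^ 'n\<close>; the operator norm induced by the Euclidean norm is
  \<^const>\<open>onorm\<close>.\<close>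

definition opnorm_inf :: "real ^ 'n ^ 'm \<Rightarrow> real" where
  "opnorm_inf A = (SUP x. infnorm (A *v x) / infnorm x)"

definition diag_mat :: "real ^ 'n \<Rightarrow> real ^ 'n ^ 'n" where
  "diag_mat z = (\<chi> i j. if i = j then z $ i else 0)"

definition spd :: "real ^ 'n ^ 'n \<Rightarrow> bool" where
  "spd P \<longleftrightarrow> transpose P = P \<and> (\<forall>x. x \<noteq> 0 \<longrightarrow> 0 < x \<bullet> (P *v x))"

definition diagonal :: "real ^ 'n ^ 'n \<Rightarrow> bool" where
  "diagonal P \<longleftrightarrow> (\<forall>i j. i \<noteq> j \<longrightarrow> P $ i $ j = 0)"

text \<open>The linear order on the index type \<^typ>\<open>'n\<close> identifies it with \<open>{1..CARD('n)}\<close>.\<close>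

definition index_of :: "'n::{finite,linorder} \<Rightarrow> nat" where
  "index_of i = card {l. l \<le> i}"

definition tridiagonal :: "real ^ 'n::{finite,linorder} ^ 'n::{finite,linorder} \<Rightarrow> bool" where
  "tridiagonal P \<longleftrightarrow>
     (\<forall>i j. \<bar>int (index_of i) - int (index_of j)\<bar> > 1 \<longrightarrow> P $ i $ j = 0)"

datatype cov_kind = Const | Diag | Tri | Full

fun cov_shape :: "cov_kind \<Rightarrow> real ^ 'n::{finite,linorder} ^ 'n::{finite,linorder} \<Rightarrow> bool" where
  "cov_shape Const P \<longleftrightarrow> (\<exists>s. P = mat s)"
| "cov_shape Diag P \<longleftrightarrow> diagonal P"
| "cov_shape Tri P \<longleftrightarrow> tridiagonal P"
| "cov_shape Full P \<longleftrightarrow> True"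

definition cov_class ::
  "cov_kind \<Rightarrow> real \<Rightarrow> real \<Rightarrow> (real ^ 'n::{finite,linorder} ^ 'n::{finite,linorder}) set" where
  "cov_class kind p_min p_max =
     {P. spd P \<and> onorm ((*v) P) \<le> p_max \<and> onorm ((*v) (matrix_inv P)) \<le> inverse p_min
         \<and> cov_shape kind P}"

fun cov_dim :: "cov_kind \<Rightarrow> nat \<Rightarrow> nat" where
  "cov_dim Const n = 1"
| "cov_dim Diag n = n"
| "cov_dim Tri n = 2 * n - 1"
| "cov_dim Full n = n * (n + 1) div 2"

definition relu :: "real \<Rightarrow> real" where
  "relu x = max 0 x"

definition mrelu :: "real \<Rightarrow> real \<Rightarrow> real ^ 'n \<Rightarrow> real ^ 'n" where
  "mrelu a b x = (\<chi> i. a + relu (x $ i - a) - relu (x $ i - b))"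

definition rho :: "real \<Rightarrow> real ^ 'n \<Rightarrow> real ^ 'n" where
  "rho b v = v /\<^sub>R max 1 (norm v / b)"

definition tikhonov ::
  "real ^ 'n ^ 'm \<Rightarrow> real ^ 'm \<Rightarrow> real ^ 'n \<Rightarrow> real ^ 'n ^ 'n \<Rightarrow> real ^ 'n" where
  "tikhonov A y z P =
     (let Az = A ** diag_mat z
      in matrix_inv (transpose Az ** Az + matrix_inv P) *v (transpose Az *v y))"

definition init_scale :: "real ^ 'n ^ 'm \<Rightarrow> real \<Rightarrow> real ^ 'm \<Rightarrow> real ^ 'n" where
  "init_scale A b y = mrelu 0 b ((transpose A *v y) /\<^sub>R onorm ((*v) A))"

text \<open>A vector of \<open>\<real>\<^sup>a\<close>, with \<open>a\<close> a number rather than a type, is an element of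
  \<open>topspace (Euclidean_space a)\<close>, i.e. a function \<^typ>\<open>nat \<Rightarrow> real\<close> that vanishes from index
  \<open>a\<close> on. The parameter tuple of one update is an extensional function on \<open>{1..D}\<close> whose
  \<open>d\<close>-th entry has dimension \<open>\<alpha> d\<close>; \<open>g k j y z u \<theta>\<close> is the \<open>j\<close>-th
  update of layer \<open>k\<close> with tuple \<open>\<theta>\<close>.\<close>

type_synonym param_tuple = "nat \<Rightarrow> nat \<Rightarrow> real"

type_synonym ('n, 'm) scale_update =
  "nat \<Rightarrow> nat \<Rightarrow> real ^ 'm \<Rightarrow> real ^ 'n \<Rightarrow> real ^ 'n \<Rightarrow> param_tuple \<Rightarrow> real ^ 'n"

definition is_norm_on_Rn :: "nat \<Rightarrow> ((nat \<Rightarrow> real) \<Rightarrow> real) \<Rightarrow> bool" where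
  "is_norm_on_Rn a N \<longleftrightarrow>
     (\<forall>x \<in> topspace (Euclidean_space a).
        0 \<le> N x \<and> (N x = 0 \<longleftrightarrow> x = (\<lambda>_. 0)) \<and>
        (\<forall>s. N (\<lambda>i. s * x i) = \<bar>s\<bar> * N x) \<and>
        (\<forall>x' \<in> topspace (Euclidean_space a). N (\<lambda>i. x i + x' i) \<le> N x + N x'))"

definition param_ball :: "nat \<Rightarrow> ((nat \<Rightarrow> real) \<Rightarrow> real) \<Rightarrow> real \<Rightarrow> (nat \<Rightarrow> real) set" where
  "param_ball a N \<omega> = {\<theta> \<in> topspace (Euclidean_space a). N \<theta> \<le> \<omega>}"

definition tuple_space ::
  "nat \<Rightarrow> (nat \<Rightarrow> nat) \<Rightarrow> (nat \<Rightarrow> (nat \<Rightarrow> real) \<Rightarrow> real) \<Rightarrow> (nat \<Rightarrow> real) \<Rightarrow> param_tuple set" where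
  "tuple_space D \<alpha> N \<omega> = (\<Pi>\<^sub>E d\<in>{1..D}. param_ball (\<alpha> d) (N d) (\<omega> d))"

primrec scale_iter ::
  "real \<Rightarrow> (nat \<Rightarrow> real ^ 'n \<Rightarrow> real ^ 'n \<Rightarrow> real ^ 'n) \<Rightarrow> real ^ 'n \<Rightarrow> real ^ 'n \<Rightarrow> nat \<Rightarrow> real ^ 'n"
where
  "scale_iter z_inf gk z u 0 = z"
| "scale_iter z_inf gk z u (Suc j) = mrelu 0 z_inf (gk (Suc j) (scale_iter z_inf gk z u j) u)"

text \<open>\<open>cg_layer \<dots> k\<close> is the pair \<open>(Z\<^sub>k\<^sup>(\<^sup>J\<^sup>), U\<^sub>k)\<close>, which for \<open>k = 0\<close> is
  the initial pair; \<open>\<theta> k j\<close> is the parameter tuple of update \<open>(k, j)\<close>.\<close>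

primrec cg_layer ::
  "real ^ 'n ^ 'm \<Rightarrow> real \<Rightarrow> real \<Rightarrow> nat \<Rightarrow> ('n, 'm) scale_update \<Rightarrow> real ^ 'n ^ 'n \<Rightarrow>
   (nat \<Rightarrow> nat \<Rightarrow> param_tuple) \<Rightarrow> real ^ 'm \<Rightarrow> nat \<Rightarrow> (real ^ 'n) \<times> (real ^ 'n)"
where
  "cg_layer A b z_inf J g P \<theta> y 0 =
     (let z = init_scale A b y in (z, tikhonov A y z P))"
| "cg_layer A b z_inf J g P \<theta> y (Suc k) =
     (let (z, u) = cg_layer A b z_inf J g P \<theta> y k;
          z' = scale_iter z_inf (\<lambda>j z u. g (Suc k) j y z u (\<theta> (Suc k) j)) z u J
      in (z', tikhonov A y z' P))"

definition cg_net ::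
  "real ^ 'n ^ 'm \<Rightarrow> real \<Rightarrow> real \<Rightarrow> real \<Rightarrow> nat \<Rightarrow> nat \<Rightarrow> ('n, 'm) scale_update \<Rightarrow>
   real ^ 'n ^ 'n \<Rightarrow> (nat \<Rightarrow> nat \<Rightarrow> param_tuple) \<Rightarrow> real ^ 'm \<Rightarrow> real ^ 'n"
where
  "cg_net A b z_inf c_max K J g P \<theta> y =
     (let (z, u) = cg_layer A b z_inf J g P \<theta> y K in rho c_max (z * u))"

definition cg_hypotheses ::
  "real ^ 'n::{finite,linorder} ^ 'm \<Rightarrow> real \<Rightarrow> real \<Rightarrow> real \<Rightarrow> nat \<Rightarrow> nat \<Rightarrow> ('n::{finite,linorder}, 'm) scale_update \<Rightarrow>
   (real ^ 'n::{finite,linorder} ^ 'n::{finite,linorder}) set \<Rightarrow> param_tuple set \<Rightarrow> (real ^ 'm \<Rightarrow> real ^ 'n::{finite,linorder}) set"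
where
  "cg_hypotheses A b z_inf c_max K J g \<P> \<T> =
     {cg_net A b z_inf c_max K J g P \<theta> | P \<theta>.
        P \<in> \<P> \<and> (\<forall>k\<in>{1..K}. \<forall>j\<in>{1..J}. \<theta> k j \<in> \<T>)}"

definition empirical_loss ::
  "('c \<Rightarrow> 'c \<Rightarrow> real) \<Rightarrow> nat \<Rightarrow> (nat \<Rightarrow> 'y) \<Rightarrow> (nat \<Rightarrow> 'c) \<Rightarrow> ('y \<Rightarrow> 'c) \<Rightarrow> real" where
  "empirical_loss L N ys cs h = (1 / real N) * (\<Sum>i=1..N. L (h (ys i)) (cs i))"

definition expected_loss ::
  "('c \<Rightarrow> 'c \<Rightarrow> real) \<Rightarrow> ('y \<times> 'c) measure \<Rightarrow> ('y \<Rightarrow> 'c) \<Rightarrow> real" where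
  "expected_loss L \<D> h = (\<integral>(y, s). L (h y) s \<partial>\<D>)"

definition loss_assumption ::
  "('c::real_normed_vector \<Rightarrow> 'c \<Rightarrow> real) \<Rightarrow> real \<Rightarrow> real \<Rightarrow> bool" where
  "loss_assumption L c \<tau> \<longleftrightarrow> 0 \<le> c \<and> 0 \<le> \<tau> \<and>
     (\<forall>x1 x2. \<bar>L x1 x2\<bar> \<le> c) \<and>
     (\<forall>x1 x2 x. \<bar>L x1 x - L x2 x\<bar> \<le> \<tau> * norm (x1 - x2))"

text \<open>The scale-update assumption at one measurement \<open>y\<close>. The second argument which the network
  passes to the \<open>j\<close>-th update of layer \<open>k\<close> is \<open>U\<^sub>k\<^sub>-\<^sub>1\<close>, the Tikhonov solution at
  \<open>Z\<^sub>k\<^sup>(\<^sup>0\<^sup>)\<close>, while its first argument is \<open>Z\<^sub>k\<^sup>(\<^sup>j\<^sup>-\<^sup>1\<^sup>)\<close>. These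
  scale variables agree for \<open>j = 1\<close> but in general not for \<open>j > 1\<close>; so the scale
  variables \<open>w1\<close>, \<open>w2\<close> behind \<open>u1\<close>, \<open>u2\<close> are only tied to \<open>z1\<close>, \<open>z2\<close>
  when \<open>j = 1\<close>. Tying them for \<open>j > 1\<close> too would leave the updates unconstrained at the
  points where the network evaluates them.

  \<open>r1 k (j - 1)\<close>, \<open>r2 k (j - 1)\<close>, \<open>r3 k d (j - 1)\<close> are the Lipschitz constants of update
  \<open>(k, j)\<close>, with superscripts running over \<open>0..J-1\<close>.\<close>

definition scale_update_assumption ::
  "real ^ 'n ^ 'm \<Rightarrow> real \<Rightarrow> nat \<Rightarrow> nat \<Rightarrow> nat \<Rightarrow> (nat \<Rightarrow> (nat \<Rightarrow> real) \<Rightarrow> real) \<Rightarrow>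
   ('n, 'm) scale_update \<Rightarrow> (real ^ 'n ^ 'n) set \<Rightarrow> param_tuple set \<Rightarrow>
   (nat \<Rightarrow> nat \<Rightarrow> real) \<Rightarrow> (nat \<Rightarrow> nat \<Rightarrow> real) \<Rightarrow> (nat \<Rightarrow> nat \<Rightarrow> nat \<Rightarrow> real) \<Rightarrow>
   real ^ 'm \<Rightarrow> bool"
where
  "scale_update_assumption A z_inf K J D N g \<P> \<T> r1 r2 r3 y \<longleftrightarrow>
     (\<forall>k\<in>{1..K}. \<forall>j\<in>{1..J}.
        0 \<le> r1 k (j - 1) \<and> 0 \<le> r2 k (j - 1) \<and> (\<forall>d\<in>{1..D}. 0 \<le> r3 k d (j - 1)) \<and>
        (\<forall>z1 z2 w1 w2 u1 u2. \<forall>P1\<in>\<P>. \<forall>P2\<in>\<P>. \<forall>\<theta>1\<in>\<T>. \<forall>\<theta>2\<in>\<T>.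
           infnorm z1 \<le> z_inf \<and> infnorm z2 \<le> z_inf \<and>
           infnorm w1 \<le> z_inf \<and> infnorm w2 \<le> z_inf \<and>
           (j = 1 \<longrightarrow> w1 = z1 \<and> w2 = z2) \<and>
           u1 = tikhonov A y w1 P1 \<and> u2 = tikhonov A y w2 P2 \<longrightarrow>
           norm (g k j y z1 u1 \<theta>1 - g k j y z2 u2 \<theta>2)
             \<le> r1 k (j - 1) * norm (z1 - z2) + r2 k (j - 1) * norm (u1 - u2)
               + (\<Sum>d=1..D. r3 k d (j - 1) * N d (\<lambda>i. \<theta>1 d i - \<theta>2 d i))))"

definition const_c1 :: "real ^ 'n ^ 'm \<Rightarrow> real \<Rightarrow> real \<Rightarrow> real \<Rightarrow> real" where
  "const_c1 A z_inf p_max y_max =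
     p_max * y_max * onorm ((*v) A) * (1 + 2 * z_inf\<^sup>2 * p_max * (onorm ((*v) A))\<^sup>2)"

definition const_c2 :: "real ^ 'n ^ 'm \<Rightarrow> real \<Rightarrow> real \<Rightarrow> real \<Rightarrow> real \<Rightarrow> real" where
  "const_c2 A z_inf p_min p_max y_max = z_inf * y_max * onorm ((*v) A) * (p_max / p_min)\<^sup>2"

definition r1_hat :: "nat \<Rightarrow> (nat \<Rightarrow> nat \<Rightarrow> real) \<Rightarrow> nat \<Rightarrow> real" where
  "r1_hat J r1 k = (\<Prod>j=1..J. r1 k (j - 1))"

definition r2_hat ::
  "nat \<Rightarrow> (nat \<Rightarrow> nat \<Rightarrow> real) \<Rightarrow> (nat \<Rightarrow> nat \<Rightarrow> real) \<Rightarrow> nat \<Rightarrow> real" where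
  "r2_hat J r1 r2 k = (\<Sum>j=1..J. r2 k (j - 1) * (\<Prod>l=j..<J. r1 k l))"

definition r3_hat ::
  "nat \<Rightarrow> (nat \<Rightarrow> nat \<Rightarrow> real) \<Rightarrow> (nat \<Rightarrow> nat \<Rightarrow> nat \<Rightarrow> real) \<Rightarrow> nat \<Rightarrow> nat \<Rightarrow> nat \<Rightarrow> real" where
  "r3_hat J r1 r3 k d j = r3 k d (j - 1) * (\<Prod>l=j..<J. r1 k l)"

definition c1_hat ::
  "nat \<Rightarrow> nat \<Rightarrow> (nat \<Rightarrow> nat \<Rightarrow> real) \<Rightarrow> (nat \<Rightarrow> nat \<Rightarrow> real) \<Rightarrow> real \<Rightarrow> real \<Rightarrow> real" where
  "c1_hat K J r1 r2 c1 c2 =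
     c2 * (\<Sum>k=1..K. r2_hat J r1 r2 k * (\<Prod>l=k+1..K. r1_hat J r1 l + r2_hat J r1 r2 l * c1))"

definition c2_hat ::
  "nat \<Rightarrow> nat \<Rightarrow> (nat \<Rightarrow> nat \<Rightarrow> real) \<Rightarrow> (nat \<Rightarrow> nat \<Rightarrow> real) \<Rightarrow> (nat \<Rightarrow> nat \<Rightarrow> nat \<Rightarrow> real) \<Rightarrow>
   real \<Rightarrow> nat \<Rightarrow> nat \<Rightarrow> nat \<Rightarrow> real" where
  "c2_hat K J r1 r2 r3 c1 k j d =
     r3_hat J r1 r3 k d j * (\<Prod>l=k+1..K. r1_hat J r1 l + r2_hat J r1 r2 l * c1)"

definition kappa ::
  "real ^ 'n ^ 'm \<Rightarrow> real \<Rightarrow> real \<Rightarrow> real \<Rightarrow> nat \<Rightarrow> nat \<Rightarrow>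
   (nat \<Rightarrow> nat \<Rightarrow> real) \<Rightarrow> (nat \<Rightarrow> nat \<Rightarrow> real) \<Rightarrow> real \<Rightarrow> real" where
  "kappa A z_inf p_min p_max K J r1 r2 y_max =
     (let c1 = const_c1 A z_inf p_max y_max; c2 = const_c2 A z_inf p_min p_max y_max
      in z_inf * (c1 + p_max * y_max * opnorm_inf A) * c1_hat K J r1 r2 c1 c2 + z_inf * c2)"

definition kappa_par ::
  "real ^ 'n ^ 'm \<Rightarrow> real \<Rightarrow> real \<Rightarrow> nat \<Rightarrow> nat \<Rightarrow>
   (nat \<Rightarrow> nat \<Rightarrow> real) \<Rightarrow> (nat \<Rightarrow> nat \<Rightarrow> real) \<Rightarrow> (nat \<Rightarrow> nat \<Rightarrow> nat \<Rightarrow> real) \<Rightarrow> real \<Rightarrow>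
   nat \<Rightarrow> nat \<Rightarrow> nat \<Rightarrow> real" where
  "kappa_par A z_inf p_max K J r1 r2 r3 y_max k j d =
     (let c1 = const_c1 A z_inf p_max y_max
      in z_inf * (c1 + p_max * y_max * opnorm_inf A) * c2_hat K J r1 r2 r3 c1 k j d)"

end

theory Submission
  imports Defs
begin

text \<open>
  The network output is Lipschitz in \<open>P\<^sub>u\<close> and in every parameter block, with constants
  \<open>2 \<kappa>\<close> and \<open>2 \<kappa>\<^sub>k\<^sub>,\<^sub>d\<close>: the normal equations give the perturbation bounds of one
  Tikhonov solution, and these propagate through the layers. Comparing volumes, a ball of radius
  \<open>r\<close> of an \<open>a\<close>-dimensional norm has a net of mesh \<open>1 / t\<close> with at most \<open>(1 + 2 r t)^a\<close>
  points, so the loss vectors on the sample have nets at the scales \<open>R / 2^n\<close>, where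
  \<open>R = \<tau> c_max sqrt N\<close>. Chaining along these scales with Massart's lemma bounds the empirical
  Rademacher average \<open>Rad\<close> of the sample itself; as this bound may depend on the sample, the
  Lipschitz constants of the updates may do so too.

  McDiarmid's inequality is applied once, to the supremum of the deviations minus \<open>2 Rad\<close>, which has
  nonpositive mean by symmetrization. The chaining entropies are those of the factor 2 in the
  Lipschitz constants, and \<open>\<Sum>n. 2^(-n) sqrt (ln (1 + 2^n x)) \<le> sqrt 2 * sqrt (ln (e (1 + x)))\<close>
  yields the constant 8. Suprema are taken over a countable dense set of parameters; the
  remaining hypotheses follow by dominated convergence.
\<close>

section \<open>Symmetrization\<close>

text \<open>The scale updates are controlled only almost surely and only at the training
  measurements, whereas the expected loss integrates over a fresh pair. The two meet because each
  training pair has law \<open>\<D>\<close>: limits of hypotheses are taken along the first sample,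
  under the integral over \<open>M\<close>. The same restriction forces covering numbers on the
  sample, hence the empirical Rademacher average.

  A perturbation of size \<open>c_max / 2^n\<close> is shared equally among
  \<open>K * J * D + 1\<close> blocks, one covariance matrix and \<open>K * J * D\<close> vectors;
  the Lipschitz constant \<open>2 * kappa\<close> and the covering bound
  \<open>1 + 2 * r * t\<close> then give the 4 inside the logarithms. The square root of a sum is at
  most the sum of the square roots, which separates the blocks. Chaining costs
  \<open>2 * sqrt 2 * R\<close>, the entropy sum another \<open>sqrt 2\<close>, symmetrization a
  further 2: this is the 8. Replacing one sample moves the supremum of deviations by at most
  \<open>2 * c\<close> and twice the Rademacher sum by at most \<open>4 * c\<close>; the tail this
  gives is below the stated one.\<close>

text \<open>Expectation over independent fair signs as a finite average, so that no second
  probability space enters. The patterns are extensional (\<open>PiE\<close>), hence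
  \<open>2 ^ card I\<close> in number.\<close>

definition sign_avg :: "'i set \<Rightarrow> (('i \<Rightarrow> real) \<Rightarrow> real) \<Rightarrow> real" where
  "sign_avg I f = (\<Sum>s\<in>PiE I (\<lambda>_. {-1, 1}). f s) / 2 ^ card I"

lemma sign_avg_empty [simp]: "sign_avg {} f = f (\<lambda>_. undefined)"
  by (simp add: sign_avg_def)

text \<open>The inductions over the sample remove one sign at a time by this identity.\<close>

lemma sign_avg_insert:
  assumes "finite I" "i \<notin> I"
  shows "sign_avg (insert i I) f = sign_avg I (\<lambda>s. (f (s(i := 1)) + f (s(i := -1))) / 2)"
proof -
  have "(\<Sum>s\<in>PiE (insert i I) (\<lambda>_. {-1, 1}). f s)
      = (\<Sum>(y, s)\<in>{-1, 1} \<times> PiE I (\<lambda>_. {-1, 1}). f (s(i := y)))"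
    unfolding PiE_insert_eq
    using inj_combinator[OF assms(2), of "\<lambda>_. {-1, 1 :: real}"]
    by (subst sum.reindex) (auto simp: case_prod_unfold o_def)
  also have "\<dots> = (\<Sum>y\<in>{-1, 1}. \<Sum>s\<in>PiE I (\<lambda>_. {-1, 1}). f (s(i := y)))"
    by (rule sum.cartesian_product [symmetric])
  also have "\<dots> = (\<Sum>s\<in>PiE I (\<lambda>_. {-1, 1}). f (s(i := 1)) + f (s(i := -1)))"
    by (simp add: sum.distrib)
  finally show ?thesis
    using assms by (simp add: sign_avg_def sum_divide_distrib[symmetric] divide_simps)
qed

lemma card_signs:
  assumes "finite I"
  shows "card (PiE I (\<lambda>_. {-1, 1 :: real})) = 2 ^ card I"
  using assms by (simp add: card_PiE numeral_2_eq_2)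

lemma abs_sign:
  assumes "s \<in> PiE I (\<lambda>_. {-1, 1})" "i \<in> I"
  shows "\<bar>s i :: real\<bar> = 1"
  using PiE_mem[OF assms] by auto

lemma sum_abs_signs:
  assumes "s \<in> PiE I (\<lambda>_. {-1, 1 :: real})"
  shows "(\<Sum>i\<in>I. \<bar>2 * s i\<bar>) = (\<Sum>i\<in>I. 2)"
  by (rule sum.cong) (simp_all add: abs_mult abs_sign[OF assms])

lemma sign_avg_const [simp]: "finite I \<Longrightarrow> sign_avg I (\<lambda>_. k) = k"
  by (simp add: sign_avg_def card_signs)

lemma sign_avg_mono:
  assumes "\<And>s. s \<in> PiE I (\<lambda>_. {-1, 1}) \<Longrightarrow> f s \<le> h s"
  shows "sign_avg I f \<le> sign_avg I h"
  unfolding sign_avg_def by (intro divide_right_mono sum_mono assms) auto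

lemma sign_avg_add: "sign_avg I (\<lambda>s. f s + h s) = sign_avg I f + sign_avg I h"
  by (simp add: sign_avg_def sum.distrib add_divide_distrib)

lemma sign_avg_mean: "sign_avg I (\<lambda>s. (f s + h s) / 2) = (sign_avg I f + sign_avg I h) / 2"
  unfolding sign_avg_def
  by (simp add: sum.distrib sum_divide_distrib[symmetric] add_divide_distrib[symmetric])

lemma sign_avg_cmult: "sign_avg I (\<lambda>s. k * f s) = k * sign_avg I f"
  by (simp add: sign_avg_def sum_distrib_left)

lemma abs_sign_avg_le:
  assumes "finite I" "\<And>s. s \<in> PiE I (\<lambda>_. {-1, 1}) \<Longrightarrow> \<bar>f s\<bar> \<le> k"
  shows "\<bar>sign_avg I f\<bar> \<le> k"
proof -
  have "sign_avg I f \<le> sign_avg I (\<lambda>_. k)"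
    by (rule sign_avg_mono) (erule assms(2)[THEN abs_le_D1])
  moreover have "sign_avg I (\<lambda>_. - k) \<le> sign_avg I f"
  proof (rule sign_avg_mono)
    fix s assume "s \<in> PiE I (\<lambda>_. {-1, 1 :: real})"
    from assms(2)[OF this] show "- k \<le> f s" by linarith
  qed
  ultimately show ?thesis using assms(1) by (simp add: abs_le_iff)
qed

lemma borel_measurable_sign_avg:
  assumes "\<And>s. s \<in> PiE I (\<lambda>_. {-1, 1}) \<Longrightarrow> f s \<in> borel_measurable M"
  shows "(\<lambda>x. sign_avg I (\<lambda>s. f s x)) \<in> borel_measurable M"
  unfolding sign_avg_def using borel_measurable_sum[of _ f, OF assms] by simp

section \<open>Suprema of bounded real families\<close>

lemma abs_SUP_le:
  fixes f :: "'b \<Rightarrow> real"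
  assumes "A \<noteq> {}" "\<And>n. n \<in> A \<Longrightarrow> \<bar>f n\<bar> \<le> B"
  shows "\<bar>SUP n\<in>A. f n\<bar> \<le> B"
proof -
  obtain k where "k \<in> A" using assms(1) by blast
  have "bdd_above (f ` A)"
    using assms(2) by (metis abs_le_D1 bdd_aboveI2)
  then have "f k \<le> (SUP n\<in>A. f n)"
    using \<open>k \<in> A\<close> by (rule cSUP_upper[rotated])
  moreover have "(SUP n\<in>A. f n) \<le> B"
    using assms by (intro cSUP_least) (auto simp: abs_le_iff)
  moreover have "- B \<le> f k" using assms(2)[OF \<open>k \<in> A\<close>] by linarith
  ultimately show ?thesis by linarith
qed

lemma bdd_above_abs: "(\<And>n. \<bar>f n\<bar> \<le> (B :: real)) \<Longrightarrow> bdd_above (range f)"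
  by (metis abs_le_D1 bdd_aboveI2)

lemma SUP_le_SUP_plus:
  fixes f h :: "'b \<Rightarrow> real"
  assumes "\<And>n. f n \<le> h n + d" "bdd_above (range h)"
  shows "(SUP n. f n) \<le> (SUP n. h n) + d"
proof (rule cSUP_least)
  fix n show "f n \<le> (SUP n. h n) + d"
    using assms(1)[of n] cSUP_upper[OF UNIV_I assms(2), of n] by linarith
qed simp

section \<open>Product measures, one coordinate at a time\<close>

context prob_space
begin

lemma prob_space_PiM_const: "prob_space (PiM I (\<lambda>_. M))"
  by (intro prob_space_PiM prob_space_axioms)

lemma integrable_PiM_bounded:
  fixes f :: "('i \<Rightarrow> 'a) \<Rightarrow> real"
  assumes "f \<in> borel_measurable (PiM I (\<lambda>_. M))" "\<And>v. \<bar>f v\<bar> \<le> B"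
  shows "integrable (PiM I (\<lambda>_. M)) f"
proof -
  interpret P: prob_space "PiM I (\<lambda>_. M)" by (rule prob_space_PiM_const)
  show ?thesis by (rule P.integrable_const_bound[of _ B]) (use assms in auto)
qed

lemma measurable_upd:
  assumes "f \<in> borel_measurable (PiM (insert i I) (\<lambda>_. M))" 
  shows "(\<lambda>(v, y). f (v(i := y))) \<in> borel_measurable (PiM I (\<lambda>_. M) \<Otimes>\<^sub>M M)"
  using measurable_comp[OF measurable_add_dim assms] by (simp add: o_def case_prod_unfold)

text \<open>Fubini with one coordinate split off, in both orders. Symmetrization swaps the order
  between treating the new coordinate and using the induction hypothesis for the others; the
  integrability facts are what \<open>integral_mono\<close> then asks for.\<close>

lemma integral_PiM_insert:
  fixes f :: "('i \<Rightarrow> 'a) \<Rightarrow> real"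
  assumes I: "finite I" "i \<notin> I"
    and f: "f \<in> borel_measurable (PiM (insert i I) (\<lambda>_. M))" "\<And>v. \<bar>f v\<bar> \<le> B"
  shows "integral\<^sup>L (PiM (insert i I) (\<lambda>_. M)) f = (\<integral>v. (\<integral>y. f (v(i := y)) \<partial>M) \<partial>PiM I (\<lambda>_. M))"
    and "integral\<^sup>L (PiM (insert i I) (\<lambda>_. M)) f = (\<integral>y. (\<integral>v. f (v(i := y)) \<partial>PiM I (\<lambda>_. M)) \<partial>M)"
    and "integrable (PiM I (\<lambda>_. M)) (\<lambda>v. \<integral>y. f (v(i := y)) \<partial>M)"
    and "integrable M (\<lambda>y. \<integral>v. f (v(i := y)) \<partial>PiM I (\<lambda>_. M))"
    and "\<And>v. v \<in> space (PiM I (\<lambda>_. M)) \<Longrightarrow> integrable M (\<lambda>y. f (v(i := y)))"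
    and "\<And>y. y \<in> space M \<Longrightarrow> integrable (PiM I (\<lambda>_. M)) (\<lambda>v. f (v(i := y)))"
proof -
  interpret P: prob_space "PiM I (\<lambda>_. M)" by (rule prob_space_PiM_const)
  interpret PP: pair_prob_space "PiM I (\<lambda>_. M)" M ..
  interpret Q: product_sigma_finite "\<lambda>_::'i. M" ..
  note m = measurable_upd[OF f(1)]
  have int: "integrable (PiM I (\<lambda>_. M) \<Otimes>\<^sub>M M) (\<lambda>(v, y). f (v(i := y)))"
    by (rule PP.P.integrable_const_bound[of _ B]) (use m f(2) in auto)
  show 1: "integral\<^sup>L (PiM (insert i I) (\<lambda>_. M)) f = (\<integral>v. (\<integral>y. f (v(i := y)) \<partial>M) \<partial>PiM I (\<lambda>_. M))"
    by (rule Q.product_integral_insert[OF I integrable_PiM_bounded[OF f]])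
  show "integral\<^sup>L (PiM (insert i I) (\<lambda>_. M)) f = (\<integral>y. (\<integral>v. f (v(i := y)) \<partial>PiM I (\<lambda>_. M)) \<partial>M)"
    unfolding 1 by (rule PP.Fubini_integral[OF int, symmetric])
  show "integrable (PiM I (\<lambda>_. M)) (\<lambda>v. \<integral>y. f (v(i := y)) \<partial>M)"
    by (rule PP.integrable_fst[OF int])
  show "integrable M (\<lambda>y. \<integral>v. f (v(i := y)) \<partial>PiM I (\<lambda>_. M))"
    by (rule PP.integrable_snd[OF int])
  show "integrable M (\<lambda>y. f (v(i := y)))" if "v \<in> space (PiM I (\<lambda>_. M))" for v
    by (rule integrable_const_bound[of _ B]) (use measurable_Pair2[OF m that] f(2) in auto)
  show "integrable (PiM I (\<lambda>_. M)) (\<lambda>v. f (v(i := y)))" if "y \<in> space M" for y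
    by (rule P.integrable_const_bound[of _ B]) (use measurable_Pair1[OF m that] f(2) in auto)
qed

end

section \<open>Suprema of weighted sums over a countable family\<close>

locale bounded_family = prob_space S for S :: "'a measure" +
  fixes F :: "nat \<Rightarrow> 'a \<Rightarrow> real" and c :: real
  assumes F_measurable [measurable]: "\<And>n. F n \<in> borel_measurable S"
    and F_bounded: "\<And>n x. \<bar>F n x\<bar> \<le> c"
begin

definition mean :: "nat \<Rightarrow> real" where "mean n = (\<integral>x. F n x \<partial>S)"

lemma c_nonneg: "0 \<le> c"
  using F_bounded[of 0 undefined] by linarith

lemma F_integrable: "integrable S (F n)"
  by (rule integrable_const_bound[of _ c]) (auto simp: F_bounded)

lemma mean_bounded: "\<bar>mean n\<bar> \<le> c"
proof -
  have "norm (mean n) \<le> (\<integral>x. norm (F n x) \<partial>S)"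
    unfolding mean_def by (rule integral_norm_bound)
  also have "\<dots> \<le> (\<integral>x. c \<partial>S)"
    by (rule integral_mono) (auto simp: F_bounded F_integrable)
  finally show ?thesis by (simp add: prob_space)
qed

text \<open>The offset \<open>a\<close> makes the induction over the sample possible: a coordinate
  whose value is fixed moves into it. The weights are -1 on raw coordinates, \<open>2 * s i\<close>
  on symmetrized ones and \<open>s i\<close> in the Rademacher sum.\<close>

definition wsup :: "'i set \<Rightarrow> (nat \<Rightarrow> real) \<Rightarrow> ('i \<Rightarrow> real) \<Rightarrow> ('i \<Rightarrow> 'a) \<Rightarrow> real" where
  "wsup I a w v = (SUP n. a n + (\<Sum>i\<in>I. w i * F n (v i)))"

lemma wsum_bounded:
  assumes "\<And>n. \<bar>a n\<bar> \<le> B"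
  shows "\<bar>a n + (\<Sum>i\<in>I. w i * F n (v i))\<bar> \<le> B + (\<Sum>i\<in>I. \<bar>w i\<bar>) * c"
proof -
  have "\<bar>\<Sum>i\<in>I. w i * F n (v i)\<bar> \<le> (\<Sum>i\<in>I. \<bar>w i\<bar> * c)"
    by (rule order_trans[OF sum_abs]) (auto simp: abs_mult intro!: sum_mono mult_left_mono F_bounded)
  then show ?thesis using assms[of n] by (simp add: sum_distrib_right)
qed

lemma wsup_bounded:
  assumes "\<And>n. \<bar>a n\<bar> \<le> B"
  shows "\<bar>wsup I a w v\<bar> \<le> B + (\<Sum>i\<in>I. \<bar>w i\<bar>) * c"
  unfolding wsup_def by (rule abs_SUP_le) (auto intro!: wsum_bounded assms)

lemma wsup_measurable:
  assumes "\<And>n. \<bar>a n\<bar> \<le> B"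
  shows "wsup I a w \<in> borel_measurable (PiM I (\<lambda>_. S))"
  unfolding wsup_def
  by (rule borel_measurable_cSUP) (auto intro: bdd_above_abs[OF wsum_bounded[OF assms]])

lemma wsup_cong:
  assumes "\<And>n. a n = a' n" "\<And>i. i \<in> I \<Longrightarrow> w i = w' i" "\<And>i. i \<in> I \<Longrightarrow> v i = v' i"
  shows "wsup I a w v = wsup I a' w' v'"
  unfolding wsup_def using assms by (simp cong: sum.cong)

lemma wsup_insert:
  assumes "finite I" "i \<notin> I"
  shows "wsup (insert i I) a w (v(i := y)) = wsup I (\<lambda>n. a n + w i * F n y) w v"
proof -
  have "(\<Sum>j\<in>I. w j * F n ((v(i := y)) j)) = (\<Sum>j\<in>I. w j * F n (v j))" for n
    using assms by (intro sum.cong) auto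
  then show ?thesis using assms by (simp add: wsup_def add.assoc)
qed

text \<open>No ghost sample is drawn: \<open>a n + mean n - F n y\<close> is the midpoint of
  \<open>a n + 2 * mean n\<close> and \<open>a n - 2 * F n y\<close>, so its supremum is at most the
  midpoint of the two suprema. The first of these is at most the integral of
  \<open>SUP n. a n + 2 * F n y\<close>, a supremum of integrals being at most the integral of the
  supremum.\<close>

lemma symmetrize_one:
  assumes a: "\<And>n. \<bar>a n\<bar> \<le> B"
  shows "(\<integral>y. (SUP n. a n + mean n - F n y) \<partial>S)
     \<le> (\<integral>y. ((SUP n. a n + 2 * F n y) + (SUP n. a n - 2 * F n y)) / 2 \<partial>S)"
proof -
  let ?p = "\<lambda>y. SUP n. a n + 2 * F n y" and ?m = "\<lambda>y. SUP n. a n - 2 * F n y"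
  let ?q = "SUP n. a n + 2 * mean n"
  have bp: "\<bar>a n + 2 * F n y\<bar> \<le> B + 2 * c" and bm: "\<bar>a n - 2 * F n y\<bar> \<le> B + 2 * c"
    and bq: "\<bar>a n + 2 * mean n\<bar> \<le> B + 2 * c" and b0: "\<bar>a n + mean n - F n y\<bar> \<le> B + 2 * c" for n y
    using a[of n] F_bounded[of n y] mean_bounded[of n] by linarith+
  have ip: "integrable S ?p"
    by (rule integrable_const_bound[of _ "B + 2 * c"])
      (auto intro!: borel_measurable_cSUP bdd_above_abs[OF bp] abs_SUP_le bp)
  have im: "integrable S ?m"
    by (rule integrable_const_bound[of _ "B + 2 * c"])
      (auto intro!: borel_measurable_cSUP bdd_above_abs[OF bm] abs_SUP_le bm)
  have i0: "integrable S (\<lambda>y. SUP n. a n + mean n - F n y)"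
    by (rule integrable_const_bound[of _ "B + 2 * c"])
      (auto intro!: borel_measurable_cSUP bdd_above_abs[OF b0] abs_SUP_le b0)
  have q: "?q \<le> (\<integral>y. ?p y \<partial>S)"
  proof (rule cSUP_least)
    fix n
    have "a n + 2 * mean n = (\<integral>y. a n + 2 * F n y \<partial>S)"
      by (simp add: F_integrable mean_def prob_space)
    also have "\<dots> \<le> (\<integral>y. ?p y \<partial>S)"
      by (rule integral_mono) (auto simp: F_integrable ip intro!: cSUP_upper bdd_above_abs[OF bp])
    finally show "a n + 2 * mean n \<le> (\<integral>y. ?p y \<partial>S)" .
  qed simp
  have "(\<integral>y. (SUP n. a n + mean n - F n y) \<partial>S) \<le> (\<integral>y. (?q + ?m y) / 2 \<partial>S)"
  proof (rule integral_mono)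
    fix y
    show "(SUP n. a n + mean n - F n y) \<le> (?q + ?m y) / 2"
    proof (rule cSUP_least)
      fix n
      have "a n + 2 * mean n \<le> ?q" "a n - 2 * F n y \<le> ?m y"
        by (intro cSUP_upper bdd_above_abs[OF bq] bdd_above_abs[OF bm] UNIV_I)+
      then show "a n + mean n - F n y \<le> (?q + ?m y) / 2" by simp
    qed simp
  qed (auto simp: i0 im)
  also have "\<dots> = (?q + (\<integral>y. ?m y \<partial>S)) / 2"
    using im by (simp add: prob_space)
  also have "\<dots> \<le> ((\<integral>y. ?p y \<partial>S) + (\<integral>y. ?m y \<partial>S)) / 2"
    using q by simp
  also have "\<dots> = (\<integral>y. (?p y + ?m y) / 2 \<partial>S)"
    using ip im by simp
  finally show ?thesis .
qed

text \<open>Signs replace the deviations one coordinate at a time. The factor 2 of symmetrization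
  sits in the weights \<open>2 * s i\<close>, and \<open>a\<close> is arbitrary because the
  induction hypothesis is used with the offsets \<open>a n + 2 * F n y\<close> and
  \<open>a n - 2 * F n y\<close>.\<close>

theorem symmetrization:
  assumes "finite I" "\<And>n. \<bar>a n\<bar> \<le> B"
  shows "(\<integral>v. wsup I (\<lambda>n. a n + real (card I) * mean n) (\<lambda>_. -1) v \<partial>PiM I (\<lambda>_. S))
     \<le> (\<integral>v. sign_avg I (\<lambda>s. wsup I a (\<lambda>i. 2 * s i) v) \<partial>PiM I (\<lambda>_. S))"
  using assms
proof (induction I arbitrary: a B rule: finite_induct)
  case empty
  show ?case by (simp add: wsup_def)
next
  case (insert i I)
  note I = insert.hyps
  let ?P = "\<lambda>I :: 'b set. PiM I (\<lambda>_. S)"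
  define w where "w = (\<lambda>y k. if k = i then y else - 1 :: real)"
  define aI where "aI = (\<lambda>n. a n + real (card I) * mean n)"
  define f0 where "f0 = wsup (insert i I) (\<lambda>n. a n + real (card (insert i I)) * mean n) (\<lambda>_. -1)"
  \<comment> \<open>The half-way stage: coordinate \<open>i\<close> already carries the weights 2
    and -2, the others still have weight -1.\<close>
  define f1 where "f1 = (\<lambda>v. (wsup (insert i I) aI (w 2) v + wsup (insert i I) aI (w (- 2)) v) / 2)"
  define f2 where "f2 = (\<lambda>v. sign_avg (insert i I) (\<lambda>s. wsup (insert i I) a (\<lambda>i. 2 * s i) v))"
  have aI: "\<bar>aI n\<bar> \<le> B + real (card I) * c" for n
  proof -
    have "\<bar>real (card I) * mean n\<bar> \<le> real (card I) * c"
      by (simp add: abs_mult mult_left_mono mean_bounded)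
    then show ?thesis using insert.prems[of n] unfolding aI_def by linarith
  qed
  have a0: "\<bar>a n + real (card (insert i I)) * mean n\<bar> \<le> B + real (card (insert i I)) * c" for n
  proof -
    have "\<bar>real (card (insert i I)) * mean n\<bar> \<le> real (card (insert i I)) * c"
      by (simp only: abs_mult abs_of_nat) (simp add: mult_left_mono mean_bounded del: card_insert_disjoint)
    then show ?thesis using insert.prems[of n] by linarith
  qed
  have m0: "f0 \<in> borel_measurable (?P (insert i I))"
    unfolding f0_def by (rule wsup_measurable[OF a0])
  obtain B0 where b0: "\<And>v. \<bar>f0 v\<bar> \<le> B0"
    by (rule that, unfold f0_def, rule wsup_bounded[OF a0])
  have m1: "f1 \<in> borel_measurable (?P (insert i I))"
    unfolding f1_def
    by (intro borel_measurable_divide borel_measurable_add wsup_measurable[OF aI]) auto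
  obtain B1 where b1: "\<And>v. \<bar>wsup (insert i I) aI (w 2) v\<bar> \<le> B1"
    by (rule that, rule wsup_bounded[OF aI])
  obtain B2 where b2: "\<And>v. \<bar>wsup (insert i I) aI (w (-2)) v\<bar> \<le> B2"
    by (rule that, rule wsup_bounded[OF aI])
  have b1: "\<bar>f1 v\<bar> \<le> (B1 + B2) / 2" for v
    using b1[of v] b2[of v] unfolding f1_def by (auto simp: abs_le_iff)
  have m2: "f2 \<in> borel_measurable (?P (insert i I))"
    unfolding f2_def by (rule borel_measurable_sign_avg) (rule wsup_measurable[OF insert.prems])
  have b2: "\<bar>f2 v\<bar> \<le> B + (\<Sum>k\<in>insert i I. 2) * c" for v
    unfolding f2_def
  proof (rule abs_sign_avg_le)
    fix s :: "'b \<Rightarrow> real" assume s: "s \<in> insert i I \<rightarrow>\<^sub>E {-1, 1}"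
    show "\<bar>wsup (insert i I) a (\<lambda>i. 2 * s i) v\<bar> \<le> B + (\<Sum>k\<in>insert i I. 2) * c"
      using wsup_bounded[of a B "insert i I" "\<lambda>i. 2 * s i" v, OF insert.prems]
      unfolding sum_abs_signs[OF s] .
  qed (use I in simp)
  note i0 = integral_PiM_insert[OF I m0 b0]
  note i1 = integral_PiM_insert[OF I m1 b1]
  note i2 = integral_PiM_insert[OF I m2 b2]
  have "integral\<^sup>L (?P (insert i I)) f0 = (\<integral>v. (\<integral>y. f0 (v(i := y)) \<partial>S) \<partial>?P I)"
    by (rule i0)
  \<comment> \<open>With the other coordinates fixed, their terms form an offset independent of
    \<open>y\<close>, as \<open>symmetrize_one\<close> requires.\<close>
  also have "\<dots> \<le> (\<integral>v. (\<integral>y. f1 (v(i := y)) \<partial>S) \<partial>?P I)"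
  proof (rule integral_mono[OF i0(3) i1(3)])
    fix v :: "'b \<Rightarrow> 'a"
    let ?a = "\<lambda>n. aI n + (\<Sum>j\<in>I. - 1 * F n (v j))"
    have wi: "w y i = y" for y
      by (simp add: w_def)
    have sw: "(\<Sum>j\<in>I. w y j * F n (v j)) = - (\<Sum>j\<in>I. F n (v j))" for n y
      unfolding sum_negf[symmetric] by (rule sum.cong) (use I in \<open>auto simp: w_def\<close>)
    have "(\<integral>y. f0 (v(i := y)) \<partial>S) = (\<integral>y. (SUP n. ?a n + mean n - F n y) \<partial>S)"
      unfolding f0_def wsup_insert[OF I] unfolding wsup_def aI_def using I
      by (simp add: algebra_simps sum_negf)
    also have "\<dots> \<le> (\<integral>y. ((SUP n. ?a n + 2 * F n y) + (SUP n. ?a n - 2 * F n y)) / 2 \<partial>S)"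
      by (rule symmetrize_one) (rule wsum_bounded[OF aI])
    also have "\<dots> = (\<integral>y. f1 (v(i := y)) \<partial>S)"
      unfolding f1_def wsup_insert[OF I] unfolding wsup_def
      by (simp only: sw wi) (simp add: sum_negf algebra_simps)
    finally show "(\<integral>y. f0 (v(i := y)) \<partial>S) \<le> (\<integral>y. f1 (v(i := y)) \<partial>S)" .
  qed
  also have "\<dots> = (\<integral>y. (\<integral>v. f1 (v(i := y)) \<partial>?P I) \<partial>S)"
    using i1(1,2) by simp
  \<comment> \<open>After the exchange of integrals \<open>y\<close> is fixed instead, and its term
    joins the offset of the induction hypothesis.\<close>
  also have "\<dots> \<le> (\<integral>y. (\<integral>v. f2 (v(i := y)) \<partial>?P I) \<partial>S)"
  proof (rule integral_mono[OF i1(4) i2(4)])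
    fix y assume y: "y \<in> space S"
    let ?h = "\<lambda>e v. wsup I (\<lambda>n. (a n + e * F n y) + real (card I) * mean n) (\<lambda>_. - 1) v"
    let ?k = "\<lambda>e v. sign_avg I (\<lambda>s. wsup I (\<lambda>n. a n + e * F n y) (\<lambda>i. 2 * s i) v)"
    have ae: "\<bar>a n + e * F n y\<bar> \<le> B + \<bar>e\<bar> * c" for n e
    proof -
      have "\<bar>e * F n y\<bar> \<le> \<bar>e\<bar> * c" by (simp add: abs_mult mult_left_mono F_bounded)
      then show ?thesis using insert.prems[of n] by linarith
    qed
    have ae': "\<bar>(a n + e * F n y) + real (card I) * mean n\<bar> \<le> B + \<bar>e\<bar> * c + real (card I) * c" for n e
    proof -
      have "\<bar>real (card I) * mean n\<bar> \<le> real (card I) * c"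
        by (simp add: abs_mult mult_left_mono mean_bounded)
      then show ?thesis using ae[of n e] by linarith
    qed
    have ih: "integrable (?P I) (?h e)" for e
      by (rule integrable_PiM_bounded[OF wsup_measurable[OF ae'] wsup_bounded[OF ae']])
    have kb: "\<bar>?k e v\<bar> \<le> B + \<bar>e\<bar> * c + (\<Sum>k\<in>I. 2) * c" for e v
    proof (rule abs_sign_avg_le)
      fix s :: "'b \<Rightarrow> real" assume s: "s \<in> I \<rightarrow>\<^sub>E {-1, 1}"
      show "\<bar>wsup I (\<lambda>n. a n + e * F n y) (\<lambda>i. 2 * s i) v\<bar> \<le> B + \<bar>e\<bar> * c + (\<Sum>k\<in>I. 2) * c"
        using wsup_bounded[OF ae, where I = I and w = "\<lambda>i. 2 * s i"] unfolding sum_abs_signs[OF s] .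
    qed (use I in simp)
    have ik: "integrable (?P I) (?k e)" for e
      by (rule integrable_PiM_bounded[OF _ kb]) (rule borel_measurable_sign_avg, rule wsup_measurable[OF ae])
    have fh: "wsup I (\<lambda>n. aI n + w e i * F n y) (w e) v = ?h e v" for e v
      by (rule wsup_cong) (use I in \<open>auto simp: aI_def w_def\<close>)
    have IH: "(\<integral>v. ?h e v \<partial>?P I) \<le> (\<integral>v. ?k e v \<partial>?P I)" for e
      by (rule insert.IH[OF ae])
    have "(\<integral>v. f1 (v(i := y)) \<partial>?P I) = (\<integral>v. (?h 2 v + ?h (-2) v) / 2 \<partial>?P I)"
      unfolding f1_def wsup_insert[OF I] fh ..
    also have "\<dots> = ((\<integral>v. ?h 2 v \<partial>?P I) + (\<integral>v. ?h (-2) v \<partial>?P I)) / 2"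
      using ih[of 2] ih[of "-2"] by simp
    also have "\<dots> \<le> ((\<integral>v. ?k 2 v \<partial>?P I) + (\<integral>v. ?k (-2) v \<partial>?P I)) / 2"
      by (intro divide_right_mono add_mono IH) simp
    also have "\<dots> = (\<integral>v. (?k 2 v + ?k (-2) v) / 2 \<partial>?P I)"
      using ik[of 2] ik[of "-2"] by simp
    also have "\<dots> = (\<integral>v. f2 (v(i := y)) \<partial>?P I)"
    proof (rule Bochner_Integration.integral_cong[OF refl])
      fix v
      have e: "wsup I (\<lambda>n. a n + 2 * (s(i := d)) i * F n y) (\<lambda>j. 2 * (s(i := d)) j) v
          = wsup I (\<lambda>n. a n + 2 * d * F n y) (\<lambda>j. 2 * s j) v" for s d
        by (rule wsup_cong) (use I in auto)
      show "(?k 2 v + ?k (-2) v) / 2 = f2 (v(i := y))"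
        unfolding f2_def sign_avg_insert[OF I] wsup_insert[OF I] e
        by (simp add: sign_avg_mean)
    qed
    finally show "(\<integral>v. f1 (v(i := y)) \<partial>?P I) \<le> (\<integral>v. f2 (v(i := y)) \<partial>?P I)" .
  qed
  also have "\<dots> = integral\<^sup>L (?P (insert i I)) f2"
    by (rule i2(2)[symmetric])
  finally show ?case unfolding f0_def f2_def .
qed

end

section \<open>Bounded differences\<close>

text \<open>Hoeffding's lemma speaks of a fixed interval, while bounded differences control only the
  oscillation of \<open>f\<close>; the interval of length \<open>d\<close> is anchored at the
  infimum of \<open>f\<close> over the space.\<close>

lemma (in prob_space) hoeffding_mgf:
  fixes f :: "'a \<Rightarrow> real"
  assumes f: "f \<in> borel_measurable M" "\<And>y. \<bar>f y\<bar> \<le> B"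
    and d: "\<And>y y'. y \<in> space M \<Longrightarrow> y' \<in> space M \<Longrightarrow> f y - f y' \<le> d"
    and l: "0 < l"
  shows "(\<integral>y. exp (l * f y) \<partial>M) \<le> exp (l * (\<integral>y. f y \<partial>M) + l\<^sup>2 * d\<^sup>2 / 8)"
proof -
  define a where "a = (INF y\<in>space M. f y)"
  have bdd: "bdd_below (f ` space M)"
    by (rule bdd_belowI2[of _ "- B"]) (use f(2) in \<open>simp add: abs_le_iff minus_le_iff\<close>)
  have ab: "f y \<in> {a..a + d}" if y: "y \<in> space M" for y
  proof -
    have "a \<le> f y" unfolding a_def by (rule cINF_lower[OF bdd y])
    moreover have "f y - d \<le> a"
      unfolding a_def using not_empty d[OF y] by (intro cINF_greatest) (auto simp: algebra_simps)
    ultimately show ?thesis by simp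
  qed
  interpret interval_bounded_random_variable M f a "a + d"
    by unfold_locales (use f ab in auto)
  let ?m = "\<integral>y. f y \<partial>M"
  have int: "integrable M (\<lambda>y. exp (l * (f y - ?m)))"
  proof (rule integrable_const_bound[of _ "exp (l * (B - ?m))"])
    show "AE y in M. norm (exp (l * (f y - ?m))) \<le> exp (l * (B - ?m))"
      using f(2) l by (auto simp: abs_le_iff)
  qed (use f in simp)
  have "(\<integral>\<^sup>+y. exp (l * (f y - ?m)) \<partial>M) \<le> ennreal (exp (l\<^sup>2 * d\<^sup>2 / 8))"
    using Hoeffdings_lemma_nn_integral[OF l] by simp
  then have "(\<integral>y. exp (l * (f y - ?m)) \<partial>M) \<le> exp (l\<^sup>2 * d\<^sup>2 / 8)"
    by (subst (asm) nn_integral_eq_integral[OF int]) auto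
  moreover have "(\<integral>y. exp (l * f y) \<partial>M) = exp (l * ?m) * (\<integral>y. exp (l * (f y - ?m)) \<partial>M)"
    by (simp flip: exp_add integral_mult_right_zero add: algebra_simps)
  ultimately show ?thesis
    by (simp add: exp_add)
qed

text \<open>Integrating out coordinate \<open>i\<close> gives a function \<open>g\<close> with the
  same mean and the same bounded differences in the other coordinates. At fixed \<open>v\<close>
  Hoeffding's lemma bounds the inner exponential moment, which costs one factor
  \<open>exp (l^2 * d^2 / 8)\<close>.\<close>

theorem (in prob_space) mcdiarmid_mgf:
  fixes f :: "('i \<Rightarrow> 'a) \<Rightarrow> real"
  assumes I: "finite I"
    and f: "f \<in> borel_measurable (PiM I (\<lambda>_. M))" "\<And>v. \<bar>f v\<bar> \<le> B"
    and d: "\<And>v i y. v \<in> space (PiM I (\<lambda>_. M)) \<Longrightarrow> i \<in> I \<Longrightarrow> y \<in> space M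
              \<Longrightarrow> \<bar>f (v(i := y)) - f v\<bar> \<le> d"
    and l: "0 < l"
  shows "(\<integral>v. exp (l * f v) \<partial>PiM I (\<lambda>_. M))
      \<le> exp (l * (\<integral>v. f v \<partial>PiM I (\<lambda>_. M)) + real (card I) * (l\<^sup>2 * d\<^sup>2 / 8))"
  using I f d
proof (induction I arbitrary: f rule: finite_induct)
  case empty
  interpret P: prob_space "PiM {} (\<lambda>_. M)" by (rule prob_space_PiM_const)
  show ?case by (simp add: PiM_empty lebesgue_integral_count_space_finite)
next
  case (insert i I)
  note I = insert.hyps
  note ii = integral_PiM_insert[OF I insert.prems(1,2)]
  let ?P = "\<lambda>I :: 'i set. PiM I (\<lambda>_. M)"
  define g where "g = (\<lambda>v. \<integral>y. f (v(i := y)) \<partial>M)"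
  have B: "0 \<le> B" using insert.prems(2)[of undefined] by linarith
  have upd: "v(i := y) \<in> space (?P (insert i I))" if "v \<in> space (?P I)" "y \<in> space M" for v y
    using that by (auto simp: space_PiM PiE_def extensional_def)
  have gm: "g \<in> borel_measurable (?P I)"
    unfolding g_def using ii(3) by (rule borel_measurable_integrable)
  have gb: "\<bar>g v\<bar> \<le> B" for v
  proof -
    have "\<bar>g v\<bar> \<le> (\<integral>y. B \<partial>M)"
      unfolding g_def
      by (rule order_trans[OF integral_abs_bound integral_mono']) (use insert.prems(2) B in auto)
    then show ?thesis by (simp add: prob_space)
  qed
  have gd: "\<bar>g (v(j := z)) - g v\<bar> \<le> d" if v: "v \<in> space (?P I)" and j: "j \<in> I" and z: "z \<in> space M" for v j z
  proof -
    have v': "v(j := z) \<in> space (?P I)"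
      using v j z by (auto simp: space_PiM PiE_def extensional_def)
    have "g (v(j := z)) - g v = (\<integral>y. f (v(j := z, i := y)) - f (v(i := y)) \<partial>M)"
      unfolding g_def by (rule Bochner_Integration.integral_diff[symmetric]; rule ii(5)) (use v v' in auto)
    also have "\<bar>\<dots>\<bar> \<le> (\<integral>y. \<bar>f (v(j := z, i := y)) - f (v(i := y))\<bar> \<partial>M)"
      by (rule integral_abs_bound)
    also have "\<dots> \<le> (\<integral>y. d \<partial>M)"
    proof (rule integral_mono)
      fix y assume y: "y \<in> space M"
      have "v(j := z, i := y) = v(i := y, j := z)"
        using I j by (auto simp: fun_eq_iff)
      then show "\<bar>f (v(j := z, i := y)) - f (v(i := y))\<bar> \<le> d"
        using insert.prems(3)[OF upd[OF v y], of j z] j z by (simp del: fun_upd_apply)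
    qed (intro integrable_abs Bochner_Integration.integrable_diff ii(5) v v' integrable_const)+
    finally show ?thesis by (simp add: prob_space)
  qed
  let ?e = "\<lambda>v. exp (l * f v)"
  have em: "?e \<in> borel_measurable (?P (insert i I))" using insert.prems(1) by simp
  have eb: "\<bar>?e v\<bar> \<le> exp (l * B)" for v using insert.prems(2)[of v] l by (simp add: abs_le_iff)
  note ie = integral_PiM_insert[OF I em eb]
  have ig: "integrable (?P I) (\<lambda>v. exp (l * g v + l\<^sup>2 * d\<^sup>2 / 8))"
    by (rule integrable_PiM_bounded[of _ _ "exp (l * B + l\<^sup>2 * d\<^sup>2 / 8)"])
      (use gm gb l in \<open>auto simp: abs_le_iff\<close>)
  have "integral\<^sup>L (?P (insert i I)) ?e = (\<integral>v. (\<integral>y. ?e (v(i := y)) \<partial>M) \<partial>?P I)"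
    by (rule ie(1))
  also have "\<dots> \<le> (\<integral>v. exp (l * g v + l\<^sup>2 * d\<^sup>2 / 8) \<partial>?P I)"
  proof (rule integral_mono[OF ie(3) ig])
    fix v assume v: "v \<in> space (?P I)"
    show "(\<integral>y. ?e (v(i := y)) \<partial>M) \<le> exp (l * g v + l\<^sup>2 * d\<^sup>2 / 8)"
      unfolding g_def
    proof (rule hoeffding_mgf[OF _ insert.prems(2) _ l])
      show "(\<lambda>y. f (v(i := y))) \<in> borel_measurable M"
        using ii(5)[OF v] by (rule borel_measurable_integrable)
      fix y y' assume y: "y \<in> space M" "y' \<in> space M"
      show "f (v(i := y)) - f (v(i := y')) \<le> d"
        using insert.prems(3)[OF upd[OF v y(2)], of i y] y
          by (simp add: abs_le_iff fun_upd_upd del: fun_upd_apply)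
    qed
  qed
  also have "\<dots> = exp (l\<^sup>2 * d\<^sup>2 / 8) * (\<integral>v. exp (l * g v) \<partial>?P I)"
    by (simp add: exp_add mult.commute)
  also have "\<dots> \<le> exp (l\<^sup>2 * d\<^sup>2 / 8) * exp (l * (\<integral>v. g v \<partial>?P I) + real (card I) * (l\<^sup>2 * d\<^sup>2 / 8))"
    by (intro mult_left_mono insert.IH[OF gm gb gd]) auto
  also have "(\<integral>v. g v \<partial>?P I) = integral\<^sup>L (?P (insert i I)) f"
    unfolding g_def by (rule ii(1)[symmetric])
  finally show ?case
    using I by (simp flip: exp_add add: algebra_simps add_divide_distrib)
qed

theorem (in prob_space) mcdiarmid:
  fixes f :: "('i \<Rightarrow> 'a) \<Rightarrow> real"
  assumes I: "finite I" "I \<noteq> {}"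
    and f: "f \<in> borel_measurable (PiM I (\<lambda>_. M))" "\<And>v. \<bar>f v\<bar> \<le> B"
    and d: "\<And>v i y. v \<in> space (PiM I (\<lambda>_. M)) \<Longrightarrow> i \<in> I \<Longrightarrow> y \<in> space M
              \<Longrightarrow> \<bar>f (v(i := y)) - f v\<bar> \<le> d"
    and "0 < d" "0 < t"
    and E: "(\<integral>v. f v \<partial>PiM I (\<lambda>_. M)) \<le> 0"
  shows "measure (PiM I (\<lambda>_. M)) {v \<in> space (PiM I (\<lambda>_. M)). t \<le> f v}
      \<le> exp (- (2 * t\<^sup>2 / (real (card I) * d\<^sup>2)))"
proof -
  interpret P: prob_space "PiM I (\<lambda>_. M)" by (rule prob_space_PiM_const)
  let ?P = "PiM I (\<lambda>_. M)"
  define n where "n = real (card I)"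
  have n: "0 < n" using I by (simp add: n_def card_gt_0_iff)
  \<comment> \<open>Minimizer of \<open>n * l^2 * d^2 / 8 - l * t\<close>.\<close>
  define l where "l = 4 * t / (n * d\<^sup>2)"
  have l: "0 < l" using n assms by (simp add: l_def)
  have int: "integrable ?P (\<lambda>v. exp (l * f v))"
    by (rule integrable_PiM_bounded[of _ _ "exp (l * B)"]) (use f l in \<open>auto simp: abs_le_iff\<close>)
  have "measure ?P {v \<in> space ?P. t \<le> f v} = measure ?P {v \<in> space ?P. exp (l * t) \<le> exp (l * f v)}"
    using l by simp
  also have "\<dots> \<le> (\<integral>v. exp (l * f v) \<partial>?P) / exp (l * t)"
    by (rule integral_Markov_inequality_measure[OF int, of "{}"]) auto
  also have "\<dots> \<le> exp (l * (\<integral>v. f v \<partial>?P) + n * (l\<^sup>2 * d\<^sup>2 / 8)) / exp (l * t)"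
    unfolding n_def by (intro divide_right_mono mcdiarmid_mgf[OF I(1) f d l]) auto
  also have "\<dots> \<le> exp (n * (l\<^sup>2 * d\<^sup>2 / 8)) / exp (l * t)"
    using E l by (intro divide_right_mono) (auto simp: mult_nonneg_nonpos)
  also have "\<dots> = exp (n * (l\<^sup>2 * d\<^sup>2 / 8) - l * t)"
    by (simp add: exp_diff)
  also have "n * (l\<^sup>2 * d\<^sup>2 / 8) - l * t = - (2 * t\<^sup>2 / (n * d\<^sup>2))"
    using n \<open>0 < d\<close> by (simp add: l_def field_simps power2_eq_square)
  finally show ?thesis by (simp add: n_def)
qed

section \<open>Uniform deviation of a countable family\<close>

context bounded_family
begin

text \<open>A sum, not an average: division by \<open>card I\<close> is postponed, and the deviation
  bound is scaled by the sample size accordingly.\<close>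

definition emp_rad :: "'i set \<Rightarrow> ('i \<Rightarrow> 'a) \<Rightarrow> real" where
  "emp_rad I v = sign_avg I (\<lambda>s. wsup I (\<lambda>_. 0) s v)"

lemma bdd_wsum:
  assumes "\<And>n. \<bar>a n\<bar> \<le> B"
  shows "bdd_above (range (\<lambda>n. a n + (\<Sum>i\<in>I. w i * F n (v i))))"
  by (rule bdd_above_abs) (rule wsum_bounded[OF assms])

lemma wsup_diff_le:
  assumes "finite I" "i \<in> I" and a: "\<And>n. \<bar>a n\<bar> \<le> B"
  shows "wsup I a w v \<le> wsup I a w (v(i := y)) + 2 * \<bar>w i\<bar> * c"
  unfolding wsup_def
proof (rule SUP_le_SUP_plus[OF _ bdd_wsum[OF a]])
  fix n
  have "(\<Sum>j\<in>I. w j * F n (v j)) = w i * F n (v i) + (\<Sum>j\<in>I - {i}. w j * F n (v j))"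
    and "(\<Sum>j\<in>I. w j * F n ((v(i := y)) j)) = w i * F n y + (\<Sum>j\<in>I - {i}. w j * F n (v j))"
    using assms by (simp_all add: sum.remove)
  moreover have "w i * F n (v i) - w i * F n y \<le> 2 * \<bar>w i\<bar> * c"
  proof -
    have "w i * F n (v i) - w i * F n y \<le> \<bar>w i * (F n (v i) - F n y)\<bar>" by (simp add: algebra_simps)
    also have "\<dots> \<le> \<bar>w i\<bar> * (2 * c)"
      unfolding abs_mult using F_bounded[of n "v i"] F_bounded[of n y] by (intro mult_left_mono) linarith+
    finally show ?thesis by simp
  qed
  ultimately show "a n + (\<Sum>j\<in>I. w j * F n (v j))
      \<le> a n + (\<Sum>j\<in>I. w j * F n ((v(i := y)) j)) + 2 * \<bar>w i\<bar> * c" by linarith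
qed

lemma wsup_diff:
  assumes "finite I" "i \<in> I" and a: "\<And>n. \<bar>a n\<bar> \<le> B"
  shows "\<bar>wsup I a w (v(i := y)) - wsup I a w v\<bar> \<le> 2 * \<bar>w i\<bar> * c"
  using wsup_diff_le[where a = a and w = w and v = v and y = y, OF assms]
    wsup_diff_le[where a = a and w = w and v = "v(i := y)" and y = "v i", OF assms]
  by simp

lemma emp_rad_diff:
  assumes I: "finite I" "i \<in> I"
  shows "\<bar>emp_rad I (v(i := y)) - emp_rad I v\<bar> \<le> 2 * c"
proof -
  have "emp_rad I (v(i := y)) - emp_rad I v
      = sign_avg I (\<lambda>s. wsup I (\<lambda>_. 0) s (v(i := y)) - wsup I (\<lambda>_. 0) s v)"
    by (simp add: emp_rad_def sign_avg_def sum_subtractf diff_divide_distrib)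
  also have "\<bar>\<dots>\<bar> \<le> 2 * c"
  proof (rule abs_sign_avg_le[OF I(1)])
    fix s assume "s \<in> PiE I (\<lambda>_. {-1, 1 :: real})"
    then show "\<bar>wsup I (\<lambda>_. 0) s (v(i := y)) - wsup I (\<lambda>_. 0) s v\<bar> \<le> 2 * c"
      using wsup_diff[of I i "\<lambda>_. 0" 0 s v y] abs_sign[of s I i] I by simp
  qed
  finally show ?thesis .
qed

lemma emp_rad_bounded:
  assumes "finite I"
  shows "\<bar>emp_rad I v\<bar> \<le> real (card I) * c"
  unfolding emp_rad_def
proof (rule abs_sign_avg_le[OF assms])
  fix s assume s: "s \<in> PiE I (\<lambda>_. {-1, 1 :: real})"
  have "(\<Sum>i\<in>I. \<bar>s i\<bar>) = (\<Sum>i\<in>I. 1)"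
    by (rule sum.cong) (simp_all add: abs_sign[OF s])
  then show "\<bar>wsup I (\<lambda>_. 0) s v\<bar> \<le> real (card I) * c"
    using wsup_bounded[of "\<lambda>_. 0" 0 I s v] by simp
qed

lemma emp_rad_measurable: "emp_rad I \<in> borel_measurable (PiM I (\<lambda>_. S))"
  unfolding emp_rad_def
  by (rule borel_measurable_sign_avg, rule wsup_measurable[of _ 0]) simp

lemma wsup_double: "wsup I (\<lambda>_. 0) (\<lambda>i. 2 * s i) v \<le> 2 * wsup I (\<lambda>_. 0) s v"
  unfolding wsup_def
proof (rule cSUP_least)
  fix n
  have "0 + (\<Sum>i\<in>I. s i * F n (v i)) \<le> (SUP n. 0 + (\<Sum>i\<in>I. s i * F n (v i)))"
    by (intro cSUP_upper bdd_wsum[of _ 0]) auto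
  then show "0 + (\<Sum>i\<in>I. 2 * s i * F n (v i)) \<le> 2 * (SUP n. 0 + (\<Sum>i\<in>I. s i * F n (v i)))"
    by (simp add: mult.assoc flip: sum_distrib_left)
qed simp

text \<open>Concentrating the difference, instead of the supremum and the Rademacher sum separately,
  avoids a union of two exceptional events and leaves a sample-dependent quantity in the
  bound.\<close>

theorem uniform_deviation:
  assumes I: "finite I" "I \<noteq> {}" and eps: "0 < \<epsilon>" "\<epsilon> < 1"
  defines "N \<equiv> real (card I)"
  shows "\<exists>E \<in> sets (PiM I (\<lambda>_. S)). 1 - \<epsilon> \<le> measure (PiM I (\<lambda>_. S)) E \<and>
    (\<forall>v\<in>E. \<forall>n. N * mean n \<le> (\<Sum>i\<in>I. F n (v i)) + 2 * emp_rad I v + N * (3 * c * sqrt (2 * ln (1 / \<epsilon>) / N)))"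
\<comment> \<open>\<open>mcdiarmid\<close> asks for a positive difference bound; for
  \<open>c = 0\<close> all functions vanish.\<close>
proof (cases "c = 0")
  case True
  then have F0: "F n x = 0" for n x using F_bounded[of n x] by simp
  have "mean n = 0" for n by (simp add: mean_def F0)
  moreover have "emp_rad I v = 0" for v
    using emp_rad_bounded[OF I(1), of v] True by simp
  ultimately show ?thesis
    using prob_space.prob_space[OF prob_space_PiM_const, of I] eps
    by (intro bexI[of _ "space (PiM I (\<lambda>_. S))"]) (simp_all add: F0 True)
next
  case False
  then have c: "0 < c" using c_nonneg by simp
  let ?P = "PiM I (\<lambda>_. S)"
  interpret P: prob_space ?P by (rule prob_space_PiM_const)
  have N: "0 < N" using I by (simp add: N_def card_gt_0_iff)
  define a where "a = (\<lambda>n. N * mean n)"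
  define \<Phi> where "\<Phi> = (\<lambda>v. wsup I a (\<lambda>_. -1) v - 2 * emp_rad I v)"
  \<comment> \<open>Solves \<open>2 * t^2 / (N * (6 * c)^2) = ln (1 / \<epsilon>)\<close>, so that
    the failure probability is at most \<open>\<epsilon>\<close>.\<close>
  define t where "t = N * (3 * c * sqrt (2 * ln (1 / \<epsilon>) / N))"
  have ln: "0 < ln (1 / \<epsilon>)" using eps by simp
  have t: "0 < t" using N c ln by (simp add: t_def)
  have a: "\<bar>a n\<bar> \<le> N * c" for n
    using N by (simp add: a_def abs_mult mean_bounded)
  have wb: "\<bar>wsup I a (\<lambda>_. -1) v\<bar> \<le> N * c + N * c" for v
    using wsup_bounded[where a = a and I = I and w = "\<lambda>_. -1" and v = v, OF a] by (simp add: N_def)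
  have wm: "wsup I a (\<lambda>_. -1) \<in> borel_measurable ?P" by (rule wsup_measurable[OF a])
  have m: "\<Phi> \<in> borel_measurable ?P"
    unfolding \<Phi>_def by (intro borel_measurable_diff borel_measurable_times borel_measurable_const wm emp_rad_measurable)
  have b: "\<bar>\<Phi> v\<bar> \<le> 4 * N * c" for v
    using wb[of v] emp_rad_bounded[OF I(1), of v] unfolding \<Phi>_def N_def by linarith
  \<comment> \<open>\<open>2 * c\<close> from the supremum with weights -1, and
    \<open>2 * (2 * c)\<close> from the doubled Rademacher sum.\<close>
  have d: "\<bar>\<Phi> (v(i := y)) - \<Phi> v\<bar> \<le> 6 * c" if "i \<in> I" for v i y
    using wsup_diff[where a = a and w = "\<lambda>_. -1" and v = v and y = y, OF I(1) that a] emp_rad_diff[OF I(1) that, of v y]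
    unfolding \<Phi>_def by simp
  have iw: "integrable ?P (wsup I a (\<lambda>_. -1))" by (rule integrable_PiM_bounded[OF wm wb])
  have ie: "integrable ?P (emp_rad I)"
    by (rule integrable_PiM_bounded[OF emp_rad_measurable emp_rad_bounded[OF I(1)]])
  have "(\<integral>v. wsup I a (\<lambda>_. -1) v \<partial>?P) \<le> (\<integral>v. sign_avg I (\<lambda>s. wsup I (\<lambda>_. 0) (\<lambda>i. 2 * s i) v) \<partial>?P)"
    using symmetrization[OF I(1), of "\<lambda>_. 0" 0] by (simp add: a_def N_def)
  also have "\<dots> \<le> (\<integral>v. 2 * emp_rad I v \<partial>?P)"
  proof (rule integral_mono)
    show "integrable ?P (\<lambda>v. sign_avg I (\<lambda>s. wsup I (\<lambda>_. 0) (\<lambda>i. 2 * s i) v))"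
    proof (rule integrable_PiM_bounded)
      show "(\<lambda>v. sign_avg I (\<lambda>s. wsup I (\<lambda>_. 0) (\<lambda>i. 2 * s i) v)) \<in> borel_measurable ?P"
        by (rule borel_measurable_sign_avg, rule wsup_measurable[of _ 0]) simp
      fix v show "\<bar>sign_avg I (\<lambda>s. wsup I (\<lambda>_. 0) (\<lambda>i. 2 * s i) v)\<bar> \<le> (\<Sum>i\<in>I. 2) * c"
      proof (rule abs_sign_avg_le[OF I(1)])
        fix s assume s: "s \<in> PiE I (\<lambda>_. {-1, 1 :: real})"
        show "\<bar>wsup I (\<lambda>_. 0) (\<lambda>i. 2 * s i) v\<bar> \<le> (\<Sum>i\<in>I. 2) * c"
          using wsup_bounded[of "\<lambda>_. 0" 0 I "\<lambda>i. 2 * s i" v]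
          unfolding sum_abs_signs[OF s] by simp
      qed
    qed
    fix v show "sign_avg I (\<lambda>s. wsup I (\<lambda>_. 0) (\<lambda>i. 2 * s i) v) \<le> 2 * emp_rad I v"
      unfolding emp_rad_def sign_avg_cmult[symmetric] by (rule sign_avg_mono) (rule wsup_double)
  qed (use ie in simp)
  finally have E: "(\<integral>v. \<Phi> v \<partial>?P) \<le> 0"
    using iw ie by (simp add: \<Phi>_def)
  have "measure ?P {v \<in> space ?P. t \<le> \<Phi> v} \<le> exp (- (2 * t\<^sup>2 / (N * (6 * c)\<^sup>2)))"
    unfolding N_def by (rule mcdiarmid[OF I m b d _ t E]) (use c in auto)
  also have "2 * t\<^sup>2 / (N * (6 * c)\<^sup>2) = ln (1 / \<epsilon>)"
    using N c ln by (simp add: t_def power_mult_distrib) (simp add: power2_eq_square divide_simps)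
  finally have bad: "measure ?P {v \<in> space ?P. t \<le> \<Phi> v} \<le> \<epsilon>"
    using eps by (simp add: ln_div)
  have "{v \<in> space ?P. t \<le> \<Phi> v} \<in> sets ?P" using m by measurable
  from P.prob_compl[OF this] have "1 - \<epsilon> \<le> measure ?P {v \<in> space ?P. \<Phi> v < t}"
    using bad by (simp add: set_diff_eq not_le conj_commute cong: conj_cong)
  moreover have "{v \<in> space ?P. \<Phi> v < t} \<in> sets ?P" using m by measurable
  moreover have "N * mean n \<le> (\<Sum>i\<in>I. F n (v i)) + 2 * emp_rad I v + t" if "\<Phi> v < t" for v n
  proof -
    have "a n + (\<Sum>i\<in>I. - 1 * F n (v i)) \<le> wsup I a (\<lambda>_. -1) v"
      unfolding wsup_def by (rule cSUP_upper[OF UNIV_I bdd_wsum[OF a]])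
    then show ?thesis using that by (simp add: \<Phi>_def a_def sum_negf)
  qed
  ultimately show ?thesis
    unfolding t_def[symmetric] by (intro bexI[of _ "{v \<in> space ?P. \<Phi> v < t}"]) auto
qed

end

section \<open>Chaining\<close>

text \<open>Hoeffding's lemma for a fair sign: its auxiliary inequality with length
  \<open>2 * x\<close> and probability 1/2 is the logarithm of this bound for \<open>x >= 0\<close>,
  and both sides are even.\<close>

lemma cosh_le_exp_half_square: "(exp x + exp (- x)) / 2 \<le> exp (x\<^sup>2 / 2)" for x :: real
proof -
  have pos: "(exp x + exp (- x)) / 2 \<le> exp (x\<^sup>2 / 2)" if "0 \<le> x" for x :: real
  proof -
    have "- (2 * x) * (1 / 2) + ln (1 + 1 / 2 * (exp (2 * x) - 1)) \<le> (2 * x)\<^sup>2 / 8"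
      by (rule Hoeffdings_lemma_aux) (use that in auto)
    then have "ln ((1 + exp (2 * x)) / 2) \<le> x + x\<^sup>2 / 2"
      by (simp add: field_simps power_mult_distrib)
    then have "exp (ln ((1 + exp (2 * x)) / 2)) \<le> exp (x + x\<^sup>2 / 2)" by simp
    then have "(1 + exp (2 * x)) / 2 \<le> exp (x + x\<^sup>2 / 2)"
      by (subst (asm) exp_ln) (auto intro: add_pos_pos)
    then have "(1 + exp (2 * x)) / 2 * exp (- x) \<le> exp (x + x\<^sup>2 / 2) * exp (- x)"
      by (intro mult_right_mono) auto
    then show ?thesis
      by (simp add: field_simps flip: exp_add)
  qed
  show ?thesis using pos[of x] pos[of "- x"] by (cases "0 \<le> x") (auto simp: add.commute)
qed

text \<open>Independence of the signs turns the average into a product of hyperbolic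
  cosines.\<close>

lemma sign_avg_exp_le:
  assumes "finite I"
  shows "sign_avg I (\<lambda>s. exp (\<Sum>i\<in>I. s i * x i)) \<le> exp ((\<Sum>i\<in>I. (x i)\<^sup>2) / 2)"
  using assms
proof (induction I rule: finite_induct)
  case (insert i I)
  have e: "(\<Sum>j\<in>I. (s(i := d)) j * x j) = (\<Sum>j\<in>I. s j * x j)" for s d
    using insert.hyps by (intro sum.cong) auto
  have "sign_avg (insert i I) (\<lambda>s. exp (\<Sum>i\<in>insert i I. s i * x i))
      = sign_avg I (\<lambda>s. (exp (x i) + exp (- x i)) / 2 * exp (\<Sum>j\<in>I. s j * x j))"
    unfolding sign_avg_insert[OF insert.hyps] sum.insert[OF insert.hyps] e
    by (simp add: exp_add exp_diff exp_minus field_simps)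
  also have "\<dots> = (exp (x i) + exp (- x i)) / 2 * sign_avg I (\<lambda>s. exp (\<Sum>j\<in>I. s j * x j))"
    by (rule sign_avg_cmult)
  also have "\<dots> \<le> exp ((x i)\<^sup>2 / 2) * exp ((\<Sum>i\<in>I. (x i)\<^sup>2) / 2)"
    by (intro mult_mono cosh_le_exp_half_square insert.IH)
      (auto simp: sign_avg_def intro!: divide_nonneg_nonneg sum_nonneg)
  also have "\<dots> = exp ((\<Sum>i\<in>insert i I. (x i)\<^sup>2) / 2)"
    using insert.hyps by (simp flip: exp_add add: add_divide_distrib)
  finally show ?case .
qed simp

lemma sign_avg_linear:
  assumes "finite I"
  shows "sign_avg I (\<lambda>s. \<Sum>i\<in>I. s i * x i) = 0"
  using assms
proof (induction I rule: finite_induct)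
  case (insert i I)
  have e: "(\<Sum>j\<in>I. (s(i := d)) j * x j) = (\<Sum>j\<in>I. s j * x j)" for s d
    using insert.hyps by (intro sum.cong) auto
  show ?case
    unfolding sign_avg_insert[OF insert.hyps] sum.insert[OF insert.hyps] e
    using insert.IH by simp
qed simp

text \<open>Jensen's inequality, proved by averaging the tangent line of \<open>exp\<close> at
  \<open>sign_avg I f\<close>.\<close>

lemma exp_sign_avg_le:
  assumes "finite I"
  shows "exp (sign_avg I f) \<le> sign_avg I (\<lambda>s. exp (f s))"
proof -
  let ?m = "sign_avg I f"
  have "exp ?m = sign_avg I (\<lambda>s. exp ?m * (1 - ?m) + exp ?m * f s)"
    using assms by (simp only: sign_avg_add sign_avg_cmult sign_avg_const) (simp add: algebra_simps)
  also have "\<dots> \<le> sign_avg I (\<lambda>s. exp (f s))"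
  proof (rule sign_avg_mono)
    fix s
    have "exp ?m * (1 + (f s - ?m)) \<le> exp ?m * exp (f s - ?m)"
      by (intro mult_left_mono exp_ge_add_one_self) auto
    then show "exp ?m * (1 - ?m) + exp ?m * f s \<le> exp (f s)"
      by (simp add: algebra_simps flip: exp_add)
  qed
  finally show ?thesis .
qed

text \<open>For the degenerate cases of Massart's lemma, in which the optimal exponent would be zero
  or infinite.\<close>

lemma le_of_all_pos:
  fixes x k :: real
  assumes "\<And>l. 0 < l \<Longrightarrow> x \<le> l * k"
  shows "x \<le> 0"
proof (rule ccontr)
  assume "\<not> x \<le> 0"
  define l where "l = x / (2 * (\<bar>k\<bar> + 1))"
  have l: "0 < l" using \<open>\<not> x \<le> 0\<close> by (simp add: l_def)
  have "x \<le> l * k" by (rule assms[OF l])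
  also have "l * k \<le> l * (\<bar>k\<bar> + 1)" using l by (intro mult_left_mono) auto
  also have "\<dots> = x / 2" by (simp add: l_def field_simps)
  finally show False using \<open>\<not> x \<le> 0\<close> by simp
qed

text \<open>The exponential of the maximum is at most the sum of the exponentials, which gives
  \<open>l * E <= k^2 + l^2 * \<rho>^2 / 2\<close> for every \<open>l > 0\<close>. The cardinality
  enters through a number \<open>k\<close> with \<open>card A <= exp (k^2)\<close>, so that no
  square root of a logarithm has to be carried along.\<close>

theorem massart:
  fixes x :: "'a \<Rightarrow> 'i \<Rightarrow> real"
  assumes I: "finite I" and A: "finite A" "A \<noteq> {}"
    and \<rho>: "0 \<le> \<rho>" "\<And>a. a \<in> A \<Longrightarrow> (\<Sum>i\<in>I. (x a i)\<^sup>2) \<le> \<rho>\<^sup>2"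
    and k: "0 \<le> k" "real (card A) \<le> exp (k\<^sup>2)"
  shows "sign_avg I (\<lambda>s. Max ((\<lambda>a. \<Sum>i\<in>I. s i * x a i) ` A)) \<le> sqrt 2 * \<rho> * k"
proof -
  let ?m = "\<lambda>s. Max ((\<lambda>a. \<Sum>i\<in>I. s i * x a i) ` A)"
  define E where "E = sign_avg I ?m"
  have bound: "l * E \<le> k\<^sup>2 + l\<^sup>2 * \<rho>\<^sup>2 / 2" if l: "0 < l" for l
  proof -
    have "exp (l * E) \<le> sign_avg I (\<lambda>s. exp (l * ?m s))"
      unfolding E_def sign_avg_cmult[symmetric] by (rule exp_sign_avg_le[OF I])
    also have "\<dots> \<le> sign_avg I (\<lambda>s. \<Sum>a\<in>A. exp (l * (\<Sum>i\<in>I. s i * x a i)))"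
    proof (rule sign_avg_mono)
      fix s
      have "?m s \<in> (\<lambda>a. \<Sum>i\<in>I. s i * x a i) ` A" using A by (intro Max_in) auto
      then obtain a where a: "a \<in> A" "?m s = (\<Sum>i\<in>I. s i * x a i)" by blast
      show "exp (l * ?m s) \<le> (\<Sum>a\<in>A. exp (l * (\<Sum>i\<in>I. s i * x a i)))"
        unfolding a(2) using A a(1) by (intro member_le_sum) auto
    qed
    also have "\<dots> = (\<Sum>a\<in>A. sign_avg I (\<lambda>s. exp (\<Sum>i\<in>I. s i * (l * x a i))))"
      unfolding sign_avg_def sum_divide_distrib[symmetric]
      by (subst sum.swap) (simp add: sum_distrib_left mult.left_commute)
    also have "\<dots> \<le> (\<Sum>a\<in>A. exp (l\<^sup>2 * \<rho>\<^sup>2 / 2))"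
    proof (rule sum_mono)
      fix a assume a: "a \<in> A"
      have "(\<Sum>i\<in>I. (l * x a i)\<^sup>2) = l\<^sup>2 * (\<Sum>i\<in>I. (x a i)\<^sup>2)"
        by (simp add: power_mult_distrib sum_distrib_left)
      then have "(\<Sum>i\<in>I. (l * x a i)\<^sup>2) \<le> l\<^sup>2 * \<rho>\<^sup>2"
        using \<rho>(2)[OF a] by (simp add: mult_left_mono)
      then show "sign_avg I (\<lambda>s. exp (\<Sum>i\<in>I. s i * (l * x a i))) \<le> exp (l\<^sup>2 * \<rho>\<^sup>2 / 2)"
        by (intro order_trans[OF sign_avg_exp_le[OF I]]) simp
    qed
    also have "\<dots> \<le> exp (k\<^sup>2) * exp (l\<^sup>2 * \<rho>\<^sup>2 / 2)"
      using k(2) by (simp add: mult_right_mono)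
    finally show ?thesis by (simp flip: exp_add)
  qed
  have "E \<le> sqrt 2 * \<rho> * k"
  proof (cases "\<rho> = 0 \<or> k = 0")
    case True
    then have "E \<le> 0"
    proof
      assume "\<rho> = 0"
      show ?thesis
      proof (rule le_of_all_pos[of _ "k\<^sup>2"])
        fix l :: real assume "0 < l"
        then show "E \<le> l * k\<^sup>2" using bound[of "1 / l"] \<open>\<rho> = 0\<close> by (simp add: field_simps)
      qed
    next
      assume "k = 0"
      show ?thesis
      proof (rule le_of_all_pos[of _ "\<rho>\<^sup>2 / 2"])
        fix l :: real assume l: "0 < l"
        then show "E \<le> l * (\<rho>\<^sup>2 / 2)" using bound[OF l] \<open>k = 0\<close> by (simp add: power2_eq_square)
      qed
    qed
    then show ?thesis using \<rho>(1) k(1) by (smt (verit) mult_nonneg_nonneg real_sqrt_ge_zero)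
  next
    case False
    then have p: "0 < \<rho>" "0 < k" using \<rho>(1) k(1) by auto
    \<comment> \<open>This choice makes the two summands of \<open>bound\<close> equal.\<close>
    define l where "l = sqrt 2 * k / \<rho>"
    have l: "0 < l" using p by (simp add: l_def)
    have "l\<^sup>2 * \<rho>\<^sup>2 / 2 = k\<^sup>2" using p by (simp add: l_def power_mult_distrib power_divide)
    then have "E \<le> 2 * k\<^sup>2 / l" using bound[OF l] l by (simp add: field_simps)
    also have "2 * k\<^sup>2 / l = sqrt 2 * \<rho> * k"
    proof -
      have "sqrt 2 * sqrt 2 = (2 :: real)" by simp
      then show ?thesis using p by (simp add: l_def field_simps power2_eq_square)
    qed
    finally show ?thesis .
  qed
  then show ?thesis by (simp add: E_def)
qed

text \<open>One link of a chain: \<open>q a\<close> is the point of the coarser level from which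
  \<open>a\<close> is reached. The increments are indexed by \<open>A\<close>, so only its size is
  paid for.\<close>

lemma massart_increment:
  fixes x q :: "'a \<Rightarrow> 'i \<Rightarrow> real"
  assumes I: "finite I" and A: "finite A" "A \<noteq> {}"
    and \<rho>: "0 \<le> \<rho>" "\<And>a. a \<in> A \<Longrightarrow> (\<Sum>i\<in>I. (x a i - q a i)\<^sup>2) \<le> \<rho>\<^sup>2"
    and k: "0 \<le> k" "real (card A) \<le> exp (k\<^sup>2)"
  shows "sign_avg I (\<lambda>s. Max ((\<lambda>a. \<Sum>i\<in>I. s i * x a i) ` A))
     \<le> sign_avg I (\<lambda>s. Max ((\<lambda>a. \<Sum>i\<in>I. s i * q a i) ` A)) + sqrt 2 * \<rho> * k"
proof -
  let ?m = "\<lambda>x s. Max ((\<lambda>a. \<Sum>i\<in>I. s i * x a i) ` A)"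
  let ?d = "\<lambda>a i. x a i - q a i"
  have "sign_avg I (?m x) \<le> sign_avg I (\<lambda>s. ?m q s + ?m ?d s)"
  proof (rule sign_avg_mono)
    fix s
    have "(\<Sum>i\<in>I. s i * x a i) \<le> ?m q s + ?m ?d s" if "a \<in> A" for a
    proof -
      have "(\<Sum>i\<in>I. s i * q a i) \<le> ?m q s" "(\<Sum>i\<in>I. s i * ?d a i) \<le> ?m ?d s"
        using A that by (auto intro!: Max_ge)
      moreover have "(\<Sum>i\<in>I. s i * x a i) = (\<Sum>i\<in>I. s i * q a i) + (\<Sum>i\<in>I. s i * ?d a i)"
        by (simp add: algebra_simps sum_subtractf)
      ultimately show ?thesis by linarith
    qed
    then show "?m x s \<le> ?m q s + ?m ?d s" using A by (auto intro!: Max.boundedI)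
  qed
  also have "\<dots> = sign_avg I (?m q) + sign_avg I (?m ?d)" by (rule sign_avg_add)
  also have "sign_avg I (?m ?d) \<le> sqrt 2 * \<rho> * k"
    by (rule massart) (use assms in auto)
  finally show ?thesis by simp
qed

text \<open>Each net at scale \<open>R / 2^n\<close> lies inside \<open>W\<close>, so its points are within \<open>R / 2^(n - 1)\<close> of
  the previous net: this makes the number of increments at level \<open>n\<close> the size of one net, not the
  product of the sizes of two.\<close>

theorem chaining:
  fixes x :: "'w \<Rightarrow> 'i \<Rightarrow> real"
  assumes I: "finite I" and R: "0 \<le> R"
    and center: "\<And>w. w \<in> W \<Longrightarrow> (\<Sum>i\<in>I. (x w i - z i)\<^sup>2) \<le> R\<^sup>2"
    and net: "\<And>n. 1 \<le> n \<Longrightarrow> finite (A n) \<and> A n \<noteq> {} \<and> A n \<subseteq> W \<and> real (card (A n)) \<le> exp ((k n)\<^sup>2)"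
    and dense: "\<And>n w. 1 \<le> n \<Longrightarrow> w \<in> W \<Longrightarrow> \<exists>a\<in>A n. (\<Sum>i\<in>I. (x w i - x a i)\<^sup>2) \<le> (R / 2 ^ n)\<^sup>2"
    and k: "\<And>n. 0 \<le> k n" "\<And>m. (\<Sum>n=1..m. k n / 2 ^ n) \<le> b"
    and h: "\<And>j. h j \<in> W"
  shows "sign_avg I (\<lambda>s. SUP j. \<Sum>i\<in>I. s i * x (h j) i) \<le> 2 * sqrt 2 * R * b"
proof -
  let ?X = "\<lambda>s a. \<Sum>i\<in>I. s i * x a i"
  let ?m = "\<lambda>n s. Max (?X s ` A n)"
  have level: "sign_avg I (?m (Suc m)) \<le> 2 * sqrt 2 * R * (\<Sum>n=1..Suc m. k n / 2 ^ n)" for m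
  proof (induction m)
    \<comment> \<open>Level zero is the single vector \<open>z\<close>, whose signed sum averages to
      0. The link has radius \<open>R\<close>, that is \<open>2 * (R / 2)\<close>, in keeping with
      the factor 2 of the later links.\<close>
    case 0
    have "sign_avg I (?m 1) \<le> sign_avg I (\<lambda>s. Max ((\<lambda>a. \<Sum>i\<in>I. s i * z i) ` A 1)) + sqrt 2 * R * k 1"
      by (rule massart_increment[OF I]) (use net[of 1] center R k in auto)
    also have "(\<lambda>s. Max ((\<lambda>a. \<Sum>i\<in>I. s i * z i) ` A 1)) = (\<lambda>s. \<Sum>i\<in>I. s i * z i)"
      using net[of 1] by (simp add: image_constant_conv)
    finally show ?case by (simp add: sign_avg_linear[OF I])
  next
    case (Suc m)
    have "\<forall>w\<in>W. \<exists>a. a \<in> A (Suc m) \<and> (\<Sum>i\<in>I. (x w i - x a i)\<^sup>2) \<le> (R / 2 ^ Suc m)\<^sup>2"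
      using dense[of "Suc m"] by (auto simp: Bex_def)
    then obtain p where p: "\<And>w. w \<in> W \<Longrightarrow> p w \<in> A (Suc m)"
        "\<And>w. w \<in> W \<Longrightarrow> (\<Sum>i\<in>I. (x w i - x (p w) i)\<^sup>2) \<le> (R / 2 ^ Suc m)\<^sup>2"
      by metis
    have A2: "finite (A (Suc (Suc m)))" "A (Suc (Suc m)) \<noteq> {}" "A (Suc (Suc m)) \<subseteq> W"
        "real (card (A (Suc (Suc m)))) \<le> exp ((k (Suc (Suc m)))\<^sup>2)"
      using net[of "Suc (Suc m)"] by auto
    \<comment> \<open>A link is as long as the mesh of the coarser net, \<open>R / 2^Suc m\<close>,
      which is twice \<open>R / 2^Suc (Suc m)\<close>; this is the 2 in
      \<open>2 * sqrt 2\<close>.\<close>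
    have "sign_avg I (?m (Suc (Suc m)))
       \<le> sign_avg I (\<lambda>s. Max ((\<lambda>a. ?X s (p a)) ` A (Suc (Suc m)))) + sqrt 2 * (R / 2 ^ Suc m) * k (Suc (Suc m))"
      by (rule massart_increment[OF I A2(1,2) _ _ k(1) A2(4)]) (use A2(3) p(2) R in auto)
    \<comment> \<open>The projected points \<open>p a\<close> belong to the coarser net, so its
      maximum dominates theirs.\<close>
    also have "sign_avg I (\<lambda>s. Max ((\<lambda>a. ?X s (p a)) ` A (Suc (Suc m)))) \<le> sign_avg I (?m (Suc m))"
    proof (rule sign_avg_mono)
      fix s
      show "Max ((\<lambda>a. ?X s (p a)) ` A (Suc (Suc m))) \<le> ?m (Suc m) s"
        using A2 p(1) net[of "Suc m"] by (intro Max_mono) auto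
    qed
    also note Suc.IH
    finally show ?case by (simp add: algebra_simps)
  qed
  \<comment> \<open>The infinite family is compared with the net of level \<open>Suc m\<close> by
    the Cauchy-Schwarz inequality; the error vanishes as \<open>m\<close> grows, while the chaining
    bound does not depend on \<open>m\<close>.\<close>
  have final: "sign_avg I (\<lambda>s. SUP j. ?X s (h j)) \<le> 2 * sqrt 2 * R * b + sqrt (real (card I)) * R / 2 ^ Suc m" for m
  proof -
    let ?r = "sqrt (real (card I)) * R / 2 ^ Suc m"
    have "sign_avg I (\<lambda>s. SUP j. ?X s (h j)) \<le> sign_avg I (\<lambda>s. ?m (Suc m) s + ?r)"
    proof (rule sign_avg_mono)
      fix s assume s: "s \<in> PiE I (\<lambda>_. {-1, 1 :: real})"
      show "(SUP j. ?X s (h j)) \<le> ?m (Suc m) s + ?r"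
      proof (rule cSUP_least)
        fix j
        obtain a where a: "a \<in> A (Suc m)" "(\<Sum>i\<in>I. (x (h j) i - x a i)\<^sup>2) \<le> (R / 2 ^ Suc m)\<^sup>2"
          using dense[OF _ h, of "Suc m" j] by auto
        have "(\<Sum>i\<in>I. (s i)\<^sup>2) = (\<Sum>i\<in>I. 1)"
        proof (rule sum.cong[OF refl])
          fix i assume "i \<in> I"
          have "(s i)\<^sup>2 = \<bar>s i\<bar>\<^sup>2" by simp
          then show "(s i)\<^sup>2 = 1" unfolding abs_sign[OF s \<open>i \<in> I\<close>] by simp
        qed
        then have ss: "(\<Sum>i\<in>I. (s i)\<^sup>2) = real (card I)" by simp
        have "(\<Sum>i\<in>I. s i * (x (h j) i - x a i))\<^sup>2 \<le> real (card I) * (R / 2 ^ Suc m)\<^sup>2"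
          using Cauchy_Schwarz_ineq_sum[of s "\<lambda>i. x (h j) i - x a i" I] mult_left_mono[OF a(2), of "real (card I)"]
          unfolding ss by linarith
        then have "(\<Sum>i\<in>I. s i * (x (h j) i - x a i)) \<le> sqrt (real (card I) * (R / 2 ^ Suc m)\<^sup>2)"
          by (rule real_le_rsqrt)
        also have "\<dots> = ?r" using R by (simp add: real_sqrt_mult real_sqrt_divide)
        finally have "?X s (h j) \<le> ?X s a + ?r"
          by (simp add: algebra_simps sum_subtractf)
        moreover have "?X s a \<le> ?m (Suc m) s" using a(1) net[of "Suc m"] by (intro Max_ge) auto
        ultimately show "?X s (h j) \<le> ?m (Suc m) s + ?r" by linarith
      qed simp
    qed
    also have "\<dots> = sign_avg I (?m (Suc m)) + ?r"
      by (simp only: sign_avg_add sign_avg_const[OF I])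
    also have "sign_avg I (?m (Suc m)) \<le> 2 * sqrt 2 * R * b"
      by (rule order_trans[OF level mult_left_mono[OF k(2)]]) (use R in simp)
    finally show ?thesis by simp
  qed
  have "(\<lambda>m. 2 * sqrt 2 * R * b + sqrt (real (card I)) * R / 2 ^ Suc m) \<longlonglongrightarrow> 2 * sqrt 2 * R * b + 0"
    by (intro tendsto_add tendsto_const LIMSEQ_Suc) (rule LIMSEQ_divide_realpow_zero, simp)
  then show ?thesis
    by (intro LIMSEQ_le_const) (use final in auto)
qed

section \<open>Sums of entropies over the dyadic scales\<close>

lemma sum_inverse_powers_2: "(\<Sum>n=1..m. 1 / 2 ^ n) = (1 :: real) - 1 / 2 ^ m" for m :: nat
  by (induction m) (auto simp: field_simps)

lemma sum_linear_powers_2: "(\<Sum>n=1..m. real n / 2 ^ n) = 2 - (real m + 2) / 2 ^ m"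
  by (induction m) (auto simp: field_simps)

text \<open>\<open>1 + 2^n * x <= 2^n * (1 + x)\<close> bounds the logarithm by
  \<open>n * ln 2 + ln (1 + x)\<close>. Under the weights \<open>2^-n\<close> the sum of these
  bounds is at most \<open>2 * ln 2 + ln (1 + x) <= 2 * l\<close>; Jensen's inequality for the
  square root then gives \<open>sqrt (2 * l)\<close>. It is applied in the form of the tangent at
  \<open>2 * l\<close>, which avoids normalizing the partial sums of the weights.\<close>

lemma sum_sqrt_ln_powers_2:
  fixes x :: real
  assumes x: "0 \<le> x"
  shows "(\<Sum>n=1..m. sqrt (ln (1 + 2 ^ n * x)) / 2 ^ n) \<le> sqrt 2 * sqrt (ln (exp 1 * (1 + x)))"
proof -
  define l where "l = ln (exp 1 * (1 + x))"
  have l: "l = 1 + ln (1 + x)" using x by (simp add: l_def ln_mult)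
  have lnx: "0 \<le> ln (1 + x)" using x by simp
  have L: "0 < 2 * l" using l lnx by linarith
  have ln: "ln (1 + 2 ^ n * x) \<le> real n * ln 2 + ln (1 + x)" for n :: nat
  proof -
    have "1 + 2 ^ n * x \<le> 2 ^ n * (1 + x)" using x by (simp add: algebra_simps)
    moreover have "0 < 1 + 2 ^ n * x" using x by (simp add: add_pos_nonneg)
    ultimately have "ln (1 + 2 ^ n * x) \<le> ln (2 ^ n * (1 + x))" by simp
    also have "\<dots> = real n * ln 2 + ln (1 + x)" using x by (simp add: ln_mult ln_realpow)
    finally show ?thesis .
  qed
  have tangent: "sqrt u \<le> (u + 2 * l) / (2 * sqrt (2 * l))" if "0 \<le> u" for u
  proof -
    have "0 \<le> (sqrt u - sqrt (2 * l))\<^sup>2" by simp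
    then have "2 * (sqrt u * sqrt (2 * l)) \<le> u + 2 * l"
      using that L by (simp add: power2_diff)
    then show ?thesis using L by (simp add: field_simps)
  qed
  have "(\<Sum>n=1..m. sqrt (ln (1 + 2 ^ n * x)) / 2 ^ n)
      \<le> (\<Sum>n=1..m. (real n * ln 2 + ln (1 + x) + 2 * l) / (2 * sqrt (2 * l)) / 2 ^ n)"
  proof (intro sum_mono divide_right_mono)
    fix n :: nat
    have "0 \<le> ln (1 + 2 ^ n * x)" using x by simp
    from tangent[OF this] show "sqrt (ln (1 + 2 ^ n * x)) \<le> (real n * ln 2 + ln (1 + x) + 2 * l) / (2 * sqrt (2 * l))"
      by (rule order_trans) (use ln[of n] L in \<open>intro divide_right_mono; simp\<close>)
  qed simp
  also have "\<dots> = (ln 2 * (\<Sum>n=1..m. real n / 2 ^ n) + (ln (1 + x) + 2 * l) * (\<Sum>n=1..m. 1 / 2 ^ n)) / (2 * sqrt (2 * l))"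
    by (simp add: sum_distrib_left sum_divide_distrib flip: sum.distrib) (auto simp: add_divide_distrib algebra_simps intro!: sum.cong)
  also have "\<dots> \<le> (2 * l + 2 * l) / (2 * sqrt (2 * l))"
  proof (rule divide_right_mono)
    have "ln 2 * (\<Sum>n=1..m. real n / 2 ^ n) + (ln (1 + x) + 2 * l) * (\<Sum>n=1..m. 1 / 2 ^ n)
        \<le> ln 2 * 2 + (ln (1 + x) + 2 * l) * 1"
      unfolding sum_linear_powers_2 sum_inverse_powers_2 using lnx L
      by (intro add_mono mult_left_mono) auto
    also have "\<dots> \<le> 2 * l + 2 * l"
      using l lnx ln_2_less_1 by simp
    finally show "ln 2 * (\<Sum>n=1..m. real n / 2 ^ n) + (ln (1 + x) + 2 * l) * (\<Sum>n=1..m. 1 / 2 ^ n) \<le> 2 * l + 2 * l" .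
  qed (use L in simp)
  also have "\<dots> = sqrt (2 * l)"
  proof -
    define r where "r = sqrt (2 * l)"
    have "2 * l = r * r" "0 < r"
      using L unfolding r_def by (simp_all only: real_sqrt_mult_self abs_of_pos real_sqrt_gt_zero)
    then show ?thesis unfolding r_def[symmetric] by (simp add: field_simps)
  qed
  also have "\<dots> = sqrt 2 * sqrt l" by (simp add: real_sqrt_mult)
  finally show ?thesis by (simp add: l_def)
qed

section \<open>Nets in finite-dimensional norms\<close>

text \<open>The dimension is a number and not a type, so volume is a finite product of
  \<open>lborel\<close>. A finite product measure is determined by boxes, and on a box the claim is
  the one-dimensional scaling in each coordinate.\<close>

lemma PiM_lborel_affine:
  fixes I :: "'i set" and d :: "'i \<Rightarrow> real"
  assumes I: "finite I" and m: "0 < m" and A: "A \<in> sets (PiM I (\<lambda>_. lborel))"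
  shows "emeasure (PiM I (\<lambda>_. lborel)) A
     = ennreal (m ^ card I) * emeasure (PiM I (\<lambda>_. lborel))
         ((\<lambda>v. \<lambda>i\<in>I. d i + m * v i) -` A \<inter> space (PiM I (\<lambda>_. lborel)))"
proof -
  let ?P = "PiM I (\<lambda>_. lborel :: real measure)"
  let ?T = "\<lambda>v. \<lambda>i\<in>I. d i + m * v i"
  interpret product_sigma_finite "\<lambda>_ :: 'i. lborel :: real measure" ..
  have T: "?T \<in> measurable ?P ?P" by measurable
  have "scale_measure (ennreal (m ^ card I)) (distr ?P ?P ?T) = ?P"
  proof (rule PiM_eqI[OF I])
    fix A :: "'i \<Rightarrow> real set" assume A: "\<And>i. i \<in> I \<Longrightarrow> A i \<in> sets lborel"
    have box: "PiE I A \<in> sets ?P" using A I by (intro sets_PiM_I_finite) auto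
    have Ai: "(\<lambda>x. d i + m * x) -` A i \<in> sets lborel" if "i \<in> I" for i
      using measurable_sets_borel[of "\<lambda>x. d i + m * x" borel "A i"] A[OF that] by simp
    have pre: "?T -` PiE I A \<inter> space ?P = PiE I (\<lambda>i. (\<lambda>x. d i + m * x) -` A i)"
      by (auto simp: space_PiM PiE_iff)
    have one: "ennreal m * emeasure lborel ((\<lambda>x. d i + m * x) -` A i) = emeasure lborel (A i)" if "i \<in> I" for i
    proof -
      have Ab: "A i \<in> sets borel" using A[OF that] by simp
      have "emeasure lborel (A i) = emeasure (density (distr lborel borel (\<lambda>x. d i + m * x)) (\<lambda>_. ennreal \<bar>m\<bar>)) (A i)"
        using lborel_real_affine[of m "d i"] m by simp
      also have "\<dots> = ennreal m * emeasure (distr lborel borel (\<lambda>x. d i + m * x)) (A i)"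
        using Ab m by (simp add: emeasure_density_const)
      also have "\<dots> = ennreal m * emeasure lborel ((\<lambda>x. d i + m * x) -` A i)"
        using Ab by (simp add: emeasure_distr)
      finally show ?thesis by simp
    qed
    have "emeasure (scale_measure (ennreal (m ^ card I)) (distr ?P ?P ?T)) (PiE I A)
        = ennreal (m ^ card I) * (\<Prod>i\<in>I. emeasure lborel ((\<lambda>x. d i + m * x) -` A i))"
      using box T I Ai by (simp add: emeasure_distr pre emeasure_PiM)
    also have "\<dots> = (\<Prod>i\<in>I. ennreal m * emeasure lborel ((\<lambda>x. d i + m * x) -` A i))"
      using m by (simp add: prod.distrib ennreal_power)
    also have "\<dots> = (\<Prod>i\<in>I. emeasure lborel (A i))"
      by (rule prod.cong) (auto simp: one)
    finally show "emeasure (scale_measure (ennreal (m ^ card I)) (distr ?P ?P ?T)) (PiE I A)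
        = (\<Prod>i\<in>I. emeasure lborel (A i))" .
  qed simp
  then have "emeasure ?P A = emeasure (scale_measure (ennreal (m ^ card I)) (distr ?P ?P ?T)) A" by simp
  then show ?thesis using A T by (simp add: emeasure_distr)
qed

locale coord_norm =
  fixes a :: nat and N :: "(nat \<Rightarrow> real) \<Rightarrow> real"
  assumes norm_N: "is_norm_on_Rn a N"
begin

text \<open>\<open>N\<close> is controlled only on functions that vanish from \<open>a\<close> on,
  while the points of \<open>vol\<close> are \<open>undefined\<close> there. Cutting makes one
  function \<open>gauge\<close> meaningful for both, and for differences between them.\<close>

definition cut :: "(nat \<Rightarrow> real) \<Rightarrow> nat \<Rightarrow> real" where
  "cut x = (\<lambda>i. if i < a then x i else 0)"

definition gauge :: "(nat \<Rightarrow> real) \<Rightarrow> real" where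
  "gauge x = N (cut x)"

lemma cut_space [simp]: "cut x \<in> topspace (Euclidean_space a)"
  by (simp add: cut_def topspace_Euclidean_space)

lemma cut_id: "x \<in> topspace (Euclidean_space a) \<Longrightarrow> cut x = x"
  by (auto simp: cut_def topspace_Euclidean_space fun_eq_iff)

lemma gauge_nonneg: "0 \<le> gauge x"
  using norm_N by (simp add: is_norm_on_Rn_def gauge_def)

lemma gauge_eq_0: "gauge x = 0 \<longleftrightarrow> (\<forall>i<a. x i = 0)"
  using norm_N by (simp add: is_norm_on_Rn_def gauge_def) (auto simp: cut_def fun_eq_iff)

lemma gauge_scale: "gauge (\<lambda>i. s * x i) = \<bar>s\<bar> * gauge x"
proof -
  have "cut (\<lambda>i. s * x i) = (\<lambda>i. s * cut x i)" by (auto simp: cut_def)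
  then show ?thesis using norm_N by (simp add: is_norm_on_Rn_def gauge_def)
qed

lemma gauge_triangle: "gauge (\<lambda>i. x i + y i) \<le> gauge x + gauge y"
proof -
  have "cut (\<lambda>i. x i + y i) = (\<lambda>i. cut x i + cut y i)" by (auto simp: cut_def)
  then show ?thesis using norm_N by (simp add: is_norm_on_Rn_def gauge_def)
qed

lemma gauge_cong: "(\<And>i. i < a \<Longrightarrow> x i = y i) \<Longrightarrow> gauge x = gauge y"
  unfolding gauge_def by (intro arg_cong[of _ _ N]) (auto simp: cut_def)

lemma gauge_diff_commute: "gauge (\<lambda>i. x i - y i) = gauge (\<lambda>i. y i - x i)"
  using gauge_scale[of "-1" "\<lambda>i. x i - y i"] by simp

lemma gauge_triangle_diff: "gauge (\<lambda>i. x i - z i) \<le> gauge (\<lambda>i. x i - y i) + gauge (\<lambda>i. y i - z i)"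
  using gauge_triangle[of "\<lambda>i. x i - y i" "\<lambda>i. y i - z i"] by simp

definition unit :: "nat \<Rightarrow> nat \<Rightarrow> real" where "unit i j = (if j = i then 1 else 0)"

lemma gauge_le_sum: "gauge x \<le> (\<Sum>i<a. \<bar>x i\<bar> * gauge (unit i))"
proof -
  have *: "gauge (\<lambda>j. \<Sum>i\<in>I. x i * unit i j) \<le> (\<Sum>i\<in>I. \<bar>x i\<bar> * gauge (unit i))" if "finite I" for I
    using that
  proof (induction I rule: finite_induct)
    case empty
    show ?case using gauge_eq_0[of "\<lambda>_. 0"] by simp
  next
    case (insert i I)
    then show ?case
      using gauge_triangle[of "\<lambda>j. x i * unit i j" "\<lambda>j. \<Sum>i\<in>I. x i * unit i j"]
        gauge_scale[of "x i" "unit i"] by simp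
  qed
  have "gauge x = gauge (\<lambda>j. \<Sum>i<a. x i * unit i j)"
    by (rule gauge_cong) (simp add: unit_def if_distrib cong: if_cong)
  then show ?thesis using *[of "{..<a}"] by simp
qed

text \<open>Only the first \<open>a\<close> coordinates matter, and by \<open>gauge_le_sum\<close>
  they dominate the difference of two gauges; the topology is that of the infinite product.\<close>

lemma continuous_gauge: "continuous_on UNIV gauge"
  unfolding continuous_on_eq_continuous_at[OF open_UNIV] isCont_def
proof (intro ballI)
  fix x :: "nat \<Rightarrow> real"
  have c: "((\<lambda>y. y i) \<longlongrightarrow> x i) (at x)" for i
  proof -
    have "continuous_on UNIV (\<lambda>y :: nat \<Rightarrow> real. y i)"
      by (rule continuous_on_product_coordinates)
    then show ?thesis
      unfolding continuous_on_eq_continuous_at[OF open_UNIV] isCont_def by blast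
  qed
  have "((\<lambda>y. \<Sum>i<a. \<bar>y i - x i\<bar> * gauge (unit i)) \<longlongrightarrow> (\<Sum>i<a. \<bar>x i - x i\<bar> * gauge (unit i))) (at x)"
    by (intro tendsto_intros c)
  then have z: "((\<lambda>y. \<Sum>i<a. \<bar>y i - x i\<bar> * gauge (unit i)) \<longlongrightarrow> 0) (at x)" by simp
  have "((\<lambda>y. gauge y - gauge x) \<longlongrightarrow> 0) (at x)"
  proof (rule Lim_null_comparison[OF _ z], rule always_eventually, intro allI)
    fix y
    have "gauge y \<le> gauge (\<lambda>i. y i - x i) + gauge x" "gauge x \<le> gauge (\<lambda>i. x i - y i) + gauge y"
      using gauge_triangle[of "\<lambda>i. y i - x i" x] gauge_triangle[of "\<lambda>i. x i - y i" y] by simp_all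
    then have "\<bar>gauge y - gauge x\<bar> \<le> gauge (\<lambda>i. y i - x i)"
      using gauge_diff_commute[of x y] by linarith
    also have "\<dots> \<le> (\<Sum>i<a. \<bar>y i - x i\<bar> * gauge (unit i))" by (rule gauge_le_sum)
    finally show "norm (gauge y - gauge x) \<le> (\<Sum>i<a. \<bar>y i - x i\<bar> * gauge (unit i))" by simp
  qed
  then show "(gauge \<longlongrightarrow> gauge x) (at x)" by (simp add: LIM_zero_iff)
qed

text \<open>Equivalence of norms: the unit sphere of the l1 norm is compact, so \<open>gauge\<close>
  has a positive minimum on it, if it is nonempty; scaling does the rest.\<close>

lemma coord_le_gauge: "\<exists>k>0. \<forall>x. \<forall>i<a. \<bar>x i\<bar> \<le> k * gauge x"
proof -
  \<comment> \<open>The factors \<open>{0}\<close> beyond the dimension make the sphere compact in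
    the infinite product without affecting \<open>gauge\<close>.\<close>
  define Q where "Q = PiE UNIV (\<lambda>i. if i < a then {-1..1::real} else {0})"
  define Sph where "Sph = Q \<inter> {x. (\<Sum>i<a. \<bar>x i\<bar>) = 1}"
  have "compactin (product_topology (\<lambda>i. euclidean) UNIV) Q"
    unfolding Q_def by (simp add: compactin_PiE)
  then have "compact Q" by (simp add: euclidean_product_topology)
  moreover have "closed {x :: nat \<Rightarrow> real. (\<Sum>i<a. \<bar>x i\<bar>) = 1}"
    by (intro closed_Collect_eq continuous_intros continuous_on_product_coordinates)
  ultimately have comp: "compact Sph" unfolding Sph_def by (rule compact_Int_closed)
  have unit_sphere: "\<exists>m>0. \<forall>y\<in>Sph. m \<le> gauge y"
  proof (cases "Sph = {}")
    case True then show ?thesis by (auto intro: exI[of _ 1])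
  next
    case False
    obtain x where x: "x \<in> Sph" "\<forall>y\<in>Sph. gauge x \<le> gauge y"
      using continuous_attains_inf[OF comp False continuous_on_subset[OF continuous_gauge]] by blast
    have "(\<Sum>i<a. \<bar>x i\<bar>) \<noteq> 0" using x(1) by (simp add: Sph_def)
    then have "gauge x \<noteq> 0" unfolding gauge_eq_0 by (metis abs_zero lessThan_iff sum.neutral)
    then show ?thesis using x(2) gauge_nonneg[of x] by (intro exI[of _ "gauge x"]) auto
  qed
  then obtain m where m: "0 < m" "\<And>y. y \<in> Sph \<Longrightarrow> m \<le> gauge y" by blast
  have "\<bar>x i\<bar> \<le> 1 / m * gauge x" if i: "i < a" for x i
  proof -
    define s where "s = (\<Sum>i<a. \<bar>x i\<bar>)"
    have xs: "\<bar>x j\<bar> \<le> s" if "j < a" for j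
      unfolding s_def using that by (intro member_le_sum) auto
    show ?thesis
    proof (cases "s = 0")
      case True
      then show ?thesis using xs[OF i] m gauge_nonneg[of x] by simp
    next
      case False
      then have s: "0 < s" using xs[OF i] by linarith
      have "cut (\<lambda>j. inverse s * x j) \<in> Sph"
      proof -
        have "(\<Sum>j<a. \<bar>cut (\<lambda>j. inverse s * x j) j\<bar>) = inverse s * (\<Sum>j<a. \<bar>x j\<bar>)"
          using s by (simp add: cut_def sum_distrib_left abs_mult)
        moreover have "\<bar>inverse s * x j\<bar> \<le> 1" if "j < a" for j
          using xs[OF that] s by (simp add: abs_mult field_simps)
        ultimately show ?thesis
          using s by (auto simp: Sph_def Q_def s_def[symmetric] PiE_iff cut_def abs_le_iff minus_le_iff)
      qed
      then have "m \<le> gauge (cut (\<lambda>j. inverse s * x j))" by (rule m)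
      also have "\<dots> = gauge (\<lambda>j. inverse s * x j)" by (rule gauge_cong) (simp add: cut_def)
      also have "\<dots> = inverse s * gauge x" using s by (simp add: gauge_scale)
      finally have "s \<le> 1 / m * gauge x" using s m by (simp add: field_simps)
      then show ?thesis using xs[OF i] by linarith
    qed
  qed
  then show ?thesis using m(1) by (intro exI[of _ "1 / m"]) auto
qed

abbreviation vol :: "(nat \<Rightarrow> real) measure" where
  "vol \<equiv> PiM {..<a} (\<lambda>_. lborel)"

definition gball :: "(nat \<Rightarrow> real) \<Rightarrow> real \<Rightarrow> (nat \<Rightarrow> real) set" where
  "gball x r = {v \<in> space vol. gauge (\<lambda>i. v i - x i) < r}"

lemma gball_sets: "gball x r \<in> sets vol"
proof -
  have "(\<lambda>v. cut (\<lambda>i. v i - x i)) \<in> borel_measurable vol"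
  proof (rule measurable_coordinatewise_then_product)
    fix i show "(\<lambda>v. cut (\<lambda>i. v i - x i) i) \<in> borel_measurable vol"
      by (cases "i < a") (auto simp: cut_def)
  qed
  then have "(\<lambda>v. gauge (cut (\<lambda>i. v i - x i))) \<in> borel_measurable vol"
    by (rule measurable_compose) (rule borel_measurable_continuous_onI[OF continuous_gauge])
  moreover have "gauge (cut y) = gauge y" for y by (rule gauge_cong) (simp add: cut_def)
  ultimately have [measurable]: "(\<lambda>v. gauge (\<lambda>i. v i - x i)) \<in> borel_measurable vol" by simp
  show ?thesis unfolding gball_def by measurable
qed

lemma emeasure_gball:
  assumes "0 < r"
  shows "emeasure vol (gball x r) = ennreal (r ^ a) * emeasure vol (gball (\<lambda>_. 0) 1)"
proof -
  have "(\<lambda>v. \<lambda>i\<in>{..<a}. x i + r * v i) -` gball x r \<inter> space vol = gball (\<lambda>_. 0) 1"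
  proof -
    have "gauge (\<lambda>i. (\<lambda>i\<in>{..<a}. x i + r * v i) i - x i) = r * gauge v" for v
      using gauge_scale[of r v] assms by (subst gauge_cong[of _ "\<lambda>i. r * v i"]) auto
    then show ?thesis using assms by (auto simp: gball_def space_PiM)
  qed
  then show ?thesis
    using PiM_lborel_affine[OF finite_lessThan assms gball_sets, where d = x] by simp
qed

lemma emeasure_gball_finite: "emeasure vol (gball x r) \<noteq> \<infinity>"
proof -
  interpret product_sigma_finite "\<lambda>_ :: nat. lborel :: real measure" ..
  obtain k where k: "0 < k" "\<And>x i. i < a \<Longrightarrow> \<bar>x i\<bar> \<le> k * gauge x" using coord_le_gauge by blast
  have "gball x r \<subseteq> PiE {..<a} (\<lambda>i. {x i - k * r..x i + k * r})"
  proof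
    fix v assume v: "v \<in> gball x r"
    have "\<bar>v i - x i\<bar> \<le> k * r" if "i < a" for i
    proof -
      have "\<bar>v i - x i\<bar> \<le> k * gauge (\<lambda>i. v i - x i)" by (rule k(2)[OF that])
      also have "\<dots> \<le> k * r" using v k(1) by (intro mult_left_mono) (auto simp: gball_def)
      finally show ?thesis .
    qed
    then show "v \<in> PiE {..<a} (\<lambda>i. {x i - k * r..x i + k * r})"
      using v by (auto simp: gball_def space_PiM PiE_iff abs_le_iff algebra_simps)
  qed
  then have "emeasure vol (gball x r) \<le> emeasure vol (PiE {..<a} (\<lambda>i. {x i - k * r..x i + k * r}))"
    by (intro emeasure_mono sets_PiM_I_finite) auto
  also have "\<dots> = (\<Prod>i<a. emeasure lborel {x i - k * r..x i + k * r})" by (rule emeasure_PiM) auto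
  also have "\<dots> < \<infinity>" by (simp add: emeasure_lborel_Icc_eq prod_ennreal)
  finally show ?thesis by simp
qed

text \<open>A null unit ball would make all its dilates null, and with them the whole space, whose
  measure is infinite, or 1 when \<open>a = 0\<close>.\<close>

lemma emeasure_unit_gball_pos: "emeasure vol (gball (\<lambda>_. 0) 1) \<noteq> 0"
proof
  assume z: "emeasure vol (gball (\<lambda>_. 0) 1) = 0"
  interpret product_sigma_finite "\<lambda>_ :: nat. lborel :: real measure" ..
  have "space vol \<subseteq> (\<Union>n. gball (\<lambda>_. 0) (real (Suc n)))"
  proof
    fix v assume v: "v \<in> space vol"
    obtain n where "gauge v < real n" using reals_Archimedean2 by blast
    then have "v \<in> gball (\<lambda>_. 0) (real (Suc n))" using v by (simp add: gball_def)
    then show "v \<in> (\<Union>n. gball (\<lambda>_. 0) (real (Suc n)))" by blast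
  qed
  moreover have "(\<Union>n. gball (\<lambda>_. 0) (real (Suc n))) \<in> null_sets vol"
  proof (rule null_sets_UN)
    fix n
    show "gball (\<lambda>_. 0) (real (Suc n)) \<in> null_sets vol"
    proof (rule null_setsI)
      show "emeasure vol (gball (\<lambda>_. 0) (real (Suc n))) = 0"
        using emeasure_gball[of "real (Suc n)" "\<lambda>_. 0"] z by simp
    qed (rule gball_sets)
  qed
  ultimately have "space vol \<in> null_sets vol"
    by (metis null_sets_subset sets.top)
  moreover have "emeasure vol (space vol) = (\<Prod>i<a. emeasure lborel (UNIV :: real set))"
    unfolding space_PiM by (subst emeasure_PiM) auto
  ultimately show False by (auto simp: null_sets_def)
qed

text \<open>Balls of radius \<open>d = 1 / (2 * t)\<close> around the points are disjoint and lie in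
  the ball of radius \<open>r + d\<close>, so \<open>card S * d^a <= (r + d)^a\<close>, the volume
  of the unit ball cancelling.\<close>

lemma packing_card:
  assumes S: "finite S" "\<And>s. s \<in> S \<Longrightarrow> gauge s \<le> r" and r: "0 \<le> r" and t: "0 < t"
    and sep: "\<And>s s'. s \<in> S \<Longrightarrow> s' \<in> S \<Longrightarrow> s \<noteq> s' \<Longrightarrow> 1 < t * gauge (\<lambda>i. s i - s' i)"
  shows "real (card S) \<le> (1 + 2 * r * t) ^ a"
proof -
  define d where "d = 1 / (2 * t)"
  have d: "0 < d" using t by (simp add: d_def)
  define V where "V = measure vol (gball (\<lambda>_. 0) 1)"
  have V: "emeasure vol (gball (\<lambda>_. 0) 1) = ennreal V" "0 < V"
    using emeasure_gball_finite[of "\<lambda>_. 0" 1] emeasure_unit_gball_pos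
    by (simp_all add: V_def emeasure_eq_ennreal_measure zero_less_measure_iff)
  have ball: "emeasure vol (gball x r) = ennreal (r ^ a * V)" if "0 < r" for x r
    using that V(2) unfolding emeasure_gball[OF that] V(1) by (simp add: ennreal_mult)
  have disj: "disjoint_family_on (\<lambda>s. gball s d) S"
    unfolding disjoint_family_on_def
  proof (intro ballI impI)
    fix s s' assume s: "s \<in> S" "s' \<in> S" "s \<noteq> s'"
    show "gball s d \<inter> gball s' d = {}"
    proof (rule ccontr)
      assume "gball s d \<inter> gball s' d \<noteq> {}"
      then obtain v where v: "gauge (\<lambda>i. v i - s i) < d" "gauge (\<lambda>i. v i - s' i) < d"
        by (auto simp: gball_def)
      have "gauge (\<lambda>i. s i - s' i) < 2 * d"
        using gauge_triangle_diff[of s s' v] gauge_diff_commute[of v s] v by linarith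
      then have "t * gauge (\<lambda>i. s i - s' i) < t * (2 * d)" using t by simp
      then show False using sep[OF s] t by (simp add: d_def)
    qed
  qed
  have "(\<Union>s\<in>S. gball s d) \<subseteq> gball (\<lambda>_. 0) (r + d)"
  proof (safe)
    fix s v assume "s \<in> S" "v \<in> gball s d"
    then show "v \<in> gball (\<lambda>_. 0) (r + d)"
      using gauge_triangle[of "\<lambda>i. v i - s i" s] S(2)[of s] by (simp add: gball_def)
  qed
  then have "emeasure vol (\<Union>s\<in>S. gball s d) \<le> emeasure vol (gball (\<lambda>_. 0) (r + d))"
    by (intro emeasure_mono gball_sets)
  also have "emeasure vol (\<Union>s\<in>S. gball s d) = (\<Sum>s\<in>S. emeasure vol (gball s d))"
  proof (rule sum_emeasure[symmetric])
    show "(\<lambda>s. gball s d) ` S \<subseteq> sets vol" using gball_sets by blast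
  qed (fact disj S(1))+
  also have "\<dots> = ennreal (real (card S) * (d ^ a * V))"
    using V(2) d unfolding ball[OF d]
    by (simp add: ennreal_of_nat_eq_real_of_nat ennreal_mult)
  also have "emeasure vol (gball (\<lambda>_. 0) (r + d)) = ennreal ((r + d) ^ a * V)"
    by (rule ball) (use r d in simp)
  finally have "real (card S) * (d ^ a * V) \<le> (r + d) ^ a * V"
    using r d V(2) by (subst (asm) ennreal_le_iff) auto
  then have "real (card S) * d ^ a \<le> (r + d) ^ a"
    using V(2) by (simp add: mult.assoc[symmetric])
  then have "real (card S) \<le> (r + d) ^ a / d ^ a" using d by (simp add: field_simps)
  also have "\<dots> = ((r + d) / d) ^ a" by (simp add: power_divide)
  also have "(r + d) / d = 1 + 2 * r * t" using t by (simp add: d_def field_simps)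
  finally show ?thesis .
qed

text \<open>A separated set of maximal size is a net, for otherwise a point could be added; the
  packing bound provides the maximum. \<open>X\<close> is any nonempty subset of the ball and the
  net lies in it, as chaining requires. The mesh is written \<open>t * N <= 1\<close> rather than
  with \<open>1 / t\<close>, since \<open>t\<close> will be proportional to a Lipschitz constant,
  which may be 0.\<close>

lemma finite_net:
  assumes X: "X \<subseteq> param_ball a N r" "X \<noteq> {}" and t: "0 \<le> t"
  shows "\<exists>S. finite S \<and> S \<noteq> {} \<and> S \<subseteq> X \<and> real (card S) \<le> (1 + 2 * r * t) ^ a \<and>
    (\<forall>x\<in>X. \<exists>s\<in>S. t * N (\<lambda>i. x i - s i) \<le> 1)"
proof (cases "t = 0")
  case True
  obtain x where "x \<in> X" using X(2) by blast
  then show ?thesis using True by (intro exI[of _ "{x}"]) auto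
next
  case False
  then have t: "0 < t" using t by simp
  have Xs: "x \<in> topspace (Euclidean_space a)" "gauge x \<le> r" if "x \<in> X" for x
  proof -
    show "x \<in> topspace (Euclidean_space a)" using X(1) that by (auto simp: param_ball_def)
    then show "gauge x \<le> r" using X(1) that by (auto simp: param_ball_def gauge_def cut_id)
  qed
  have r: "0 \<le> r" using X(2) Xs(2) gauge_nonneg order_trans by blast
  have gN: "gauge (\<lambda>i. x i - y i) = N (\<lambda>i. x i - y i)" if "x \<in> X" "y \<in> X" for x y
  proof -
    have "cut (\<lambda>i. x i - y i) = (\<lambda>i. x i - y i)"
      by (rule cut_id) (use Xs(1)[OF that(1)] Xs(1)[OF that(2)] in \<open>auto simp: topspace_Euclidean_space\<close>)
    then show ?thesis by (simp add: gauge_def)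
  qed
  define ok where "ok = (\<lambda>S. finite S \<and> S \<subseteq> X \<and>
    (\<forall>s\<in>S. \<forall>s'\<in>S. s \<noteq> s' \<longrightarrow> 1 < t * gauge (\<lambda>i. s i - s' i)))"
  have bound: "real (card S) \<le> (1 + 2 * r * t) ^ a" if "ok S" for S
    by (rule packing_card) (use that Xs r t in \<open>auto simp: ok_def\<close>)
  have "\<exists>S. ok S \<and> (\<forall>S'. ok S' \<longrightarrow> card S' \<le> card S)"
  proof (rule ex_has_greatest_nat)
    show "ok {}" by (simp add: ok_def)
    show "\<forall>S. ok S \<longrightarrow> card S < Suc (nat \<lfloor>(1 + 2 * r * t) ^ a\<rfloor>)"
      using bound by (auto simp: less_Suc_eq_le le_nat_floor)
  qed
  then obtain S where S: "ok S" "\<And>S'. ok S' \<Longrightarrow> card S' \<le> card S" by blast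
  have net: "\<exists>s\<in>S. t * N (\<lambda>i. x i - s i) \<le> 1" if x: "x \<in> X" for x
  proof (rule ccontr)
    assume "\<not> ?thesis"
    then have far: "1 < t * gauge (\<lambda>i. x i - s i)" if "s \<in> S" for s
      using that S(1) x gN[of x s] by (auto simp: ok_def not_le)
    have "x \<notin> S" using far[of x] gauge_eq_0[of "\<lambda>_. 0"] by auto
    have "ok (insert x S)"
      unfolding ok_def
    proof (intro conjI ballI impI)
      fix s s' assume "s \<in> insert x S" "s' \<in> insert x S" "s \<noteq> s'"
      then show "1 < t * gauge (\<lambda>i. s i - s' i)"
        using S(1) far gauge_diff_commute[of x] by (auto simp: ok_def)
    qed (use S(1) x in \<open>auto simp: ok_def\<close>)
    then have "card (insert x S) \<le> card S" by (rule S(2))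
    then show False using \<open>x \<notin> S\<close> S(1) by (simp add: ok_def)
  qed
  have "S \<noteq> {}" using net X(2) by blast
  then show ?thesis using S(1) bound[OF S(1)] net by (intro exI[of _ S]) (auto simp: ok_def)
qed

end

text \<open>Coordinates with respect to a basis chosen from \<open>G\<close> carry \<open>nn\<close>
  to a norm on a coordinate space; independence of the basis makes it definite. The basis may have
  fewer than \<open>d\<close> elements, so the exponent is raised at the end.\<close>

lemma finite_net_span:
  fixes nn :: "'e::real_vector \<Rightarrow> real" and G :: "'e set"
  assumes nn: "\<And>x. 0 \<le> nn x" "\<And>x. nn x = 0 \<Longrightarrow> x = 0" "\<And>s x. nn (s *\<^sub>R x) = \<bar>s\<bar> * nn x"
      "\<And>x y. nn (x + y) \<le> nn x + nn y"
    and G: "finite G" "card G \<le> d"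
    and X: "X \<subseteq> span G" "X \<noteq> {}" "\<And>x. x \<in> X \<Longrightarrow> nn x \<le> r" and t: "0 \<le> t"
  shows "\<exists>S. finite S \<and> S \<noteq> {} \<and> S \<subseteq> X \<and> real (card S) \<le> (1 + 2 * r * t) ^ d \<and>
    (\<forall>x\<in>X. \<exists>s\<in>S. t * nn (x - s) \<le> 1)"
proof -
  obtain B where B: "B \<subseteq> G" "independent B" "G \<subseteq> span B"
    by (rule maximal_independent_subset)
  have finB: "finite B" using B(1) G(1) by (rule finite_subset)
  define a where "a = card B"
  have a: "a \<le> d" using card_mono[OF G(1) B(1)] G(2) by (simp add: a_def)
  obtain e where e: "bij_betw e {..<a} B"
    using ex_bij_betw_nat_finite[OF finB] by (auto simp: a_def atLeast0LessThan)
  define vec where "vec = (\<lambda>x :: nat \<Rightarrow> real. \<Sum>i<a. x i *\<^sub>R e i)"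
  have vec_add: "vec (\<lambda>i. x i + y i) = vec x + vec y" for x y
    by (simp add: vec_def scaleR_add_left sum.distrib)
  have vec_diff: "vec (\<lambda>i. x i - y i) = vec x - vec y" for x y
    by (simp add: vec_def scaleR_diff_left sum_subtractf)
  have vec_scale: "vec (\<lambda>i. s * x i) = s *\<^sub>R vec x" for s x
    by (simp add: vec_def scaleR_sum_right)
  have vec_B: "vec x = (\<Sum>b\<in>B. x (the_inv_into {..<a} e b) *\<^sub>R b)" for x
    unfolding vec_def sum.reindex_bij_betw[OF e, symmetric]
    by (rule sum.cong) (use e in \<open>auto simp: bij_betw_def the_inv_into_f_f\<close>)
  have vec_0: "x i = 0" if "vec x = 0" "i < a" for x i
  proof -
    have "x (the_inv_into {..<a} e (e i)) = 0"
      using independentD[OF B(2) finB subset_refl, of "\<lambda>b. x (the_inv_into {..<a} e b)" "e i"] that e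
      by (auto simp: vec_B bij_betw_def)
    then show ?thesis using e that by (simp add: bij_betw_def the_inv_into_f_f)
  qed
  have nn0: "nn 0 = 0" using nn(3)[of 0 0] by simp
  have "is_norm_on_Rn a (\<lambda>x. nn (vec x))"
    unfolding is_norm_on_Rn_def
  proof (intro ballI conjI allI)
    fix x assume x: "x \<in> topspace (Euclidean_space a)"
    show "(nn (vec x) = 0) = (x = (\<lambda>_. 0))"
    proof
      assume "nn (vec x) = 0"
      then have "x i = 0" if "i < a" for i using vec_0 nn(2) that by blast
      moreover have "x i = 0" if "\<not> i < a" for i using x that by (auto simp: topspace_Euclidean_space)
      ultimately show "x = (\<lambda>_. 0)" by blast
    qed (simp add: vec_def nn0)
  qed (auto simp: vec_add vec_scale nn)
  then interpret coord_norm a "\<lambda>x. nn (vec x)" by unfold_locales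
  define Y where "Y = {y \<in> topspace (Euclidean_space a). vec y \<in> X}"
  have surj: "\<exists>y\<in>Y. vec y = x" if x: "x \<in> X" for x
  proof -
    have "x \<in> span B" using X(1) x B(3) by (metis span_mono span_span subsetD)
    then obtain u where u: "x = (\<Sum>b\<in>B. u b *\<^sub>R b)" using span_finite[OF finB] by auto
    define y where "y = (\<lambda>i. if i < a then u (e i) else 0)"
    have "vec y = x" unfolding u vec_def sum.reindex_bij_betw[OF e, symmetric] by (simp add: y_def)
    moreover have "y \<in> topspace (Euclidean_space a)" by (simp add: y_def topspace_Euclidean_space)
    ultimately show ?thesis using x by (auto simp: Y_def)
  qed
  have Y: "Y \<subseteq> param_ball a (\<lambda>x. nn (vec x)) r" "Y \<noteq> {}"
    using X(2,3) surj by (auto simp: Y_def param_ball_def)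
  obtain S where S: "finite S" "S \<noteq> {}" "S \<subseteq> Y" "real (card S) \<le> (1 + 2 * r * t) ^ a"
      "\<And>y. y \<in> Y \<Longrightarrow> \<exists>s\<in>S. t * nn (vec (\<lambda>i. y i - s i)) \<le> 1"
    using finite_net[OF Y t] by blast
  have r: "0 \<le> r" using X(2,3) nn(1) order_trans by blast
  show ?thesis
  proof (intro exI[of _ "vec ` S"] conjI ballI)
    show "vec ` S \<subseteq> X" using S(3) by (auto simp: Y_def)
    have "real (card (vec ` S)) \<le> (1 + 2 * r * t) ^ a"
      using card_image_le[OF S(1), of vec] S(4) by linarith
    also have "\<dots> \<le> (1 + 2 * r * t) ^ d" using a r t by (intro power_increasing) auto
    finally show "real (card (vec ` S)) \<le> (1 + 2 * r * t) ^ d" .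
    fix x assume "x \<in> X"
    then obtain y where y: "y \<in> Y" "vec y = x" using surj by blast
    then obtain s where "s \<in> S" "t * nn (vec (\<lambda>i. y i - s i)) \<le> 1" using S(5) by blast
    then show "\<exists>s\<in>vec ` S. t * nn (x - s) \<le> 1" unfolding vec_diff y(2) by blast
  qed (simp_all add: S(1,2))
qed

section \<open>Tikhonov solutions\<close>

lemma matrix_inv_inverse:
  assumes "invertible M"
  shows "M ** matrix_inv M = mat 1" "matrix_inv M ** M = mat 1"
  using someI_ex[OF assms[unfolded invertible_def]] by (simp_all add: matrix_inv_def)

lemma invertible_of_trivial_kernel:
  fixes M :: "real ^ 'n ^ 'n"
  assumes "\<And>x. M *v x = 0 \<Longrightarrow> x = 0"
  shows "invertible M"
  using assms matrix_left_invertible_ker[of M] invertible_left_inverse[of M] by blast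

lemma inner_matrix_transpose: "x \<bullet> (A *v y) = (transpose A *v x) \<bullet> y" for A :: "real ^ 'n ^ 'm"
  by (simp add: dot_lmul_matrix)

lemma norm_matrix_le: "norm (A *v x) \<le> onorm ((*v) A) * norm x" for A :: "real ^ 'n ^ 'm"
  by (rule onorm) simp

lemma onorm_matrix_nonneg: "0 \<le> onorm ((*v) A)" for A :: "real ^ 'n ^ 'm"
  by (rule onorm_pos_le) simp

text \<open>With \<open>w\<close> the image of \<open>x\<close>, \<open>|w|^2\<close> is the inner
  product of \<open>x\<close> with \<open>A w\<close>; one factor \<open>|w|\<close>
  cancels.\<close>

lemma norm_transpose_le: "norm (transpose A *v x) \<le> onorm ((*v) A) * norm x" for A :: "real ^ 'n ^ 'm"
proof -
  let ?w = "transpose A *v x"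
  have "norm ?w * norm ?w = x \<bullet> (A *v ?w)"
    by (simp add: inner_matrix_transpose flip: power2_norm_eq_inner) (simp add: power2_eq_square)
  also have "\<dots> \<le> norm x * (onorm ((*v) A) * norm ?w)"
    using norm_cauchy_schwarz[of x "A *v ?w"] mult_left_mono[OF norm_matrix_le[of A ?w] norm_ge_zero[of x]]
    by linarith
  finally have "norm ?w * norm ?w \<le> (onorm ((*v) A) * norm x) * norm ?w"
    by (simp add: mult_ac)
  then show ?thesis
    using onorm_matrix_nonneg[of A] by (cases "norm ?w = 0") (auto simp: mult_le_cancel_right)
qed

lemma norm_hadamard_le: "norm (z * x) \<le> infnorm z * norm x" for z x :: "real ^ 'n"
proof -
  have "norm (z * x) \<le> norm (infnorm z *\<^sub>R x)"
    by (rule norm_le_componentwise_cart)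
      (simp add: abs_mult mult_right_mono component_le_infnorm_cart infnorm_pos_le)
  then show ?thesis by (simp add: infnorm_pos_le)
qed

lemma norm_hadamard_le_norm: "norm (z * x) \<le> norm z * norm x" for z x :: "real ^ 'n"
  using norm_hadamard_le[of z x] mult_right_mono[OF infnorm_le_norm[of z], of "norm x"] by simp

lemma inner_hadamard: "(z * x) \<bullet> y = x \<bullet> (z * y)" for x y z :: "real ^ 'n"
  by (simp add: inner_vec_def mult_ac)

lemma diag_mat_mult: "diag_mat z *v x = z * x" for z x :: "real ^ 'n"
  by (simp add: vec_eq_iff diag_mat_def matrix_vector_mult_def if_distrib[of "\<lambda>c. c * _"] cong: if_cong)

lemma transpose_diag_mat: "transpose (diag_mat z) = diag_mat z" for z :: "real ^ 'n"
  by (auto simp: vec_eq_iff diag_mat_def transpose_def)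

lemma spd_invertible: "spd P \<Longrightarrow> invertible P"
  by (rule invertible_of_trivial_kernel) (metis inner_zero_right less_irrefl spd_def)

text \<open>The inverse is bounded below by \<open>1 / p\<close> without eigenvalues: the quadratic
  form of \<open>P\<close> is nonnegative at \<open>P^-1 x - x / p\<close>, and expanding it leaves
  the claim once the form at \<open>x\<close> is bounded by \<open>p * |x|^2\<close>.\<close>

lemma spd_inverse_coercive:
  fixes P :: "real ^ 'n ^ 'n"
  assumes P: "spd P" "onorm ((*v) P) \<le> p" and p: "0 < p"
  shows "(norm x)\<^sup>2 / p \<le> x \<bullet> (matrix_inv P *v x)"
proof -
  define w where "w = matrix_inv P *v x"
  have x: "x = P *v w"
    unfolding w_def matrix_vector_mul_assoc matrix_inv_inverse(1)[OF spd_invertible[OF P(1)]]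
    by simp
  have "transpose P = P" using P(1) by (simp add: spd_def)
  then have sym: "w \<bullet> (P *v x) = x \<bullet> x"
    using inner_matrix_transpose[of w P x] x by metis
  define q where "q = w - (1 / p) *\<^sub>R x"
  have Pq: "P *v q = x - (1 / p) *\<^sub>R (P *v x)"
    unfolding q_def matrix_vector_mult_diff_distrib matrix_vector_mult_scaleR x[symmetric] ..
  have "0 \<le> q \<bullet> (P *v q)"
    using P(1) unfolding spd_def by (cases "q = 0") (auto intro: less_imp_le)
  also have "q \<bullet> (P *v q) = w \<bullet> x - 2 / p * (x \<bullet> x) + 1 / p * (1 / p * (x \<bullet> (P *v x)))"
    unfolding Pq unfolding q_def by (simp add: inner_diff_left inner_diff_right sym diff_divide_distrib add_divide_distrib)
  also have "x \<bullet> (P *v x) \<le> p * (x \<bullet> x)"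
  proof -
    have "x \<bullet> (P *v x) \<le> norm x * norm (P *v x)" by (rule norm_cauchy_schwarz)
    also have "\<dots> \<le> norm x * (p * norm x)"
      using P(2) norm_matrix_le[of P x] by (intro mult_left_mono order_trans[OF norm_matrix_le] mult_right_mono) auto
    finally show ?thesis by (simp add: power2_norm_eq_inner[symmetric] power2_eq_square mult_ac)
  qed
  finally have "0 \<le> w \<bullet> x - 2 / p * (x \<bullet> x) + 1 / p * (1 / p * (p * (x \<bullet> x)))"
    using p by (simp add: divide_right_mono)
  then show ?thesis
    using p by (simp add: w_def[symmetric] power2_norm_eq_inner inner_commute divide_simps)
qed

text \<open>The normal equations of the Tikhonov problem, with \<open>A\<^sub>z x = A (z * x)\<close>.\<close>

definition normal_op :: "real ^ 'n ^ 'm \<Rightarrow> real ^ 'n \<Rightarrow> real ^ 'n ^ 'n \<Rightarrow> real ^ 'n \<Rightarrow> real ^ 'n" where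
  "normal_op A z P v = z * (transpose A *v (A *v (z * v))) + matrix_inv P *v v"

lemma normal_op_diff: "normal_op A z P (v - w) = normal_op A z P v - normal_op A z P w"
  by (simp add: normal_op_def right_diff_distrib matrix_vector_mult_diff_distrib)

text \<open>The Gram part contributes the squared norm of \<open>A (z * v)\<close>, so the normal
  operator inherits the coercivity of \<open>P^-1\<close>. This gives both invertibility and the
  perturbation estimates.\<close>

lemma normal_op_bound:
  fixes A :: "real ^ 'n ^ 'm"
  assumes P: "spd P" "onorm ((*v) P) \<le> p" and p: "0 < p"
  shows "norm v \<le> p * norm (normal_op A z P v)"
proof -
  have "(norm v)\<^sup>2 / p \<le> v \<bullet> (matrix_inv P *v v)" by (rule spd_inverse_coercive[OF assms])
  also have "\<dots> \<le> v \<bullet> normal_op A z P v"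
  proof -
    have "v \<bullet> (z * (transpose A *v (A *v (z * v)))) = (A *v (z * v)) \<bullet> (A *v (z * v))"
      by (metis inner_hadamard inner_matrix_transpose inner_commute)
    then show ?thesis by (simp add: normal_op_def inner_add_right)
  qed
  also have "\<dots> \<le> norm v * norm (normal_op A z P v)" by (rule norm_cauchy_schwarz)
  finally have "norm v * norm v \<le> norm v * (p * norm (normal_op A z P v))"
    using p by (simp add: field_simps power2_eq_square)
  then show ?thesis using p by (cases "norm v = 0") (auto simp: mult_le_cancel_left)
qed

text \<open>\<open>matrix_inv\<close> is an inverse only for invertible matrices; here the kernel is
  trivial by \<open>normal_op_bound\<close>.\<close>

lemma normal_op_tikhonov:
  fixes A :: "real ^ 'n ^ 'm"
  assumes P: "spd P" "onorm ((*v) P) \<le> p" and p: "0 < p"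
  shows "normal_op A z P (tikhonov A y z P) = z * (transpose A *v y)"
proof -
  define Az where "Az = A ** diag_mat z"
  define M where "M = transpose Az ** Az + matrix_inv P"
  have Az: "Az *v x = A *v (z * x)" for x
    by (simp add: Az_def diag_mat_mult flip: matrix_vector_mul_assoc)
  have AzT: "transpose Az *v x = z * (transpose A *v x)" for x
    by (simp add: Az_def matrix_transpose_mul transpose_diag_mat diag_mat_mult flip: matrix_vector_mul_assoc)
  have M: "M *v x = normal_op A z P x" for x
    by (simp only: M_def normal_op_def matrix_vector_mult_add_rdistrib Az AzT matrix_vector_mul_assoc[symmetric])
  have "invertible M"
  proof (rule invertible_of_trivial_kernel)
    fix x assume "M *v x = 0"
    then show "x = 0" using normal_op_bound[OF assms, of x A z] unfolding M[symmetric] by simp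
  qed
  then have "M *v (matrix_inv M *v w) = w" for w
    by (simp add: matrix_vector_mul_assoc matrix_inv_inverse)
  then show ?thesis
    by (simp only: tikhonov_def Let_def Az_def[symmetric] M_def[symmetric] M[symmetric] AzT[symmetric])
qed

text \<open>The inner product of \<open>u\<close> and \<open>P^-1 u\<close> equals that of the
  residual and the fitted vector \<open>A (z * u)\<close>. It is nonnegative, so adding the fitted
  vector to the residual, which gives \<open>y\<close>, cannot shorten it.\<close>

lemma tikhonov_residual:
  fixes A :: "real ^ 'n ^ 'm" and y :: "real ^ 'm" and z :: "real ^ 'n"
  assumes P: "spd P" "onorm ((*v) P) \<le> p" and p: "0 < p"
  defines "u \<equiv> tikhonov A y z P"
  shows "matrix_inv P *v u = z * (transpose A *v (y - A *v (z * u)))"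
    and "norm (y - A *v (z * u)) \<le> norm y"
proof -
  show eq: "matrix_inv P *v u = z * (transpose A *v (y - A *v (z * u)))"
    using normal_op_tikhonov[OF P p, of A z y]
    by (simp add: normal_op_def u_def[symmetric] matrix_vector_mult_diff_distrib right_diff_distrib eq_diff_eq add.commute)
  define r where "r = y - A *v (z * u)"
  have "0 \<le> (norm u)\<^sup>2 / p" using p by simp
  also have "\<dots> \<le> u \<bullet> (matrix_inv P *v u)" by (rule spd_inverse_coercive[OF P p])
  also have "\<dots> = r \<bullet> (A *v (z * u))"
    unfolding eq r_def[symmetric] by (metis inner_hadamard inner_matrix_transpose inner_commute)
  finally have "(norm r)\<^sup>2 \<le> (norm (r + A *v (z * u)))\<^sup>2"
    by (simp add: power2_norm_eq_inner inner_add_left inner_add_right inner_commute)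
  then show "norm (y - A *v (z * u)) \<le> norm y"
    unfolding r_def by (simp add: abs_le_square_iff[symmetric])
qed

text \<open>\<open>Y\<close> is only an upper bound of the norm of \<open>y\<close>, so that the
  constants are the same for all training measurements.\<close>

locale tikhonov_bounds =
  fixes A :: "real ^ 'n::{finite,linorder} ^ 'm" and p_min p_max z_inf Y :: real and y :: "real ^ 'm"
  assumes p_min: "0 < p_min" and p_max: "0 < p_max" and z_inf: "0 \<le> z_inf" and Y: "norm y \<le> Y"
begin

abbreviation "nA \<equiv> onorm ((*v) A)"

lemma nA: "0 \<le> nA" by (rule onorm_matrix_nonneg)

lemma Y_nonneg: "0 \<le> Y" using Y norm_ge_zero order_trans by blast

lemma norm_transpose_y: "norm v \<le> Y \<Longrightarrow> norm (transpose A *v v) \<le> nA * Y"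
  using norm_transpose_le[of A v] mult_left_mono[OF _ nA, of "norm v" Y] by linarith

lemma norm_hadamard_z:
  fixes z x :: "real ^ 'k"
  shows "infnorm z \<le> z_inf \<Longrightarrow> norm x \<le> b \<Longrightarrow> norm (z * x) \<le> z_inf * b"
  by (rule order_trans[OF norm_hadamard_le]) (intro mult_mono, auto simp: z_inf)

lemma norm_tikhonov_le:
  assumes P: "spd P" "onorm ((*v) P) \<le> p_max" and z: "infnorm z \<le> z_inf"
  shows "norm (tikhonov A y z P) \<le> p_max * (z_inf * (nA * Y))"
proof -
  have "norm (tikhonov A y z P) \<le> p_max * norm (z * (transpose A *v y))"
    using normal_op_bound[OF P p_max, of "tikhonov A y z P" A z] normal_op_tikhonov[OF P p_max, of A z y] by simp
  also have "\<dots> \<le> p_max * (z_inf * (nA * Y))"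
    using p_max by (intro mult_left_mono norm_hadamard_z z norm_transpose_y Y) auto
  finally show ?thesis .
qed

text \<open>The normal operator at \<open>z1\<close> is applied to \<open>u1 - u2\<close>. Since
  \<open>P^-1 u2\<close> is \<open>z2\<close> times the back-projected residual, everything regroups
  into two terms linear in \<open>d = z1 - z2\<close>: one with the residual, bounded by
  \<open>Y\<close>, and one with \<open>u2\<close>.\<close>

lemma tikhonov_lipschitz_scale:
  assumes P: "spd P" "onorm ((*v) P) \<le> p_max" and z: "infnorm z1 \<le> z_inf" "infnorm z2 \<le> z_inf"
  shows "norm (tikhonov A y z1 P - tikhonov A y z2 P) \<le> const_c1 A z_inf p_max Y * norm (z1 - z2)"
proof -
  define u1 u2 where "u1 = tikhonov A y z1 P" and "u2 = tikhonov A y z2 P"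
  define r where "r = y - A *v (z2 * u2)"
  define d where "d = z1 - z2"
  have r: "norm r \<le> Y"
    using tikhonov_residual(2)[OF P p_max, of y A z2] Y by (simp add: r_def u2_def)
  have u2: "norm u2 \<le> p_max * (z_inf * (nA * Y))"
    unfolding u2_def by (rule norm_tikhonov_le[OF P z(2)])
  have inv: "matrix_inv P *v u2 = z2 * (transpose A *v r)"
    unfolding u2_def r_def by (rule tikhonov_residual(1)[OF P p_max])
  have "normal_op A z1 P (u1 - u2) = z1 * (transpose A *v y) - z1 * (transpose A *v (A *v (z1 * u2))) - z2 * (transpose A *v r)"
    using normal_op_tikhonov[OF P p_max, of A z1 y]
    by (simp add: normal_op_diff u1_def[symmetric]) (simp add: normal_op_def inv)
  also have "\<dots> = d * (transpose A *v r) - z1 * (transpose A *v (A *v (d * u2)))"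
  proof -
    have "z1 * u2 = d * u2 + z2 * u2" by (simp add: d_def left_diff_distrib)
    then have "A *v (z1 * u2) = A *v (d * u2) + (y - r)"
      by (simp add: matrix_vector_right_distrib r_def)
    then have "transpose A *v (A *v (z1 * u2))
        = transpose A *v (A *v (d * u2)) + (transpose A *v y - transpose A *v r)"
      by (simp only: matrix_vector_right_distrib matrix_vector_mult_diff_distrib)
    moreover have "d * (transpose A *v r) = z1 * (transpose A *v r) - z2 * (transpose A *v r)"
      by (simp only: d_def left_diff_distrib)
    ultimately show ?thesis
      by (simp only: distrib_left right_diff_distrib) simp
  qed
  also have "norm \<dots> \<le> norm (d * (transpose A *v r)) + norm (z1 * (transpose A *v (A *v (d * u2))))"
    by (rule norm_triangle_ineq4)
  also have "\<dots> \<le> norm d * (nA * Y) + z_inf * (nA * (nA * (norm d * (p_max * (z_inf * (nA * Y))))))"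
  proof (rule add_mono)
    show "norm (d * (transpose A *v r)) \<le> norm d * (nA * Y)"
      by (rule order_trans[OF norm_hadamard_le_norm]) (intro mult_left_mono norm_transpose_y r norm_ge_zero)
    have "norm (d * u2) \<le> norm d * (p_max * (z_inf * (nA * Y)))"
      by (rule order_trans[OF norm_hadamard_le_norm]) (intro mult_left_mono u2 norm_ge_zero)
    then have "norm (A *v (d * u2)) \<le> nA * (norm d * (p_max * (z_inf * (nA * Y))))"
      by (intro order_trans[OF norm_matrix_le] mult_left_mono nA)
    then have "norm (transpose A *v (A *v (d * u2))) \<le> nA * (nA * (norm d * (p_max * (z_inf * (nA * Y)))))"
      by (intro order_trans[OF norm_transpose_le] mult_left_mono nA)
    then show "norm (z1 * (transpose A *v (A *v (d * u2)))) \<le> z_inf * (nA * (nA * (norm d * (p_max * (z_inf * (nA * Y))))))"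
      by (rule norm_hadamard_z[OF z(1)])
  qed
  finally have "norm (u1 - u2) \<le> p_max * (norm d * (nA * Y) + z_inf * (nA * (nA * (norm d * (p_max * (z_inf * (nA * Y)))))))"
    using normal_op_bound[OF P p_max, of "u1 - u2" A z1] p_max by (meson less_imp_le mult_left_mono order_trans)
  also have "\<dots> = p_max * Y * nA * (1 + z_inf\<^sup>2 * p_max * nA\<^sup>2) * norm d"
    by (simp add: algebra_simps power2_eq_square)
  also have "\<dots> \<le> const_c1 A z_inf p_max Y * norm d"
    unfolding const_c1_def using p_max Y_nonneg nA
    by (intro mult_right_mono mult_left_mono add_left_mono mult_nonneg_nonneg) auto
  finally show ?thesis by (simp add: u1_def u2_def d_def)
qed

text \<open>Both normal equations have the same right-hand side, so only the identity
  \<open>Q1 - Q2 = Q1 (P2 - P1) Q2\<close> for the inverses matters. Each inverse costs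
  \<open>1 / p_min\<close>; one \<open>p_max\<close> comes from the size of \<open>u2\<close>, the
  other from inverting the normal operator.\<close>

lemma tikhonov_lipschitz_cov:
  assumes P: "spd P1" "onorm ((*v) P1) \<le> p_max" "onorm ((*v) (matrix_inv P1)) \<le> inverse p_min"
    and Q: "spd P2" "onorm ((*v) P2) \<le> p_max" "onorm ((*v) (matrix_inv P2)) \<le> inverse p_min"
    and z: "infnorm z \<le> z_inf"
  shows "norm (tikhonov A y z P1 - tikhonov A y z P2)
     \<le> const_c2 A z_inf p_min p_max Y * onorm ((*v) (P1 - P2))"
proof -
  define u1 u2 where "u1 = tikhonov A y z P1" and "u2 = tikhonov A y z P2"
  define d where "d = onorm ((*v) (P1 - P2))"
  have d: "0 \<le> d" unfolding d_def by (rule onorm_matrix_nonneg)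
  have u2: "norm u2 \<le> p_max * (z_inf * (nA * Y))"
    unfolding u2_def by (rule norm_tikhonov_le[OF Q(1,2) z])
  have e1: "normal_op A z P1 u1 = z * (transpose A *v y)" "normal_op A z P2 u2 = z * (transpose A *v y)"
    unfolding u1_def u2_def by (intro normal_op_tikhonov[OF _ _ p_max] P Q)+
  have "normal_op A z P1 (u1 - u2) = normal_op A z P2 u2 - normal_op A z P1 u2"
    unfolding normal_op_diff e1 ..
  also have "\<dots> = matrix_inv P2 *v u2 - matrix_inv P1 *v u2"
    by (simp add: normal_op_def)
  also have "\<dots> = matrix_inv P1 *v ((P1 - P2) *v (matrix_inv P2 *v u2))"
  proof -
    have "P2 *v (matrix_inv P2 *v u2) = u2" "matrix_inv P1 *v (P1 *v w) = w" for w
      by (simp_all add: matrix_vector_mul_assoc matrix_inv_inverse spd_invertible P(1) Q(1))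
    then show ?thesis
      by (simp only: matrix_vector_mult_diff_rdistrib matrix_vector_mult_diff_distrib)
  qed
  also have "norm \<dots> \<le> inverse p_min * (d * (inverse p_min * (p_max * (z_inf * (nA * Y)))))"
  proof -
    have inv: "norm (matrix_inv R *v v) \<le> inverse p_min * b"
      if "onorm ((*v) (matrix_inv R)) \<le> inverse p_min" "norm v \<le> b" for R :: "real ^ 'n::{finite,linorder} ^ 'n::{finite,linorder}" and v b
      by (rule order_trans[OF norm_matrix_le]) (intro mult_mono that, use p_min in auto)
    have "norm (matrix_inv P2 *v u2) \<le> inverse p_min * (p_max * (z_inf * (nA * Y)))"
      by (rule inv[OF Q(3) u2])
    then have "norm ((P1 - P2) *v (matrix_inv P2 *v u2)) \<le> d * (inverse p_min * (p_max * (z_inf * (nA * Y))))"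
      unfolding d_def by (rule order_trans[OF norm_matrix_le mult_left_mono[OF _ onorm_matrix_nonneg]])
    then show ?thesis by (rule inv[OF P(3)])
  qed
  finally have "norm (u1 - u2) \<le> p_max * (inverse p_min * (d * (inverse p_min * (p_max * (z_inf * (nA * Y))))))"
    using normal_op_bound[OF P(1,2) p_max, of "u1 - u2" A z] p_max by (meson less_imp_le mult_left_mono order_trans)
  also have "\<dots> = const_c2 A z_inf p_min p_max Y * d"
    using p_min by (simp add: const_c2_def field_simps power2_eq_square)
  finally show ?thesis by (simp add: u1_def u2_def d_def)
qed

lemma c1_nonneg: "0 \<le> const_c1 A z_inf p_max Y"
  unfolding const_c1_def using p_max Y_nonneg nA by simp

lemma c2_nonneg: "0 \<le> const_c2 A z_inf p_min p_max Y"
  unfolding const_c2_def using z_inf Y_nonneg nA by simp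

lemma tikhonov_lipschitz:
  assumes P: "P1 \<in> cov_class kind p_min p_max" "P2 \<in> cov_class kind p_min p_max"
    and z: "infnorm z1 \<le> z_inf" "infnorm z2 \<le> z_inf"
  shows "norm (tikhonov A y z1 P1 - tikhonov A y z2 P2)
     \<le> const_c1 A z_inf p_max Y * norm (z1 - z2) + const_c2 A z_inf p_min p_max Y * onorm ((*v) (P1 - P2))"
proof -
  have "norm (tikhonov A y z1 P1 - tikhonov A y z2 P1) \<le> const_c1 A z_inf p_max Y * norm (z1 - z2)"
    by (rule tikhonov_lipschitz_scale) (use P z in \<open>auto simp: cov_class_def\<close>)
  moreover have "norm (tikhonov A y z2 P1 - tikhonov A y z2 P2) \<le> const_c2 A z_inf p_min p_max Y * onorm ((*v) (P1 - P2))"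
    by (rule tikhonov_lipschitz_cov) (use P z in \<open>auto simp: cov_class_def\<close>)
  ultimately show ?thesis
    using norm_triangle_ineq[of "tikhonov A y z1 P1 - tikhonov A y z2 P1" "tikhonov A y z2 P1 - tikhonov A y z2 P2"] by simp
qed

end

section \<open>The clipping and projection maps of the network\<close>

lemma mrelu_component: "a \<le> b \<Longrightarrow> mrelu a b x $ i = max a (min b (x $ i))"
  by (auto simp: mrelu_def relu_def max_def min_def)

lemma mrelu_lipschitz:
  assumes "a \<le> b"
  shows "norm (mrelu a b x - mrelu a b y) \<le> norm (x - y)"
  by (rule norm_le_componentwise_cart) (auto simp: mrelu_component[OF assms] max_def min_def)

lemma infnorm_le_cart: "(\<And>i. \<bar>x $ i\<bar> \<le> b) \<Longrightarrow> infnorm x \<le> b" for x :: "real ^ 'n"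
  unfolding infnorm_cart by (rule cSup_least) auto

lemma infnorm_mrelu: "0 \<le> b \<Longrightarrow> infnorm (mrelu 0 b x) \<le> b"
  by (rule infnorm_le_cart) (auto simp: mrelu_component)

lemma norm_rho_le:
  assumes "0 < b"
  shows "norm (rho b v) \<le> b"
  using assms by (auto simp: rho_def max_def field_simps)

text \<open>\<open>rho b\<close> is the nearest-point projection onto the closed ball of radius
  \<open>b\<close>, and projections onto closed convex sets are nonexpansive.\<close>

lemma rho_lipschitz:
  assumes b: "0 < b"
  shows "norm (rho b v - rho b w) \<le> norm (v - w)"
proof -
  have proj: "rho b v = closest_point (cball 0 b) v" for v :: "real ^ 'n"
  proof (rule closest_point_unique)
    show "rho b v \<in> cball 0 b" using norm_rho_le[OF b, of v] by simp
    show "\<forall>z\<in>cball 0 b. dist v (rho b v) \<le> dist v z"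
    proof
      fix z :: "real ^ 'n" assume z: "z \<in> cball 0 b"
      show "dist v (rho b v) \<le> dist v z"
      proof (cases "norm v \<le> b")
        case True
        then show ?thesis using b by (simp add: rho_def)
      next
        case False
        then have v: "b < norm v" by simp
        have "rho b v = (b / norm v) *\<^sub>R v"
          using v b by (simp add: rho_def max_def field_simps)
        then have "v - rho b v = (1 - b / norm v) *\<^sub>R v"
          by (simp add: scaleR_diff_left)
        then have "dist v (rho b v) = \<bar>1 - b / norm v\<bar> * norm v"
          by (simp add: dist_norm)
        also have "\<dots> = norm v - b"
        proof -
          have nv: "0 < norm v" using v b by linarith
          then have pos: "0 < 1 - b / norm v" using v by simp
          show ?thesis unfolding abs_of_pos[OF pos] using nv by (simp add: left_diff_distrib)
        qed
        also have "\<dots> \<le> norm v - norm z" using z by simp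
        also have "\<dots> \<le> dist v z" by (simp add: dist_norm norm_triangle_ineq2)
        finally show ?thesis .
      qed
    qed
  qed auto
  show ?thesis
    using closest_point_lipschitz[of "cball 0 b" v w] b by (simp add: proj dist_norm)
qed

text \<open>The quotient at \<open>x = 0\<close> is 0 by the convention for division, so the
  supremum is nonnegative as soon as the quotients are bounded above; equivalence of the two norms
  bounds them.\<close>

lemma opnorm_inf_nonneg: "0 \<le> opnorm_inf A" for A :: "real ^ 'n ^ 'm"
proof -
  have "infnorm (A *v x) / infnorm x \<le> onorm ((*v) A) * sqrt (DIM(real ^ 'n))" for x
  proof (cases "x = 0")
    case False
    then have x: "0 < infnorm x" by (simp add: infnorm_pos_lt)
    have "infnorm (A *v x) \<le> onorm ((*v) A) * norm x"
      using infnorm_le_norm[of "A *v x"] norm_matrix_le[of A x] by linarith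
    also have "\<dots> \<le> onorm ((*v) A) * (sqrt (DIM(real ^ 'n)) * infnorm x)"
      by (intro mult_left_mono norm_le_infnorm onorm_matrix_nonneg)
    finally show ?thesis using x by (simp add: field_simps)
  next
    case True
    show ?thesis
      unfolding True infnorm_0 div_by_0 by (intro mult_nonneg_nonneg onorm_matrix_nonneg) simp
  qed
  then have "bdd_above (range (\<lambda>x. infnorm (A *v x) / infnorm x))" by (rule bdd_aboveI2)
  from cSUP_upper[OF UNIV_I this, of 0] show ?thesis
    unfolding opnorm_inf_def infnorm_0 div_by_0 .
qed

section \<open>Perturbation of the network\<close>

lemma infnorm_scale_iter:
  "0 \<le> z_inf \<Longrightarrow> infnorm z \<le> z_inf \<Longrightarrow> infnorm (scale_iter z_inf gk z u j) \<le> z_inf"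
  by (cases j) (simp_all add: infnorm_mrelu)

text \<open>One fixed measurement \<open>y\<close>, with constants shared by the whole sample, so
  that one net of parameters can serve all training measurements at once.\<close>

locale network_bounds = tikhonov_bounds A p_min p_max z_inf Y y
  for A :: "real ^ 'n::{finite,linorder} ^ 'm" and p_min p_max z_inf Y :: real and y :: "real ^ 'm" +
  fixes K J D :: nat and nrm :: "nat \<Rightarrow> (nat \<Rightarrow> real) \<Rightarrow> real"
    and g :: "('n::{finite,linorder}, 'm) scale_update"
    and kind :: cov_kind and \<T> :: "param_tuple set"
    and r1 r2 :: "nat \<Rightarrow> nat \<Rightarrow> real" and r3 :: "nat \<Rightarrow> nat \<Rightarrow> nat \<Rightarrow> real"
    and b c_max :: real
  assumes update: "scale_update_assumption A z_inf K J D nrm g (cov_class kind p_min p_max) \<T> r1 r2 r3 y"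
    and J: "1 \<le> J" and c_max: "0 < c_max"
    and init: "infnorm (init_scale A b y) \<le> z_inf"
begin

abbreviation "\<P> \<equiv> cov_class kind p_min p_max"
abbreviation "c1 \<equiv> const_c1 A z_inf p_max Y"
abbreviation "c2 \<equiv> const_c2 A z_inf p_min p_max Y"

lemma r_nonneg:
  assumes "k \<in> {1..K}"
  shows "j < J \<Longrightarrow> 0 \<le> r1 k j" "j < J \<Longrightarrow> 0 \<le> r2 k j" "j < J \<Longrightarrow> d \<in> {1..D} \<Longrightarrow> 0 \<le> r3 k d j"
proof -
  have *: "Suc j \<in> {1..J} \<Longrightarrow> 0 \<le> r1 k j \<and> 0 \<le> r2 k j \<and> (\<forall>d\<in>{1..D}. 0 \<le> r3 k d j)"
    using update assms unfolding scale_update_assumption_def by fastforce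
  show "j < J \<Longrightarrow> 0 \<le> r1 k j" "j < J \<Longrightarrow> 0 \<le> r2 k j" "j < J \<Longrightarrow> d \<in> {1..D} \<Longrightarrow> 0 \<le> r3 k d j"
    using * by auto
qed

lemma update_lipschitz:
  assumes "k \<in> {1..K}" "j < J" "P1 \<in> \<P>" "P2 \<in> \<P>" "t1 \<in> \<T>" "t2 \<in> \<T>"
    and "infnorm z1 \<le> z_inf" "infnorm z2 \<le> z_inf" "infnorm w1 \<le> z_inf" "infnorm w2 \<le> z_inf"
    and "j = 0 \<Longrightarrow> w1 = z1 \<and> w2 = z2"
  shows "norm (g k (Suc j) y z1 (tikhonov A y w1 P1) t1 - g k (Suc j) y z2 (tikhonov A y w2 P2) t2)
     \<le> r1 k j * norm (z1 - z2) + r2 k j * norm (tikhonov A y w1 P1 - tikhonov A y w2 P2)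
       + (\<Sum>d=1..D. r3 k d j * nrm d (\<lambda>i. t1 d i - t2 d i))"
proof -
  have "Suc j \<in> {1..J}" using assms(2) by simp
  from update[unfolded scale_update_assumption_def, rule_format, OF assms(1) this, THEN conjunct2, THEN conjunct2, THEN conjunct2, rule_format,
      OF assms(3-6), of z1 z2 w1 w2 "tikhonov A y w1 P1" "tikhonov A y w2 P2"] assms(7-11)
  show ?thesis by simp
qed

text \<open>Growth of a scale-variable error through one layer: directly, and through the Tikhonov
  solution at the input of the layer.\<close>

abbreviation "rate k \<equiv> r1_hat J r1 k + r2_hat J r1 r2 k * c1"

lemma r_hat_nonneg:
  assumes "k \<in> {1..K}"
  shows "0 \<le> r1_hat J r1 k" "0 \<le> r2_hat J r1 r2 k"
  unfolding r1_hat_def r2_hat_def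
  by (auto intro!: prod_nonneg sum_nonneg mult_nonneg_nonneg r_nonneg[OF assms])

context
  fixes P1 P2 :: "real ^ 'n::{finite,linorder} ^ 'n::{finite,linorder}" and \<theta>1 \<theta>2 :: "nat \<Rightarrow> nat \<Rightarrow> param_tuple"
  assumes P: "P1 \<in> \<P>" "P2 \<in> \<P>"
    and \<theta>: "\<And>k j. k \<in> {1..K} \<Longrightarrow> j \<in> {1..J} \<Longrightarrow> \<theta>1 k j \<in> \<T> \<and> \<theta>2 k j \<in> \<T>"
begin

definition dP :: real where "dP = onorm ((*v) (P1 - P2))"
definition d\<theta> :: "nat \<Rightarrow> nat \<Rightarrow> nat \<Rightarrow> real" where
  "d\<theta> k j d = nrm d (\<lambda>i. \<theta>1 k j d i - \<theta>2 k j d i)"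

text \<open>The solution variable stays frozen during the updates of one layer, so the errors obey a
  linear recursion in \<open>j\<close>; the products and sums are its closed form.\<close>

lemma scale_iter_lipschitz:
  fixes w1 w2 :: "real ^ 'n::{finite,linorder}"
  assumes k: "k \<in> {1..K}" and w: "infnorm w1 \<le> z_inf" "infnorm w2 \<le> z_inf" and j: "j \<le> J"
  defines "u1 \<equiv> tikhonov A y w1 P1" and "u2 \<equiv> tikhonov A y w2 P2"
  defines "z1 \<equiv> scale_iter z_inf (\<lambda>j z u. g k j y z u (\<theta>1 k j)) w1 u1"
    and "z2 \<equiv> scale_iter z_inf (\<lambda>j z u. g k j y z u (\<theta>2 k j)) w2 u2"
  shows "norm (z1 j - z2 j) \<le> (\<Prod>i=1..j. r1 k (i - 1)) * norm (w1 - w2)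
     + (\<Sum>i=1..j. r2 k (i - 1) * (\<Prod>l=i..<j. r1 k l)) * norm (u1 - u2)
     + (\<Sum>i=1..j. \<Sum>d=1..D. r3 k d (i - 1) * (\<Prod>l=i..<j. r1 k l) * d\<theta> k i d)"
  using j
proof (induction j)
  case 0
  show ?case by (simp add: z1_def z2_def)
next
  case (Suc j)
  then have j: "j < J" by simp
  have zi: "infnorm (z1 j) \<le> z_inf" "infnorm (z2 j) \<le> z_inf"
    unfolding z1_def z2_def by (intro infnorm_scale_iter z_inf w)+
  let ?a = "\<Prod>i=1..j. r1 k (i - 1)"
  let ?b = "\<Sum>i=1..j. r2 k (i - 1) * (\<Prod>l=i..<j. r1 k l)"
  let ?c = "\<Sum>i=1..j. \<Sum>d=1..D. r3 k d (i - 1) * (\<Prod>l=i..<j. r1 k l) * d\<theta> k i d"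
  have "norm (z1 (Suc j) - z2 (Suc j))
      \<le> norm (g k (Suc j) y (z1 j) u1 (\<theta>1 k (Suc j)) - g k (Suc j) y (z2 j) u2 (\<theta>2 k (Suc j)))"
    unfolding z1_def z2_def scale_iter.simps by (rule mrelu_lipschitz[OF z_inf])
  also have "\<dots> \<le> r1 k j * norm (z1 j - z2 j) + r2 k j * norm (u1 - u2) + (\<Sum>d=1..D. r3 k d j * d\<theta> k (Suc j) d)"
    unfolding u1_def u2_def d\<theta>_def
    \<comment> \<open>For \<open>j = 0\<close> the current iterates are \<open>w1\<close> and
      \<open>w2\<close> themselves, which is the tie demanded for the first update.\<close>
    by (rule update_lipschitz[OF k j P _ _ zi w]) (use \<theta>[OF k, of "Suc j"] j in \<open>auto simp: z1_def z2_def\<close>)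
  also have "\<dots> \<le> r1 k j * (?a * norm (w1 - w2) + ?b * norm (u1 - u2) + ?c)
      + r2 k j * norm (u1 - u2) + (\<Sum>d=1..D. r3 k d j * d\<theta> k (Suc j) d)"
    using Suc j by (intro add_mono mult_left_mono order_refl r_nonneg[OF k]) auto
  also have "\<dots> = (?a * r1 k j) * norm (w1 - w2) + (?b * r1 k j + r2 k j) * norm (u1 - u2)
      + (?c * r1 k j + (\<Sum>d=1..D. r3 k d j * d\<theta> k (Suc j) d))"
    by (simp add: algebra_simps)
  also have "?a * r1 k j = (\<Prod>i=1..Suc j. r1 k (i - 1))" by simp
  also have "?b * r1 k j + r2 k j = (\<Sum>i=1..Suc j. r2 k (i - 1) * (\<Prod>l=i..<Suc j. r1 k l))"
    by (simp add: sum_distrib_right mult.assoc)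
  also have "?c * r1 k j + (\<Sum>d=1..D. r3 k d j * d\<theta> k (Suc j) d)
      = (\<Sum>i=1..Suc j. \<Sum>d=1..D. r3 k d (i - 1) * (\<Prod>l=i..<Suc j. r1 k l) * d\<theta> k i d)"
    by (simp add: sum_distrib_left sum_distrib_right mult_ac)
  finally show ?case .
qed

definition layer1 where "layer1 = cg_layer A b z_inf J g P1 \<theta>1 y"
definition layer2 where "layer2 = cg_layer A b z_inf J g P2 \<theta>2 y"

lemma layer_Suc:
  "fst (layer1 (Suc k)) = scale_iter z_inf (\<lambda>j z u. g (Suc k) j y z u (\<theta>1 (Suc k) j)) (fst (layer1 k)) (snd (layer1 k)) J"
  "fst (layer2 (Suc k)) = scale_iter z_inf (\<lambda>j z u. g (Suc k) j y z u (\<theta>2 (Suc k) j)) (fst (layer2 k)) (snd (layer2 k)) J"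
  by (simp_all add: layer1_def layer2_def Let_def case_prod_unfold)

lemma layer_snd:
  "snd (layer1 k) = tikhonov A y (fst (layer1 k)) P1" "snd (layer2 k) = tikhonov A y (fst (layer2 k)) P2"
  by (cases k; simp add: layer1_def layer2_def Let_def case_prod_unfold)+

lemma layer_infnorm: "infnorm (fst (layer1 k)) \<le> z_inf" "infnorm (fst (layer2 k)) \<le> z_inf"
proof (induction k)
  case 0
  show "infnorm (fst (layer1 0)) \<le> z_inf" "infnorm (fst (layer2 0)) \<le> z_inf"
    using init by (simp_all add: layer1_def layer2_def Let_def)
next
  case (Suc k)
  show "infnorm (fst (layer1 (Suc k))) \<le> z_inf" "infnorm (fst (layer2 (Suc k))) \<le> z_inf"
    unfolding layer_Suc by (intro infnorm_scale_iter z_inf Suc)+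
qed

lemma snd_diff: "norm (snd (layer1 k) - snd (layer2 k)) \<le> c1 * norm (fst (layer1 k) - fst (layer2 k)) + c2 * dP"
  unfolding layer_snd dP_def by (rule tikhonov_lipschitz[OF P layer_infnorm])

text \<open>The same unrolling one level up, with \<open>rate\<close> as multiplier. The initial
  scale variable does not depend on the parameters, so the recursion starts at 0.\<close>

lemma layer_lipschitz:
  assumes "k \<le> K"
  shows "norm (fst (layer1 k) - fst (layer2 k))
    \<le> (\<Sum>i=1..k. r2_hat J r1 r2 i * (\<Prod>l=i+1..k. rate l)) * (c2 * dP)
      + (\<Sum>i=1..k. \<Sum>j=1..J. \<Sum>d=1..D. r3_hat J r1 r3 i d j * (\<Prod>l=i+1..k. rate l) * d\<theta> i j d)"
  using assms
proof (induction k)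
  case 0
  show ?case by (simp add: layer1_def layer2_def Let_def)
next
  case (Suc k)
  then have k: "Suc k \<in> {1..K}" by simp
  let ?e = "norm (fst (layer1 k) - fst (layer2 k))"
  let ?b = "\<Sum>i=1..k. r2_hat J r1 r2 i * (\<Prod>l=i+1..k. rate l)"
  let ?c = "\<Sum>i=1..k. \<Sum>j=1..J. \<Sum>d=1..D. r3_hat J r1 r3 i d j * (\<Prod>l=i+1..k. rate l) * d\<theta> i j d"
  let ?n = "\<Sum>j=1..J. \<Sum>d=1..D. r3_hat J r1 r3 (Suc k) d j * d\<theta> (Suc k) j d"
  have "norm (fst (layer1 (Suc k)) - fst (layer2 (Suc k)))
      \<le> r1_hat J r1 (Suc k) * ?e + r2_hat J r1 r2 (Suc k) * norm (snd (layer1 k) - snd (layer2 k)) + ?n"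
    unfolding layer_Suc unfolding layer_snd r1_hat_def r2_hat_def r3_hat_def
    by (rule scale_iter_lipschitz[OF k layer_infnorm order_refl])
  also have "\<dots> \<le> r1_hat J r1 (Suc k) * ?e + r2_hat J r1 r2 (Suc k) * (c1 * ?e + c2 * dP) + ?n"
    by (intro add_mono mult_left_mono order_refl snd_diff r_hat_nonneg[OF k])
  also have "\<dots> = rate (Suc k) * ?e + r2_hat J r1 r2 (Suc k) * (c2 * dP) + ?n"
    by (simp add: algebra_simps)
  also have "\<dots> \<le> rate (Suc k) * (?b * (c2 * dP) + ?c) + r2_hat J r1 r2 (Suc k) * (c2 * dP) + ?n"
    using Suc r_hat_nonneg[OF k] c1_nonneg by (intro add_mono mult_left_mono order_refl) auto
  also have "\<dots> = (?b * rate (Suc k) + r2_hat J r1 r2 (Suc k)) * (c2 * dP) + (?c * rate (Suc k) + ?n)"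
    by (simp add: algebra_simps)
  also have "?b * rate (Suc k) + r2_hat J r1 r2 (Suc k) = (\<Sum>i=1..Suc k. r2_hat J r1 r2 i * (\<Prod>l=i+1..Suc k. rate l))"
  proof -
    have "?b * rate (Suc k) = (\<Sum>i=1..k. r2_hat J r1 r2 i * (\<Prod>l=i+1..Suc k. rate l))"
      unfolding sum_distrib_right by (rule sum.cong) (auto simp: mult.assoc)
    then show ?thesis by simp
  qed
  also have "?c * rate (Suc k) + ?n
      = (\<Sum>i=1..Suc k. \<Sum>j=1..J. \<Sum>d=1..D. r3_hat J r1 r3 i d j * (\<Prod>l=i+1..Suc k. rate l) * d\<theta> i j d)"
  proof -
    have "?c * rate (Suc k) = (\<Sum>i=1..k. \<Sum>j=1..J. \<Sum>d=1..D. r3_hat J r1 r3 i d j * (\<Prod>l=i+1..Suc k. rate l) * d\<theta> i j d)"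
      unfolding sum_distrib_right by (intro sum.cong refl) (auto simp: mult_ac)
    then show ?thesis by simp
  qed
  finally show ?case .
qed

text \<open>The last factor \<open>U\<^sub>K\<close> is bounded by \<open>p_max * z_inf * \<parallel>A\<parallel>\<^sub>2 * Y\<close>, which is at most
  \<open>c1\<close> but need not be at most \<open>p_max * Y * opnorm_inf A\<close>; hence the factor 2.\<close>

theorem net_lipschitz:
  "norm (cg_net A b z_inf c_max K J g P1 \<theta>1 y - cg_net A b z_inf c_max K J g P2 \<theta>2 y)
    \<le> 2 * kappa A z_inf p_min p_max K J r1 r2 Y * dP
      + (\<Sum>k=1..K. \<Sum>j=1..J. \<Sum>d=1..D. 2 * kappa_par A z_inf p_max K J r1 r2 r3 Y k j d * d\<theta> k j d)"
proof -
  define z1 u1 z2 u2 where "z1 = fst (layer1 K)" and "u1 = snd (layer1 K)"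
    and "z2 = fst (layer2 K)" and "u2 = snd (layer2 K)"
  define e where "e = norm (z1 - z2)"
  define s where "s = c1 + p_max * Y * opnorm_inf A"
  have dP: "0 \<le> dP" unfolding dP_def by (rule onorm_matrix_nonneg)
  have zi: "infnorm z1 \<le> z_inf" unfolding z1_def by (rule layer_infnorm)
  have u2: "norm u2 \<le> z_inf * c1"
  proof -
    have "norm u2 \<le> p_max * (z_inf * (nA * Y))"
      unfolding u2_def layer_snd by (rule norm_tikhonov_le) (use P layer_infnorm in \<open>auto simp: cov_class_def\<close>)
    also have "\<dots> = z_inf * (p_max * Y * nA * 1)" by simp
    also have "\<dots> \<le> z_inf * c1"
      unfolding const_c1_def using z_inf p_max Y_nonneg nA
      by (intro mult_left_mono mult_nonneg_nonneg) auto
    finally show ?thesis .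
  qed
  have "norm (cg_net A b z_inf c_max K J g P1 \<theta>1 y - cg_net A b z_inf c_max K J g P2 \<theta>2 y)
      = norm (rho c_max (z1 * u1) - rho c_max (z2 * u2))"
    by (simp add: cg_net_def z1_def z2_def u1_def u2_def layer1_def layer2_def case_prod_unfold Let_def)
  also have "\<dots> \<le> norm (z1 * u1 - z2 * u2)" by (rule rho_lipschitz[OF c_max])
  \<comment> \<open>\<open>z1\<close> is bounded in the sup norm and \<open>u2\<close> in the
    Euclidean norm, which suits the two Hadamard estimates.\<close>
  also have "\<dots> = norm (z1 * (u1 - u2) + (z1 - z2) * u2)" by (simp add: algebra_simps)
  also have "\<dots> \<le> norm (z1 * (u1 - u2)) + norm ((z1 - z2) * u2)" by (rule norm_triangle_ineq)
  also have "\<dots> \<le> z_inf * (c1 * e + c2 * dP) + e * (z_inf * c1)"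
  proof (rule add_mono)
    show "norm (z1 * (u1 - u2)) \<le> z_inf * (c1 * e + c2 * dP)"
      by (rule norm_hadamard_z[OF zi]) (unfold e_def z1_def z2_def u1_def u2_def, rule snd_diff)
    show "norm ((z1 - z2) * u2) \<le> e * (z_inf * c1)"
      unfolding e_def by (rule order_trans[OF norm_hadamard_le_norm]) (intro mult_left_mono u2 norm_ge_zero)
  qed
  also have "\<dots> = 2 * z_inf * c1 * e + z_inf * c2 * dP" by (simp add: algebra_simps)
  \<comment> \<open>The \<open>c2\<close> term is doubled as well, to let \<open>2 * kappa\<close>
    factor out.\<close>
  also have "\<dots> \<le> 2 * z_inf * s * e + 2 * (z_inf * c2) * dP"
  proof (rule add_mono)
    have "c1 \<le> s" using p_max Y_nonneg opnorm_inf_nonneg[of A] by (simp add: s_def)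
    then show "2 * z_inf * c1 * e \<le> 2 * z_inf * s * e"
      using z_inf by (intro mult_right_mono mult_left_mono) (auto simp: e_def)
    show "z_inf * c2 * dP \<le> 2 * (z_inf * c2) * dP"
      using mult_nonneg_nonneg[OF mult_nonneg_nonneg[OF z_inf c2_nonneg] dP] by (simp add: mult_ac)
  qed
  also have "\<dots> \<le> 2 * z_inf * s * (c1_hat K J r1 r2 c1 c2 * dP
      + (\<Sum>k=1..K. \<Sum>j=1..J. \<Sum>d=1..D. c2_hat K J r1 r2 r3 c1 k j d * d\<theta> k j d)) + 2 * (z_inf * c2) * dP"
  proof (intro add_mono mult_left_mono order_refl)
    show "e \<le> c1_hat K J r1 r2 c1 c2 * dP + (\<Sum>k=1..K. \<Sum>j=1..J. \<Sum>d=1..D. c2_hat K J r1 r2 r3 c1 k j d * d\<theta> k j d)"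
      using layer_lipschitz[OF order_refl]
      by (simp add: e_def z1_def z2_def c1_hat_def c2_hat_def mult_ac)
    show "0 \<le> 2 * z_inf * s"
      using z_inf c1_nonneg p_max Y_nonneg opnorm_inf_nonneg[of A] by (simp add: s_def)
    show "0 \<le> 2 * (z_inf * c2)"
      using z_inf c2_nonneg by simp
  qed
  also have "\<dots> = 2 * kappa A z_inf p_min p_max K J r1 r2 Y * dP
      + (\<Sum>k=1..K. \<Sum>j=1..J. \<Sum>d=1..D. 2 * kappa_par A z_inf p_max K J r1 r2 r3 Y k j d * d\<theta> k j d)"
    unfolding kappa_def kappa_par_def Let_def s_def[symmetric]
    by (simp add: algebra_simps sum_distrib_left)
  finally show ?thesis .
qed

lemmas net_lipschitz_params = net_lipschitz[unfolded dP_def d\<theta>_def]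

end

lemma kappa_nonneg: "0 \<le> kappa A z_inf p_min p_max K J r1 r2 Y"
proof -
  have rate: "0 \<le> r1_hat J r1 l + r2_hat J r1 r2 l * c1" "0 \<le> r2_hat J r1 r2 l" if "l \<in> {1..K}" for l
    using r_hat_nonneg[OF that] c1_nonneg by auto
  show ?thesis
    unfolding kappa_def Let_def c1_hat_def
    using z_inf c1_nonneg c2_nonneg p_max Y_nonneg opnorm_inf_nonneg[of A]
    by (intro add_nonneg_nonneg mult_nonneg_nonneg sum_nonneg prod_nonneg rate) auto
qed

lemma kappa_par_nonneg:
  assumes "k \<in> {1..K}" "j \<in> {1..J}" "d \<in> {1..D}"
  shows "0 \<le> kappa_par A z_inf p_max K J r1 r2 r3 Y k j d"
proof -
  have rate: "0 \<le> r1_hat J r1 l + r2_hat J r1 r2 l * c1" if "l \<in> {1..K}" for l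
    using r_hat_nonneg[OF that] c1_nonneg by auto
  have "0 \<le> r3 k d (j - 1)" by (rule r_nonneg(3)) (use assms in auto)
  moreover have "0 \<le> (\<Prod>l=j..<J. r1 k l)" by (intro prod_nonneg ballI r_nonneg(1)) (use assms in auto)
  moreover have "0 \<le> (\<Prod>l=k+1..K. r1_hat J r1 l + r2_hat J r1 r2 l * c1)"
    by (intro prod_nonneg ballI rate) (use assms in auto)
  ultimately show ?thesis
    unfolding kappa_par_def Let_def c2_hat_def r3_hat_def
    by (intro add_nonneg_nonneg mult_nonneg_nonneg z_inf c1_nonneg Y_nonneg opnorm_inf_nonneg
        less_imp_le[OF p_max])
qed

end

section \<open>Nets of covariance matrices and parameters\<close>

text \<open>On the diagonal a single unit entry, off the diagonal a symmetric pair: one basis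
  element for each free entry of a symmetric matrix.\<close>

definition sym_unit :: "'n \<times> 'n \<Rightarrow> real ^ 'n ^ 'n" where
  "sym_unit p = (\<chi> a b. if p = (a, b) \<or> p = (b, a) then 1 else 0)"

text \<open>Entry \<open>(a, b)\<close> of the combination can only receive the term of the ordered
  pair \<open>(min a b, max a b)\<close>, because \<open>I\<close> contains each unordered pair at
  most once.\<close>

lemma symmetric_matrix_in_span:
  fixes P :: "real ^ 'n::{finite,linorder} ^ 'n::{finite,linorder}"
  assumes sym: "transpose P = P" and I: "\<And>p. p \<in> I \<Longrightarrow> fst p \<le> snd p"
    and supp: "\<And>i j. i \<le> j \<Longrightarrow> (i, j) \<notin> I \<Longrightarrow> P $ i $ j = 0"
  shows "P \<in> span (sym_unit ` I)"
proof -
  have eq: "(\<Sum>p\<in>I. P $ fst p $ snd p *\<^sub>R sym_unit p) = P"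
  proof -
    have "(\<Sum>p\<in>I. P $ fst p $ snd p *\<^sub>R sym_unit p) $ a $ b = P $ a $ b" for a b
    proof -
      let ?q = "(min a b, max a b)"
      have "(\<Sum>p\<in>I. P $ fst p $ snd p *\<^sub>R sym_unit p) $ a $ b
          = (\<Sum>p\<in>I. P $ fst p $ snd p * (sym_unit p $ a $ b))" by simp
      also have "\<dots> = (\<Sum>p\<in>I. if p = ?q then P $ min a b $ max a b else 0)"
      proof (rule sum.cong[OF refl])
        fix p assume "p \<in> I"
        then have "fst p \<le> snd p" by (rule I)
        then have "p = (a, b) \<or> p = (b, a) \<longleftrightarrow> p = ?q"
          by (cases p) (auto simp: min_def max_def)
        then show "P $ fst p $ snd p * (sym_unit p $ a $ b) = (if p = ?q then P $ min a b $ max a b else 0)"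
          by (simp add: sym_unit_def)
      qed
      also have "\<dots> = P $ min a b $ max a b"
        using supp[of "min a b" "max a b"] min.coboundedI1[OF max.cobounded1, of a b b] finite_subset[OF subset_UNIV, of I]
        by (simp add: sum.delta' sum.delta)
      also have "\<dots> = P $ a $ b"
        using sym by (metis max_def min_def transpose_def vec_lambda_beta)
      finally show ?thesis .
    qed
    then show ?thesis unfolding vec_eq_iff by blast
  qed
  have "(\<Sum>p\<in>I. P $ fst p $ snd p *\<^sub>R sym_unit p) \<in> span (sym_unit ` I)"
    by (intro span_sum span_scale span_base) auto
  then show ?thesis unfolding eq .
qed

lemma index_of_less:
  fixes i j :: "'n::{finite,linorder}"
  assumes "i < j"
  shows "index_of i < index_of j"
proof -
  have "j \<in> {l. l \<le> j}" "j \<notin> {l. l \<le> i}" "{l. l \<le> i} \<subseteq> {l. l \<le> j}"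
    using assms by auto
  then have "{l. l \<le> i} \<subset> {l. l \<le> j}" by blast
  then show ?thesis unfolding index_of_def by (rule psubset_card_mono[rotated]) simp
qed

lemma inj_index_of: "inj (index_of :: 'n::{finite,linorder} \<Rightarrow> nat)"
  by (rule injI) (metis index_of_less less_irrefl linorder_neqE)

lemma index_of_bounds: "1 \<le> index_of i" "index_of i \<le> CARD('n)" for i :: "'n::{finite,linorder}"
proof -
  have "card {i} \<le> card {l. l \<le> i}" by (rule card_mono) auto
  then show "1 \<le> index_of i" by (simp add: index_of_def)
  show "index_of i \<le> CARD('n)" unfolding index_of_def by (rule card_mono) auto
qed

text \<open>Pairs on or above the diagonal that may carry an entry. For \<open>Const\<close> the
  entries are coupled; its span is generated by the identity matrix instead.\<close>

fun shape_index :: "cov_kind \<Rightarrow> ('n::{finite,linorder} \<times> 'n) set" where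
  "shape_index Const = {}"
| "shape_index Diag = range (\<lambda>i. (i, i))"
| "shape_index Tri = range (\<lambda>i. (i, i)) \<union> {(i, j). index_of j = Suc (index_of i)}"
| "shape_index Full = {(i, j). i \<le> j}"

lemma card_shape_index:
  assumes "kind \<noteq> Const"
  shows "card (shape_index kind :: ('n::{finite,linorder} \<times> 'n) set) \<le> cov_dim kind CARD('n)"
proof (cases kind)
  case Const then show ?thesis using assms by simp
next
  case Diag
  then show ?thesis by (simp add: card_image inj_on_def)
next
  case Tri
  let ?J = "{(i, j). index_of j = Suc (index_of i)} :: ('n \<times> 'n) set"
  \<comment> \<open>The row number is injective on the superdiagonal and never the last one.\<close>
  have "card ?J \<le> card {1..CARD('n) - 1}"
  proof (rule card_inj_on_le)
    show "inj_on (\<lambda>p. index_of (fst p)) ?J"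
      using inj_index_of[where 'n = 'n] by (auto simp: inj_on_def)
    show "(\<lambda>p. index_of (fst p)) ` ?J \<subseteq> {1..CARD('n) - 1}"
    proof
      fix m assume "m \<in> (\<lambda>p. index_of (fst p)) ` ?J"
      then obtain i j :: 'n where "m = index_of i" "index_of j = Suc (index_of i)" by auto
      then show "m \<in> {1..CARD('n) - 1}" using index_of_bounds(1)[of i] index_of_bounds(2)[of j] by simp
    qed
  qed simp
  moreover have "card (range (\<lambda>i :: 'n. (i, i))) = CARD('n)" by (simp add: card_image inj_on_def)
  ultimately show ?thesis
    using Tri card_Un_le[of "range (\<lambda>i :: 'n. (i, i))" ?J] by simp
next
  case Full
  let ?I = "{(i, j). i \<le> j} :: ('n \<times> 'n) set"
  \<comment> \<open>The upper triangle and its mirror image cover all pairs and meet in the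
    diagonal, so twice its size is \<open>n^2 + n\<close>.\<close>
  have "card ?I + card (prod.swap ` ?I) = card (?I \<union> prod.swap ` ?I) + card (?I \<inter> prod.swap ` ?I)"
    by (rule card_Un_Int) auto
  moreover have "?I \<union> prod.swap ` ?I = UNIV" by (auto simp: image_iff)
  moreover have "?I \<inter> prod.swap ` ?I = range (\<lambda>i. (i, i))" by auto
  moreover have "card (prod.swap ` ?I) = card ?I" by (simp add: card_image)
  moreover have "card (range (\<lambda>i :: 'n. (i, i))) = CARD('n)" by (simp add: card_image inj_on_def)
  ultimately have "2 * card ?I = CARD('n) * CARD('n) + CARD('n)" by simp
  then show ?thesis using Full by simp
qed

lemma cov_class_span:
  "\<exists>G :: (real ^ 'n::{finite,linorder} ^ 'n::{finite,linorder}) set. finite G \<and> card G \<le> cov_dim kind CARD('n) \<and> cov_class kind p_min p_max \<subseteq> span G"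
proof (cases "kind = Const")
  case True
  have "P \<in> span {mat 1}" if P: "P \<in> cov_class kind p_min p_max" for P :: "real ^ 'n::{finite,linorder} ^ 'n::{finite,linorder}"
  proof -
    obtain s where "P = mat s" using P True by (auto simp: cov_class_def)
    then have "P = s *\<^sub>R mat 1" by (simp add: vec_eq_iff mat_def)
    then show ?thesis by (simp add: span_base span_scale)
  qed
  then show ?thesis using True by (intro exI[of _ "{mat 1}"]) auto
next
  case False
  have idx: "fst p \<le> snd p" if "p \<in> shape_index kind" for p :: "'n::{finite,linorder} \<times> 'n::{finite,linorder}"
    using that False index_of_less[of "snd p" "fst p"] by (cases kind) (auto simp: not_less[symmetric])
  have "P \<in> span (sym_unit ` shape_index kind)" if P: "P \<in> cov_class kind p_min p_max" for P :: "real ^ 'n::{finite,linorder} ^ 'n::{finite,linorder}"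
  proof (rule symmetric_matrix_in_span[OF _ idx])
    show "transpose P = P" using P by (simp add: cov_class_def spd_def)
    fix i j :: "'n::{finite,linorder}" assume ij: "i \<le> j" "(i, j) \<notin> shape_index kind"
    show "P $ i $ j = 0"
    proof (cases kind)
      case Tri
      have "index_of i < index_of j" using ij Tri by (intro index_of_less) (auto simp: less_le)
      then have "\<bar>int (index_of i) - int (index_of j)\<bar> > 1" using ij Tri by auto
      then show ?thesis using P Tri by (auto simp: cov_class_def tridiagonal_def)
    qed (use P ij False in \<open>auto simp: cov_class_def diagonal_def\<close>)
  qed
  moreover have "card (sym_unit ` shape_index kind :: (real ^ 'n::{finite,linorder} ^ 'n::{finite,linorder}) set) \<le> cov_dim kind CARD('n)"
    by (rule order_trans[OF card_image_le[OF finite] card_shape_index[OF False]])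
  ultimately show ?thesis by (intro exI[of _ "sym_unit ` shape_index kind"]) auto
qed

lemma onorm_matrix_add: "onorm ((*v) (P + Q)) \<le> onorm ((*v) P) + onorm ((*v) Q)"
  for P Q :: "real ^ 'n ^ 'm"
  using onorm_triangle[of "(*v) P" "(*v) Q"] by (simp add: matrix_vector_mult_add_rdistrib[abs_def])

lemma onorm_matrix_scaleR: "onorm ((*v) (s *\<^sub>R P)) = \<bar>s\<bar> * onorm ((*v) P)" for P :: "real ^ 'n ^ 'm"
  using onorm_scaleR[of "(*v) P" s] by (simp add: scaleR_matrix_vector_assoc)

lemma onorm_matrix_eq_0: "onorm ((*v) P) = 0 \<Longrightarrow> P = 0" for P :: "real ^ 'n ^ 'm"
  using onorm_eq_0[of "(*v) P"] by (simp add: matrix_eq)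

text \<open>The class is neither a ball nor a linear space; only its span and the norm bound
  \<open>p_max\<close> enter the count, and the net consists of members of the class.\<close>

lemma cov_class_net:
  assumes ne: "cov_class kind p_min p_max \<noteq> ({} :: (real ^ 'n::{finite,linorder} ^ 'n::{finite,linorder}) set)" and t: "0 \<le> t"
  shows "\<exists>S :: (real ^ 'n::{finite,linorder} ^ 'n::{finite,linorder}) set. finite S \<and> S \<noteq> {} \<and> S \<subseteq> cov_class kind p_min p_max \<and>
    real (card S) \<le> (1 + 2 * p_max * t) ^ cov_dim kind CARD('n) \<and>
    (\<forall>P\<in>cov_class kind p_min p_max. \<exists>Q\<in>S. t * onorm ((*v) (P - Q)) \<le> 1)"
proof -
  obtain G :: "(real ^ 'n::{finite,linorder} ^ 'n::{finite,linorder}) set"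
    where G: "finite G" "card G \<le> cov_dim kind CARD('n)" "cov_class kind p_min p_max \<subseteq> span G"
    using cov_class_span by blast
  show ?thesis
    by (rule finite_net_span[where nn = "\<lambda>P. onorm ((*v) P)", OF onorm_matrix_nonneg onorm_matrix_eq_0
          onorm_matrix_scaleR onorm_matrix_add G ne _ t])
      (auto simp: cov_class_def)
qed

section \<open>Joint nets of all parameters\<close>

text \<open>Entries of \<open>\<theta>\<close> outside the index ranges stay arbitrary, as in
  \<open>cg_hypotheses\<close>; nets therefore approximate only the entries in range.\<close>

definition hyp_params ::
  "(real ^ 'n ^ 'n) set \<Rightarrow> param_tuple set \<Rightarrow> nat \<Rightarrow> nat \<Rightarrow> ((real ^ 'n ^ 'n) \<times> (nat \<Rightarrow> nat \<Rightarrow> param_tuple)) set" where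
  "hyp_params \<P> \<T> K J = {(P, \<theta>). P \<in> \<P> \<and> (\<forall>k\<in>{1..K}. \<forall>j\<in>{1..J}. \<theta> k j \<in> \<T>)}"

text \<open>A product of nets, one per block and each with its own mesh, because the blocks have
  different Lipschitz constants.\<close>

lemma hyp_params_net:
  fixes kind :: cov_kind and p_min p_max :: real and \<P> :: "(real ^ 'n::{finite,linorder} ^ 'n::{finite,linorder}) set"
  defines "\<P> \<equiv> cov_class kind p_min p_max"
  assumes ne: "\<P> \<noteq> {}"
    and nrm: "\<And>d. d \<in> {1..D} \<Longrightarrow> is_norm_on_Rn (\<alpha> d) (nrm d)" and \<omega>: "\<And>d. d \<in> {1..D} \<Longrightarrow> 0 \<le> \<omega> d"
    and s: "0 \<le> s" and t: "\<And>k j d. k \<in> {1..K} \<Longrightarrow> j \<in> {1..J} \<Longrightarrow> d \<in> {1..D} \<Longrightarrow> 0 \<le> t k j d"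
  shows "\<exists>A. finite A \<and> A \<noteq> {} \<and> A \<subseteq> hyp_params \<P> (tuple_space D \<alpha> nrm \<omega>) K J \<and>
    real (card A) \<le> (1 + 2 * p_max * s) ^ cov_dim kind CARD('n)
        * (\<Prod>k=1..K. \<Prod>j=1..J. \<Prod>d=1..D. (1 + 2 * \<omega> d * t k j d) ^ \<alpha> d) \<and>
    (\<forall>(P, \<theta>) \<in> hyp_params \<P> (tuple_space D \<alpha> nrm \<omega>) K J. \<exists>(Q, \<eta>) \<in> A.
        s * onorm ((*v) (P - Q)) \<le> 1 \<and>
        (\<forall>k\<in>{1..K}. \<forall>j\<in>{1..J}. \<forall>d\<in>{1..D}. t k j d * nrm d (\<lambda>i. \<theta> k j d i - \<eta> k j d i) \<le> 1))"
proof -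
  obtain SP where SP: "finite SP" "SP \<noteq> {}" "SP \<subseteq> \<P>"
      "real (card SP) \<le> (1 + 2 * p_max * s) ^ cov_dim kind CARD('n)"
      "\<And>P. P \<in> \<P> \<Longrightarrow> \<exists>Q\<in>SP. s * onorm ((*v) (P - Q)) \<le> 1"
    using cov_class_net[OF ne[unfolded \<P>_def] s] unfolding \<P>_def by blast
  define B where "B = {1..K} \<times> {1..J} \<times> {1..D}"
  have "\<exists>S. finite S \<and> S \<noteq> {} \<and> S \<subseteq> param_ball (\<alpha> d) (nrm d) (\<omega> d) \<and>
      real (card S) \<le> (1 + 2 * \<omega> d * t k j d) ^ \<alpha> d \<and>
      (\<forall>x\<in>param_ball (\<alpha> d) (nrm d) (\<omega> d). \<exists>s\<in>S. t k j d * nrm d (\<lambda>i. x i - s i) \<le> 1)"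
    if "(k, j, d) \<in> B" for k j d
  proof -
    have d: "d \<in> {1..D}" "0 \<le> t k j d" using that t by (auto simp: B_def)
    interpret coord_norm "\<alpha> d" "nrm d" by unfold_locales (rule nrm[OF d(1)])
    have "(\<lambda>_. 0) \<in> param_ball (\<alpha> d) (nrm d) (\<omega> d)"
      using \<omega>[OF d(1)] nrm[OF d(1)] by (auto simp: param_ball_def topspace_Euclidean_space is_norm_on_Rn_def)
    then show ?thesis by (intro finite_net d(2)) auto
  qed
  then have "\<forall>b\<in>B. \<exists>S. case b of (k, j, d) \<Rightarrow> finite S \<and> S \<noteq> {} \<and> S \<subseteq> param_ball (\<alpha> d) (nrm d) (\<omega> d) \<and>
      real (card S) \<le> (1 + 2 * \<omega> d * t k j d) ^ \<alpha> d \<and>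
      (\<forall>x\<in>param_ball (\<alpha> d) (nrm d) (\<omega> d). \<exists>s\<in>S. t k j d * nrm d (\<lambda>i. x i - s i) \<le> 1)"
    by auto
  then obtain S where S: "\<And>k j d. (k, j, d) \<in> B \<Longrightarrow> finite (S (k, j, d)) \<and> S (k, j, d) \<noteq> {} \<and>
      S (k, j, d) \<subseteq> param_ball (\<alpha> d) (nrm d) (\<omega> d) \<and>
      real (card (S (k, j, d))) \<le> (1 + 2 * \<omega> d * t k j d) ^ \<alpha> d \<and>
      (\<forall>x\<in>param_ball (\<alpha> d) (nrm d) (\<omega> d). \<exists>s\<in>S (k, j, d). t k j d * nrm d (\<lambda>i. x i - s i) \<le> 1)"
    by (drule_tac bchoice) fastforce
  have finB: "finite B" by (simp add: B_def)
  \<comment> \<open>Choices are indexed by triples in \<open>B\<close> and decoded into tuples; the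
    restriction to \<open>{1..D}\<close> makes them extensional, as \<open>tuple_space\<close>
    demands.\<close>
  define dec where "dec = (\<lambda>v :: nat \<times> nat \<times> nat \<Rightarrow> nat \<Rightarrow> real. \<lambda>k j. \<lambda>d\<in>{1..D}. v (k, j, d))"
  define A where "A = (\<lambda>(P, v). (P, dec v)) ` (SP \<times> PiE B S)"
  have Sb: "finite (S b)" "S b \<noteq> {}" if "b \<in> B" for b using S that by (cases b; auto)+
  have finPi: "finite (PiE B S)" using finB Sb by (intro finite_PiE) auto
  have "finite A" unfolding A_def using SP(1) finPi by simp
  moreover have "A \<noteq> {}" using SP(2) Sb(2) by (auto simp: A_def PiE_eq_empty_iff)
  moreover have "A \<subseteq> hyp_params \<P> (tuple_space D \<alpha> nrm \<omega>) K J"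
  proof -
    have "dec v k j \<in> tuple_space D \<alpha> nrm \<omega>" if v: "v \<in> PiE B S" and kj: "k \<in> {1..K}" "j \<in> {1..J}" for v k j
      unfolding tuple_space_def dec_def
    proof (rule restrict_PiE_iff[THEN iffD2], intro ballI)
      fix d assume "d \<in> {1..D}"
      then have "(k, j, d) \<in> B" using kj by (simp add: B_def)
      then show "v (k, j, d) \<in> param_ball (\<alpha> d) (nrm d) (\<omega> d)" using S PiE_mem[OF v] by blast
    qed
    then show ?thesis using SP(3) by (auto simp: A_def hyp_params_def)
  qed
  moreover have "real (card A) \<le> (1 + 2 * p_max * s) ^ cov_dim kind CARD('n)
        * (\<Prod>k=1..K. \<Prod>j=1..J. \<Prod>d=1..D. (1 + 2 * \<omega> d * t k j d) ^ \<alpha> d)"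
  proof -
    have "card A \<le> card SP * card (PiE B S)"
      unfolding A_def using card_image_le[of "SP \<times> PiE B S" "\<lambda>(P, v). (P, dec v)"] SP(1) finPi
      by (simp add: card_cartesian_product)
    then have "real (card A) \<le> real (card SP) * (\<Prod>b\<in>B. real (card (S b)))"
      using finB by (simp add: card_PiE flip: of_nat_mult of_nat_prod)
    also have "\<dots> \<le> (1 + 2 * p_max * s) ^ cov_dim kind CARD('n) * (\<Prod>(k, j, d)\<in>B. (1 + 2 * \<omega> d * t k j d) ^ \<alpha> d)"
    proof (rule mult_mono[OF SP(4)])
      show "(\<Prod>b\<in>B. real (card (S b))) \<le> (\<Prod>(k, j, d)\<in>B. (1 + 2 * \<omega> d * t k j d) ^ \<alpha> d)"
        by (rule prod_mono) (use S in auto)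
      show "0 \<le> (1 + 2 * p_max * s) ^ cov_dim kind CARD('n)"
        using SP(4) of_nat_0_le_iff order_trans by blast
    qed (simp add: prod_nonneg)
    also have "(\<Prod>(k, j, d)\<in>B. (1 + 2 * \<omega> d * t k j d) ^ \<alpha> d)
        = (\<Prod>k=1..K. \<Prod>j=1..J. \<Prod>d=1..D. (1 + 2 * \<omega> d * t k j d) ^ \<alpha> d)"
      unfolding B_def by (simp add: prod.cartesian_product case_prod_unfold)
    finally show ?thesis .
  qed
  moreover have "\<exists>(Q, \<eta>) \<in> A. s * onorm ((*v) (P - Q)) \<le> 1 \<and>
        (\<forall>k\<in>{1..K}. \<forall>j\<in>{1..J}. \<forall>d\<in>{1..D}. t k j d * nrm d (\<lambda>i. \<theta> k j d i - \<eta> k j d i) \<le> 1)"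
    if w: "(P, \<theta>) \<in> hyp_params \<P> (tuple_space D \<alpha> nrm \<omega>) K J" for P \<theta>
  proof -
    obtain Q where Q: "Q \<in> SP" "s * onorm ((*v) (P - Q)) \<le> 1"
      using SP(5)[of P] w unfolding hyp_params_def by blast
    have "\<forall>b\<in>B. \<exists>x. case b of (k, j, d) \<Rightarrow> x \<in> S (k, j, d) \<and> t k j d * nrm d (\<lambda>i. \<theta> k j d i - x i) \<le> 1"
    proof (clarify)
      fix k j d assume b: "(k, j, d) \<in> B"
      then have "\<theta> k j \<in> tuple_space D \<alpha> nrm \<omega>" "d \<in> {1..D}" using w by (auto simp: B_def hyp_params_def)
      then have "\<theta> k j d \<in> param_ball (\<alpha> d) (nrm d) (\<omega> d)" unfolding tuple_space_def by (rule PiE_mem)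
      then show "\<exists>x. x \<in> S (k, j, d) \<and> t k j d * nrm d (\<lambda>i. \<theta> k j d i - x i) \<le> 1" using S[OF b] by blast
    qed
    then obtain v where v: "\<And>k j d. (k, j, d) \<in> B \<Longrightarrow> v (k, j, d) \<in> S (k, j, d) \<and> t k j d * nrm d (\<lambda>i. \<theta> k j d i - v (k, j, d) i) \<le> 1"
      by (drule_tac bchoice) fastforce
    have "restrict v B \<in> PiE B S" using v by (auto intro!: restrict_PiE_iff[THEN iffD2])
    then have "(Q, dec (restrict v B)) \<in> A" using Q(1) by (force simp: A_def)
    moreover have "t k j d * nrm d (\<lambda>i. \<theta> k j d i - dec (restrict v B) k j d i) \<le> 1"
      if "k \<in> {1..K}" "j \<in> {1..J}" "d \<in> {1..D}" for k j d
      using v[of k j d] that by (simp add: dec_def B_def)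
    ultimately show ?thesis using Q(2) by blast
  qed
  ultimately show ?thesis by (intro exI[of _ A]) (auto simp del: split_paired_Ex)
qed

section \<open>Rademacher average of the network\<close>

text \<open>The sum of the block entropies is at most the square of the sum of their roots
  (Euclidean norm below l1 norm). This turns one root of a total entropy into the sum of roots over
  the blocks.\<close>

lemma prod_power_le_exp_square:
  fixes x :: "'b \<Rightarrow> real" and e :: "'b \<Rightarrow> nat"
  assumes B: "finite B" and x: "\<And>b. b \<in> B \<Longrightarrow> 0 \<le> x b"
  shows "(\<Prod>b\<in>B. (1 + 2 ^ n * x b) ^ e b) \<le> exp ((\<Sum>b\<in>B. sqrt (real (e b) * ln (1 + 2 ^ n * x b)))\<^sup>2)"
proof -
  have nn: "0 \<le> real (e b) * ln (1 + 2 ^ n * x b)" if "b \<in> B" for b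
    using x[OF that] by simp
  have "(\<Prod>b\<in>B. (1 + 2 ^ n * x b) ^ e b) = (\<Prod>b\<in>B. exp (real (e b) * ln (1 + 2 ^ n * x b)))"
  proof (rule prod.cong[OF refl])
    fix b assume "b \<in> B"
    then have "0 < 1 + 2 ^ n * x b" using x[of b] by (simp add: add_pos_nonneg)
    then show "(1 + 2 ^ n * x b) ^ e b = exp (real (e b) * ln (1 + 2 ^ n * x b))"
      by (simp add: exp_of_nat_mult)
  qed
  also have "\<dots> = exp (\<Sum>b\<in>B. real (e b) * ln (1 + 2 ^ n * x b))"
    using B by (simp add: exp_sum)
  also have "(\<Sum>b\<in>B. real (e b) * ln (1 + 2 ^ n * x b)) \<le> (\<Sum>b\<in>B. sqrt (real (e b) * ln (1 + 2 ^ n * x b)))\<^sup>2"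
  proof -
    let ?f = "\<lambda>b. sqrt (real (e b) * ln (1 + 2 ^ n * x b))"
    have "L2_set ?f B \<le> sum ?f B" by (rule L2_set_le_sum) (use nn in auto)
    then have "(L2_set ?f B)\<^sup>2 \<le> (sum ?f B)\<^sup>2" by (rule power_mono) simp
    moreover have "(L2_set ?f B)\<^sup>2 = (\<Sum>b\<in>B. (?f b)\<^sup>2)"
      unfolding L2_set_def by (rule real_sqrt_pow2) (simp add: sum_nonneg)
    moreover have "(\<Sum>b\<in>B. (?f b)\<^sup>2) = (\<Sum>b\<in>B. real (e b) * ln (1 + 2 ^ n * x b))"
      by (rule sum.cong) (use nn in auto)
    ultimately show ?thesis by simp
  qed
  finally show ?thesis by simp
qed

lemma sum_entropy_le:
  fixes x :: "'b \<Rightarrow> real" and e :: "'b \<Rightarrow> nat"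
  assumes x: "\<And>b. b \<in> B \<Longrightarrow> 0 \<le> x b"
  shows "(\<Sum>n=1..m. (\<Sum>b\<in>B. sqrt (real (e b) * ln (1 + 2 ^ n * x b))) / 2 ^ n)
     \<le> sqrt 2 * (\<Sum>b\<in>B. sqrt (real (e b) * ln (exp 1 * (1 + x b))))"
proof -
  have "(\<Sum>n=1..m. (\<Sum>b\<in>B. sqrt (real (e b) * ln (1 + 2 ^ n * x b))) / 2 ^ n)
      = (\<Sum>b\<in>B. sqrt (real (e b)) * (\<Sum>n=1..m. sqrt (ln (1 + 2 ^ n * x b)) / 2 ^ n))"
    unfolding sum_divide_distrib by (subst sum.swap) (simp add: sum_distrib_left real_sqrt_mult)
  also have "\<dots> \<le> (\<Sum>b\<in>B. sqrt (real (e b)) * (sqrt 2 * sqrt (ln (exp 1 * (1 + x b)))))"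
    by (intro sum_mono mult_left_mono sum_sqrt_ln_powers_2 x) auto
  also have "\<dots> = sqrt 2 * (\<Sum>b\<in>B. sqrt (real (e b) * ln (exp 1 * (1 + x b))))"
    by (simp add: sum_distrib_left real_sqrt_mult mult_ac)
  finally show ?thesis .
qed

text \<open>Blocks are indexed by an option type: \<open>None\<close> is the covariance matrix,
  \<open>Some (k, j, d)\<close> a parameter vector. Sums and products over all blocks are then
  uniform.\<close>

lemma sum_option: "finite B \<Longrightarrow> (\<Sum>b\<in>insert None (Some ` B). f b) = f None + (\<Sum>b\<in>B. f (Some b))"
  for f :: "_ \<Rightarrow> real"
  by (simp add: sum.reindex image_iff)

lemma prod_option: "finite B \<Longrightarrow> (\<Prod>b\<in>insert None (Some ` B). f b) = f None * (\<Prod>b\<in>B. f (Some b))"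
  for f :: "_ \<Rightarrow> real"
  by (simp add: prod.reindex image_iff)

lemma sum_triple:
  "(\<Sum>(k, j, d)\<in>{1..K} \<times> {1..J} \<times> {1..D}. f k j d) = (\<Sum>k=1..K. \<Sum>j=1..J. \<Sum>d=1..D. f k j d)"
  for f :: "nat \<Rightarrow> nat \<Rightarrow> nat \<Rightarrow> real"
  by (simp add: sum.cartesian_product case_prod_unfold)

lemma prod_triple:
  "(\<Prod>(k, j, d)\<in>{1..K} \<times> {1..J} \<times> {1..D}. f k j d) = (\<Prod>k=1..K. \<Prod>j=1..J. \<Prod>d=1..D. f k j d)"
  for f :: "nat \<Rightarrow> nat \<Rightarrow> nat \<Rightarrow> real"
  by (simp add: prod.cartesian_product case_prod_unfold)

definition complexity ::
  "nat \<Rightarrow> real \<Rightarrow> (nat \<Rightarrow> nat) \<Rightarrow> (nat \<Rightarrow> real) \<Rightarrow> nat \<Rightarrow> nat \<Rightarrow> nat \<Rightarrow> real \<Rightarrow> real \<Rightarrow> (nat \<Rightarrow> nat \<Rightarrow> nat \<Rightarrow> real) \<Rightarrow> real" where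
  "complexity m p_max \<alpha> \<omega> K J D c_max \<kappa> \<kappa>p =
     sqrt (real m) * sqrt (ln (exp 1 * (1 + 4 * p_max * real (K * J * D + 1) * \<kappa> / c_max)))
     + (\<Sum>k=1..K. \<Sum>j=1..J. \<Sum>d=1..D.
          sqrt (real (\<alpha> d) * ln (exp 1 * (1 + 4 * \<omega> d * real (K * J * D + 1) * \<kappa>p k j d / c_max))))"

context network_bounds
begin

definition net :: "(real ^ 'n::{finite,linorder} ^ 'n::{finite,linorder}) \<times> (nat \<Rightarrow> nat \<Rightarrow> param_tuple) \<Rightarrow> real ^ 'n::{finite,linorder}" where
  "net w = cg_net A b z_inf c_max K J g (fst w) (snd w) y"

text \<open>The budget \<open>q\<close> is divided equally among the \<open>K * J * D + 1\<close>
  blocks; this is the origin of that factor in the bound.\<close>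

lemma net_diff_scaled:
  assumes w: "w \<in> hyp_params \<P> \<T> K J" "w' \<in> hyp_params \<P> \<T> K J"
    and q: "0 < q"
    and P: "2 * kappa A z_inf p_min p_max K J r1 r2 Y * onorm ((*v) (fst w - fst w')) \<le> q / real (K * J * D + 1)"
    and \<theta>: "\<And>k j d. k \<in> {1..K} \<Longrightarrow> j \<in> {1..J} \<Longrightarrow> d \<in> {1..D} \<Longrightarrow>
       2 * kappa_par A z_inf p_max K J r1 r2 r3 Y k j d * nrm d (\<lambda>i. snd w k j d i - snd w' k j d i) \<le> q / real (K * J * D + 1)"
  shows "norm (net w - net w') \<le> q"
proof -
  have "norm (net w - net w') \<le> 2 * kappa A z_inf p_min p_max K J r1 r2 Y * onorm ((*v) (fst w - fst w'))
      + (\<Sum>k=1..K. \<Sum>j=1..J. \<Sum>d=1..D. 2 * kappa_par A z_inf p_max K J r1 r2 r3 Y k j d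
           * nrm d (\<lambda>i. snd w k j d i - snd w' k j d i))"
    unfolding net_def by (rule net_lipschitz_params) (use w in \<open>auto simp: hyp_params_def\<close>)
  also have "\<dots> \<le> q / real (K * J * D + 1) + (\<Sum>k=1..K. \<Sum>j=1..J. \<Sum>d=1..D. q / real (K * J * D + 1))"
    by (intro add_mono sum_mono P \<theta>)
  also have "\<dots> = real (K * J * D + 1) * (q / real (K * J * D + 1))"
    by (simp add: algebra_simps add_divide_distrib)
  also have "\<dots> = q"
  proof -
    have "m * (q / m) = q" if "m \<noteq> 0" for m :: real using that by simp
    moreover have "real (K * J * D + 1) \<noteq> 0" unfolding of_nat_eq_0_iff by simp
    ultimately show ?thesis by blast
  qed
  finally show ?thesis .
qed

end

text \<open>The net is chosen in parameter space, hence serves all measurements of the sample at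
  once; the loss vectors then have Euclidean mesh \<open>sqrt (card I)\<close> times the mesh per
  measurement.\<close>

lemma network_rademacher_bound:
  fixes A :: "real ^ 'n::{finite,linorder} ^ 'm" and ys :: "'i \<Rightarrow> real ^ 'm" and cs :: "'i \<Rightarrow> real ^ 'n::{finite,linorder}"
  assumes I: "finite I" "I \<noteq> {}"
    and nb: "\<And>i. i \<in> I \<Longrightarrow>
      network_bounds A p_min p_max z_inf Y (ys i) K J D nrm g kind (tuple_space D \<alpha> nrm \<omega>) r1 r2 r3 b c_max"
    and loss: "loss_assumption L c \<tau>"
    and nrm: "\<And>d. d \<in> {1..D} \<Longrightarrow> is_norm_on_Rn (\<alpha> d) (nrm d)" and \<omega>: "\<And>d. d \<in> {1..D} \<Longrightarrow> 0 \<le> \<omega> d"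
    and h: "\<And>n. h n \<in> hyp_params (cov_class kind p_min p_max) (tuple_space D \<alpha> nrm \<omega>) K J"
  shows "sign_avg I (\<lambda>s. SUP n. \<Sum>i\<in>I. s i * L (cg_net A b z_inf c_max K J g (fst (h n)) (snd (h n)) (ys i)) (cs i))
    \<le> 4 * (\<tau> * c_max * sqrt (real (card I)))
      * complexity (cov_dim kind CARD('n)) p_max \<alpha> \<omega> K J D c_max
          (kappa A z_inf p_min p_max K J r1 r2 Y) (kappa_par A z_inf p_max K J r1 r2 r3 Y)"
proof -
  obtain i0 where i0: "i0 \<in> I" using I(2) by blast
  interpret nb0: network_bounds A p_min p_max z_inf Y "ys i0" K J D nrm g kind "tuple_space D \<alpha> nrm \<omega>" r1 r2 r3 b c_max
    by (rule nb[OF i0])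
  let ?W = "hyp_params (cov_class kind p_min p_max) (tuple_space D \<alpha> nrm \<omega>) K J
    :: ((real ^ 'n::{finite,linorder} ^ 'n::{finite,linorder}) \<times> (nat \<Rightarrow> nat \<Rightarrow> param_tuple)) set"
  let ?\<kappa> = "kappa A z_inf p_min p_max K J r1 r2 Y"
  let ?\<kappa>p = "kappa_par A z_inf p_max K J r1 r2 r3 Y"
  define M where "M = real (K * J * D + 1)"
  have M: "0 < M" unfolding M_def of_nat_0_less_iff by simp
  have cm: "0 < c_max" by (rule nb0.c_max)
  have \<tau>: "0 \<le> \<tau>" using loss by (simp add: loss_assumption_def)
  define B where "B = {1..K} \<times> {1..J} \<times> {1..D}"
  define x where "x = (\<lambda>b. case b of None \<Rightarrow> 4 * p_max * M * ?\<kappa> / c_max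
      | Some (k, j, d) \<Rightarrow> 4 * \<omega> d * M * ?\<kappa>p k j d / c_max)"
  define e where "e = (\<lambda>b. case b of None \<Rightarrow> cov_dim kind CARD('n) | Some (k :: nat, j :: nat, d) \<Rightarrow> \<alpha> d)"
  let ?B = "insert None (Some ` B)"
  have finB: "finite B" by (simp add: B_def)
  have x: "0 \<le> x b" if "b \<in> ?B" for b
    using that M cm nb0.p_max nb0.kappa_nonneg nb0.kappa_par_nonneg \<omega>
    by (auto simp: x_def B_def)
  define k where "k = (\<lambda>n. \<Sum>b\<in>?B. sqrt (real (e b) * ln (1 + 2 ^ n * x b)))"
  have cplx: "(\<Sum>b\<in>?B. sqrt (real (e b) * ln (exp 1 * (1 + x b))))
      = complexity (cov_dim kind CARD('n)) p_max \<alpha> \<omega> K J D c_max ?\<kappa> ?\<kappa>p"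
    unfolding sum_option[OF finB] complexity_def M_def[symmetric] sum_triple[symmetric] B_def[symmetric]
    by (simp add: x_def e_def real_sqrt_mult case_prod_unfold)
  have ne: "cov_class kind p_min p_max \<noteq> ({} :: (real ^ 'n::{finite,linorder} ^ 'n::{finite,linorder}) set)"
    using h[of undefined] by (auto simp: hyp_params_def)
  \<comment> \<open>\<open>s n * v <= 1\<close> says that \<open>2 * kappa * v\<close> is at most
    \<open>c_max / (2^n * M)\<close>, one share of the budget at scale \<open>n\<close>;
    \<open>t\<close> does the same for the other blocks.\<close>
  define s where "s = (\<lambda>n. 2 * ?\<kappa> * M * 2 ^ n / c_max)"
  define t where "t = (\<lambda>n k j d. 2 * ?\<kappa>p k j d * M * 2 ^ n / c_max)"
  define good where "good = (\<lambda>n A. finite A \<and> A \<noteq> {} \<and> A \<subseteq> ?W \<and>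
    real (card A) \<le> (1 + 2 * p_max * s n) ^ cov_dim kind CARD('n)
        * (\<Prod>k=1..K. \<Prod>j=1..J. \<Prod>d=1..D. (1 + 2 * \<omega> d * t n k j d) ^ \<alpha> d) \<and>
    (\<forall>(P, \<theta>) \<in> ?W. \<exists>(Q, \<eta>) \<in> A.
        s n * onorm ((*v) (P - Q)) \<le> 1 \<and>
        (\<forall>k\<in>{1..K}. \<forall>j\<in>{1..J}. \<forall>d\<in>{1..D}. t n k j d * nrm d (\<lambda>i. \<theta> k j d i - \<eta> k j d i) \<le> 1)))"
  have "\<exists>A. good n A" for n
  proof -
    have s0: "0 \<le> s n"
      using M cm nb0.kappa_nonneg by (simp add: s_def)
    have t0: "0 \<le> t n k j d" if "k \<in> {1..K}" "j \<in> {1..J}" "d \<in> {1..D}" for k j d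
      using M cm nb0.kappa_par_nonneg[OF that] by (simp add: t_def)
    show ?thesis
      unfolding good_def
      by (rule hyp_params_net[where t = "t n" and s = "s n" and kind = kind and p_min = p_min and p_max = p_max
          and \<alpha> = \<alpha> and nrm = nrm and \<omega> = \<omega> and K = K and J = J and D = D, OF ne nrm \<omega> s0 t0])
  qed
  then obtain Net where Net: "\<And>n. good n (Net n)" by metis
  note Net = Net[unfolded good_def]
  have cardNet: "real (card (Net n)) \<le> exp ((k n)\<^sup>2)" for n
  proof -
    \<comment> \<open>Here the 4 of the bound appears: 2 from the covering number times 2 from the
      Lipschitz constant.\<close>
    have eP: "1 + 2 * p_max * s n = 1 + 2 ^ n * x None"
      and eb: "1 + 2 * \<omega> d * t n k j d = 1 + 2 ^ n * x (Some (k, j, d))" for k j d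
      by (simp_all add: s_def t_def x_def)
    have "real (card (Net n)) \<le> (1 + 2 * p_max * s n) ^ cov_dim kind CARD('n)
        * (\<Prod>k=1..K. \<Prod>j=1..J. \<Prod>d=1..D. (1 + 2 * \<omega> d * t n k j d) ^ \<alpha> d)"
      using Net by blast
    also have "\<dots> = (\<Prod>b\<in>?B. (1 + 2 ^ n * x b) ^ e b)"
      unfolding prod_option[OF finB] prod_triple[symmetric] B_def[symmetric] eP eb
      by (simp add: e_def case_prod_unfold)
    also have "\<dots> \<le> exp ((k n)\<^sup>2)"
      unfolding k_def by (rule prod_power_le_exp_square) (use finB x in auto)
    finally show ?thesis .
  qed
  define X where "X = (\<lambda>w i. L (cg_net A b z_inf c_max K J g (fst w) (snd w) (ys i)) (cs i))"
  define R where "R = \<tau> * c_max * sqrt (real (card I))"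
  have R: "0 \<le> R" using \<tau> cm by (simp add: R_def)
  have R2: "R\<^sup>2 = real (card I) * (\<tau> * c_max)\<^sup>2" by (simp add: R_def power_mult_distrib)
  have lip: "\<bar>L a1 v - L a2 v\<bar> \<le> \<tau> * norm (a1 - a2)" for a1 a2 v
    using loss by (simp add: loss_assumption_def)
  have sumsq: "(\<Sum>i\<in>I. (f i)\<^sup>2) \<le> real (card I) * q\<^sup>2" if "\<And>i. i \<in> I \<Longrightarrow> \<bar>f i\<bar> \<le> q" for f and q :: real
    using sum_bounded_above[of I "\<lambda>i. (f i)\<^sup>2" "q\<^sup>2"] power_mono[OF that, of _ 2] by simp
  have "sign_avg I (\<lambda>s. SUP n. \<Sum>i\<in>I. s i * X (h n) i)
      \<le> 2 * sqrt 2 * R * (sqrt 2 * (\<Sum>b\<in>?B. sqrt (real (e b) * ln (exp 1 * (1 + x b)))))"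
  \<comment> \<open>The chain starts at the loss of the zero prediction: \<open>rho\<close> keeps
    every prediction in the ball of radius \<open>c_max\<close>, so each entry of a loss vector is
    within \<open>\<tau> * c_max\<close> of it and the radius is \<open>R\<close>.\<close>
  proof (rule chaining[OF I(1) R, where W = ?W and z = "\<lambda>i. L 0 (cs i)" and A = Net and k = k])
    fix w assume "w \<in> ?W"
    have "\<bar>X w i - L 0 (cs i)\<bar> \<le> \<tau> * c_max" for i
    proof -
      have "norm (cg_net A b z_inf c_max K J g (fst w) (snd w) (ys i)) \<le> c_max"
        by (simp add: cg_net_def Let_def case_prod_unfold norm_rho_le cm)
      then show ?thesis
        using lip[of "cg_net A b z_inf c_max K J g (fst w) (snd w) (ys i)" "cs i" 0]
          mult_left_mono[OF _ \<tau>, of _ c_max]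
        unfolding X_def diff_zero by (blast intro: order_trans)
    qed
    then show "(\<Sum>i\<in>I. (X w i - L 0 (cs i))\<^sup>2) \<le> R\<^sup>2" unfolding R2 by (rule sumsq)
  next
    fix n w assume w: "w \<in> ?W"
    have "\<forall>(P, \<theta>) \<in> ?W. \<exists>(Q, \<eta>) \<in> Net n.
        s n * onorm ((*v) (P - Q)) \<le> 1 \<and>
        (\<forall>k\<in>{1..K}. \<forall>j\<in>{1..J}. \<forall>d\<in>{1..D}. t n k j d * nrm d (\<lambda>i. \<theta> k j d i - \<eta> k j d i) \<le> 1)"
      using Net[of n] by (elim conjE)
    from bspec[OF this w] obtain a where a: "a \<in> Net n" "s n * onorm ((*v) (fst w - fst a)) \<le> 1"
      "\<And>k j d. k \<in> {1..K} \<Longrightarrow> j \<in> {1..J} \<Longrightarrow> d \<in> {1..D} \<Longrightarrow> t n k j d * nrm d (\<lambda>i. snd w k j d i - snd a k j d i) \<le> 1"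
      unfolding case_prod_unfold by blast
    have aW: "a \<in> ?W" using Net[of n] a(1) by blast
    have scale: "2 * u * v \<le> c_max / 2 ^ n / M" if "2 * u * M * 2 ^ n / c_max * v \<le> 1" for u v
      using that M cm by (simp add: field_simps)
    have "\<bar>X w i - X a i\<bar> \<le> \<tau> * c_max / 2 ^ n" if i: "i \<in> I" for i
    proof -
      interpret nbi: network_bounds A p_min p_max z_inf Y "ys i" K J D nrm g kind "tuple_space D \<alpha> nrm \<omega>" r1 r2 r3 b c_max
        by (rule nb[OF i])
      have "norm (nbi.net w - nbi.net a) \<le> c_max / 2 ^ n"
        by (rule nbi.net_diff_scaled[OF w aW]; (unfold M_def[symmetric])?)
          (use a(2,3) cm scale in \<open>auto simp: s_def t_def\<close>)
      then have "\<tau> * norm (nbi.net w - nbi.net a) \<le> \<tau> * (c_max / 2 ^ n)"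
        using \<tau> by (rule mult_left_mono)
      then show ?thesis
        using lip[of "nbi.net w" "cs i" "nbi.net a"] by (simp add: X_def nbi.net_def)
    qed
    then have "(\<Sum>i\<in>I. (X w i - X a i)\<^sup>2) \<le> real (card I) * (\<tau> * c_max / 2 ^ n)\<^sup>2"
      by (rule sumsq)
    also have "\<dots> = (R / 2 ^ n)\<^sup>2" unfolding power_divide R2 by simp
    finally show "\<exists>a\<in>Net n. (\<Sum>i\<in>I. (X w i - X a i)\<^sup>2) \<le> (R / 2 ^ n)\<^sup>2" using a(1) by blast
  next
    show "0 \<le> k n" for n unfolding k_def using x by (intro sum_nonneg) simp
    show "(\<Sum>n=1..m. k n / 2 ^ n) \<le> sqrt 2 * (\<Sum>b\<in>?B. sqrt (real (e b) * ln (exp 1 * (1 + x b))))" for m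
      unfolding k_def by (rule sum_entropy_le[OF x])
    show "h j \<in> ?W" for j by (rule h)
    show "finite (Net n) \<and> Net n \<noteq> {} \<and> Net n \<subseteq> ?W \<and> real (card (Net n)) \<le> exp ((k n)\<^sup>2)" for n
      using Net[of n] cardNet[of n] by blast
  qed
  also have "\<dots> = 2 * (sqrt 2 * sqrt 2) * R * (\<Sum>b\<in>?B. sqrt (real (e b) * ln (exp 1 * (1 + x b))))"
    by (simp only: mult_ac)
  finally show ?thesis unfolding cplx X_def R_def by simp
qed

section \<open>The generalization bound\<close>

text \<open>The union over \<open>m\<close> of finite nets of mesh \<open>1 / (m + 1)\<close>.
  Density is expressed by sequences and in the norms of the blocks, the form to which the Lipschitz
  bound of the network applies.\<close>

lemma countable_dense_params:
  fixes kind :: cov_kind and p_min p_max :: real and K J :: nat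
  defines "\<P> \<equiv> cov_class kind p_min p_max :: (real ^ 'n::{finite,linorder} ^ 'n::{finite,linorder}) set"
  assumes ne: "\<P> \<noteq> {}"
    and nrm: "\<And>d. d \<in> {1..D} \<Longrightarrow> is_norm_on_Rn (\<alpha> d) (nrm d)" and \<omega>: "\<And>d. d \<in> {1..D} \<Longrightarrow> 0 \<le> \<omega> d"
  defines "W \<equiv> hyp_params \<P> (tuple_space D \<alpha> nrm \<omega>) K J"
  shows "\<exists>h :: nat \<Rightarrow> _. (\<forall>n. h n \<in> W) \<and> (\<forall>w\<in>W. \<exists>f :: nat \<Rightarrow> nat. \<forall>m.
      onorm ((*v) (fst (h (f m)) - fst w)) \<le> 1 / real (Suc m) \<and>
      (\<forall>k\<in>{1..K}. \<forall>j\<in>{1..J}. \<forall>d\<in>{1..D}. nrm d (\<lambda>i. snd (h (f m)) k j d i - snd w k j d i) \<le> 1 / real (Suc m)))"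
proof -
  define good where "good = (\<lambda>m A. finite A \<and> A \<noteq> {} \<and> A \<subseteq> W \<and> (\<forall>w\<in>W. \<exists>a\<in>A.
      onorm ((*v) (fst a - fst w)) \<le> 1 / real (Suc m) \<and>
      (\<forall>k\<in>{1..K}. \<forall>j\<in>{1..J}. \<forall>d\<in>{1..D}. nrm d (\<lambda>i. snd a k j d i - snd w k j d i) \<le> 1 / real (Suc m))))"
  have "\<exists>A. good m A" for m
  proof -
    have m0: "0 \<le> real (Suc m)" by simp
    have m1: "0 \<le> (\<lambda>_ _ _. real (Suc m)) k j d" for k j d :: nat by simp
    obtain A where A: "finite A" "A \<noteq> {}" "A \<subseteq> W"
      and net: "\<forall>(P, \<theta>) \<in> W. \<exists>(Q, \<eta>) \<in> A. real (Suc m) * onorm ((*v) (P - Q)) \<le> 1 \<and>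
        (\<forall>k\<in>{1..K}. \<forall>j\<in>{1..J}. \<forall>d\<in>{1..D}. real (Suc m) * nrm d (\<lambda>i. \<theta> k j d i - \<eta> k j d i) \<le> 1)"
      using hyp_params_net[where t = "\<lambda>_ _ _. real (Suc m)" and s = "real (Suc m)" and kind = kind and p_min = p_min
          and p_max = p_max and \<alpha> = \<alpha> and nrm = nrm and \<omega> = \<omega> and K = K and J = J and D = D,
          OF ne[unfolded \<P>_def] nrm \<omega> m0 m1]
      unfolding W_def \<P>_def by blast
    have "\<exists>a\<in>A. onorm ((*v) (fst a - fst w)) \<le> 1 / real (Suc m) \<and>
      (\<forall>k\<in>{1..K}. \<forall>j\<in>{1..J}. \<forall>d\<in>{1..D}. nrm d (\<lambda>i. snd a k j d i - snd w k j d i) \<le> 1 / real (Suc m))"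
      if w: "w \<in> W" for w
    proof -
      from bspec[OF net w] obtain a where a: "a \<in> A" "real (Suc m) * onorm ((*v) (fst w - fst a)) \<le> 1"
        "\<And>k j d. k \<in> {1..K} \<Longrightarrow> j \<in> {1..J} \<Longrightarrow> d \<in> {1..D} \<Longrightarrow> real (Suc m) * nrm d (\<lambda>i. snd w k j d i - snd a k j d i) \<le> 1"
        unfolding case_prod_unfold by blast
      have div: "v \<le> 1 / real (Suc m)" if "real (Suc m) * v \<le> 1" for v
        using that by (simp add: field_simps)
      \<comment> \<open>\<open>nrm d\<close> is a norm only on functions vanishing from
        \<open>\<alpha> d\<close> on, so the difference must be shown to be one before its sign is
        changed.\<close>
      have flip: "nrm d (\<lambda>i. snd a k j d i - snd w k j d i) = nrm d (\<lambda>i. snd w k j d i - snd a k j d i)"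
        if "k \<in> {1..K}" "j \<in> {1..J}" "d \<in> {1..D}" for k j d
      proof -
        have "snd v k j d \<in> topspace (Euclidean_space (\<alpha> d))" if "v \<in> W" for v
        proof -
          have "snd v k j \<in> tuple_space D \<alpha> nrm \<omega>"
            using that \<open>k \<in> _\<close> \<open>j \<in> _\<close> by (auto simp: W_def hyp_params_def)
          then have "snd v k j d \<in> param_ball (\<alpha> d) (nrm d) (\<omega> d)"
            unfolding tuple_space_def using \<open>d \<in> _\<close> by (rule PiE_mem)
          then show ?thesis by (simp add: param_ball_def)
        qed
        from this[OF w] this[OF subsetD[OF A(3) a(1)]]
        have "(\<lambda>i. snd w k j d i - snd a k j d i) \<in> topspace (Euclidean_space (\<alpha> d))"
          by (simp add: topspace_Euclidean_space)
        from bspec[OF nrm[OF that(3), unfolded is_norm_on_Rn_def] this,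
            THEN conjunct2, THEN conjunct2, THEN conjunct1, THEN spec, of "- 1"]
        show ?thesis by simp
      qed
      have "onorm ((*v) (fst a - fst w)) = onorm ((*v) (fst w - fst a))"
        using onorm_matrix_scaleR[of "- 1" "fst w - fst a"] by simp
      then show ?thesis using a div flip by (intro bexI[of _ a]) auto
    qed
    then show ?thesis using A by (auto simp: good_def)
  qed
  then obtain Net where Net: "\<And>m. good m (Net m)" by metis
  note Net = Net[unfolded good_def]
  define W0 where "W0 = (\<Union>m. Net m)"
  have W0: "countable W0" "W0 \<noteq> {}" "W0 \<subseteq> W"
  proof -
    show "countable W0"
      unfolding W0_def by (rule countable_UN) (auto intro: countable_finite[OF Net[THEN conjunct1]])
    show "W0 \<noteq> {}"
      unfolding W0_def using Net[of 0, THEN conjunct2, THEN conjunct1] by blast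
    show "W0 \<subseteq> W"
      unfolding W0_def using Net[THEN conjunct2, THEN conjunct2, THEN conjunct1] by blast
  qed
  define h where "h = from_nat_into W0"
  have hW: "h n \<in> W" for n using from_nat_into[OF W0(2), of n] W0(3) by (auto simp: h_def)
  have "\<exists>f :: nat \<Rightarrow> nat. \<forall>m.
      onorm ((*v) (fst (h (f m)) - fst w)) \<le> 1 / real (Suc m) \<and>
      (\<forall>k\<in>{1..K}. \<forall>j\<in>{1..J}. \<forall>d\<in>{1..D}. nrm d (\<lambda>i. snd (h (f m)) k j d i - snd w k j d i) \<le> 1 / real (Suc m))"
    if w: "w \<in> W" for w
  proof (rule choice, intro allI)
    fix m
    obtain a where a: "a \<in> Net m" "onorm ((*v) (fst a - fst w)) \<le> 1 / real (Suc m) \<and>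
      (\<forall>k\<in>{1..K}. \<forall>j\<in>{1..J}. \<forall>d\<in>{1..D}. nrm d (\<lambda>i. snd a k j d i - snd w k j d i) \<le> 1 / real (Suc m))"
      using Net[of m] w by blast
    have "a \<in> W0" using a(1) by (auto simp: W0_def)
    then have ha: "h (to_nat_on W0 a) = a" unfolding h_def by (rule from_nat_into_to_nat_on[OF W0(1)])
    show "\<exists>n. onorm ((*v) (fst (h n) - fst w)) \<le> 1 / real (Suc m) \<and>
      (\<forall>k\<in>{1..K}. \<forall>j\<in>{1..J}. \<forall>d\<in>{1..D}. nrm d (\<lambda>i. snd (h n) k j d i - snd w k j d i) \<le> 1 / real (Suc m))"
      by (rule exI[of _ "to_nat_on W0 a"], unfold ha, rule a(2))
  qed
  then show ?thesis using hW by blast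
qed

lemma (in network_bounds) net_tendsto:
  assumes w: "w \<in> hyp_params \<P> \<T> K J" "\<And>m. v m \<in> hyp_params \<P> \<T> K J"
    and P: "\<And>m. onorm ((*v) (fst (v m) - fst w)) \<le> 1 / real (Suc m)"
    and \<theta>: "\<And>m k j d. k \<in> {1..K} \<Longrightarrow> j \<in> {1..J} \<Longrightarrow> d \<in> {1..D} \<Longrightarrow>
       nrm d (\<lambda>i. snd (v m) k j d i - snd w k j d i) \<le> 1 / real (Suc m)"
  shows "(\<lambda>m. net (v m)) \<longlonglongrightarrow> net w"
proof -
  let ?\<kappa> = "kappa A z_inf p_min p_max K J r1 r2 Y"
  let ?\<kappa>p = "kappa_par A z_inf p_max K J r1 r2 r3 Y"
  let ?q = "\<lambda>m. 1 / real (Suc m)"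
  define C where "C = 2 * ?\<kappa> + (\<Sum>k=1..K. \<Sum>j=1..J. \<Sum>d=1..D. 2 * ?\<kappa>p k j d)"
  have bound: "norm (net (v m) - net w) \<le> C * ?q m" for m
  proof -
    have "norm (net (v m) - net w) \<le> 2 * ?\<kappa> * onorm ((*v) (fst (v m) - fst w))
        + (\<Sum>k=1..K. \<Sum>j=1..J. \<Sum>d=1..D. 2 * ?\<kappa>p k j d * nrm d (\<lambda>i. snd (v m) k j d i - snd w k j d i))"
      unfolding net_def by (rule net_lipschitz_params) (use w(1) w(2)[of m] in \<open>auto simp: hyp_params_def\<close>)
    also have "\<dots> \<le> 2 * ?\<kappa> * ?q m + (\<Sum>k=1..K. \<Sum>j=1..J. \<Sum>d=1..D. 2 * ?\<kappa>p k j d * ?q m)"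
      by (intro add_mono sum_mono mult_left_mono P \<theta>) (auto simp: kappa_nonneg kappa_par_nonneg)
    also have "\<dots> = C * ?q m" by (simp only: C_def distrib_right sum_distrib_right)
    finally show ?thesis .
  qed
  have lim: "(\<lambda>m. C * ?q m) \<longlonglongrightarrow> 0"
    using tendsto_mult_right_zero[OF LIMSEQ_inverse_real_of_nat, of C] by (simp add: inverse_eq_divide)
  have "(\<lambda>m. net (v m) - net w) \<longlonglongrightarrow> 0"
    by (rule Lim_null_comparison[OF _ lim]) (rule always_eventually, rule allI, rule bound)
  then show ?thesis by (rule LIM_zero_cancel)
qed

theorem theorem1:
  fixes A :: "real ^ 'n::{finite,linorder} ^ 'm"
    and kind :: cov_kind
    and p_min p_max z_inf c_max b c \<tau> \<epsilon> :: real
    and K J D Ns :: nat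
    and \<alpha> :: "nat \<Rightarrow> nat" and \<omega> :: "nat \<Rightarrow> real"
    and nrm :: "nat \<Rightarrow> (nat \<Rightarrow> real) \<Rightarrow> real"
    and g :: "('n::{finite,linorder}, 'm) scale_update"
    and L :: "real ^ 'n::{finite,linorder} \<Rightarrow> real ^ 'n::{finite,linorder} \<Rightarrow> real"
    and M :: "'w measure"
    and \<D> :: "((real ^ 'm) \<times> (real ^ 'n::{finite,linorder})) measure"
    and Z U C :: "nat \<Rightarrow> 'w \<Rightarrow> real ^ 'n::{finite,linorder}"
    and V Y :: "nat \<Rightarrow> 'w \<Rightarrow> real ^ 'm"
    and y_max :: "'w \<Rightarrow> real"
    and r1 r2 :: "'w \<Rightarrow> nat \<Rightarrow> nat \<Rightarrow> real"
    and r3 :: "'w \<Rightarrow> nat \<Rightarrow> nat \<Rightarrow> nat \<Rightarrow> real"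
    and \<P> :: "(real ^ 'n::{finite,linorder} ^ 'n::{finite,linorder}) set"
    and \<T> :: "param_tuple set"
    and \<H> :: "(real ^ 'm \<Rightarrow> real ^ 'n::{finite,linorder}) set"
  assumes "0 < p_min" "p_min \<le> p_max" "0 \<le> z_inf" "0 < c_max" "0 < b"
    and "1 \<le> K" "1 \<le> J" "1 \<le> D" "1 \<le> Ns"
    and "\<And>d. d \<in> {1..D} \<Longrightarrow> is_norm_on_Rn (\<alpha> d) (nrm d)"
    and "\<And>d. d \<in> {1..D} \<Longrightarrow> 0 \<le> \<omega> d"
    and \<P>: "\<P> = cov_class kind p_min p_max"
    and \<T>: "\<T> = tuple_space D \<alpha> nrm \<omega>"
    and \<H>: "\<H> = cg_hypotheses A b z_inf c_max K J g \<P> \<T>"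
    \<comment> \<open>training data, i.i.d. from \<open>\<D>\<close>, given by the linear measurement model\<close>
    and "prob_space M"
    and "\<And>i. i \<in> {1..Ns} \<Longrightarrow> Z i \<in> borel_measurable M"
    and "\<And>i. i \<in> {1..Ns} \<Longrightarrow> U i \<in> borel_measurable M"
    and "\<And>i. i \<in> {1..Ns} \<Longrightarrow> V i \<in> borel_measurable M"
    and C: "\<And>i x. C i x = Z i x * U i x"
    and Y: "\<And>i x. Y i x = A *v C i x + V i x"
    and "prob_space.indep_vars M (\<lambda>_. borel) (\<lambda>i x. (Y i x, C i x)) {1..Ns}"
    and "\<And>i. i \<in> {1..Ns} \<Longrightarrow> distr M borel (\<lambda>x. (Y i x, C i x)) = \<D>"
    and y_max: "\<And>x. y_max x = Max ((\<lambda>i. norm (Y i x)) ` {1..Ns})"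
    \<comment> \<open>boundedness assumption\<close>
    and "\<And>i. i \<in> {1..Ns} \<Longrightarrow> AE x in M. norm (C i x) \<le> c_max"
    and "\<And>i. i \<in> {1..Ns} \<Longrightarrow> AE x in M. infnorm (Z i x) \<le> z_inf"
    and "\<And>i. i \<in> {1..Ns} \<Longrightarrow> AE x in M. infnorm (init_scale A b (Y i x)) \<le> z_inf"
    \<comment> \<open>loss assumption; the expected loss of every hypothesis is well defined\<close>
    and "loss_assumption L c \<tau>"
    and "\<And>h. h \<in> \<H> \<Longrightarrow> (\<lambda>(y, s). L (h y) s) \<in> borel_measurable \<D>"
    \<comment> \<open>scale-update assumption\<close>
    and "AE x in M. \<forall>p\<in>{1..Ns}.
           scale_update_assumption A z_inf K J D nrm g \<P> \<T> (r1 x) (r2 x) (r3 x) (Y p x)"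
    and "0 < \<epsilon>" "\<epsilon> < 1"
  shows "\<exists>E \<in> sets M. measure M E \<ge> 1 - \<epsilon> \<and>
    (\<forall>x\<in>E. \<forall>h\<in>\<H>.
       expected_loss L \<D> h \<le> empirical_loss L Ns (\<lambda>i. Y i x) (\<lambda>i. C i x) h
       + 8 * \<tau> * c_max / sqrt (real Ns) *
         (sqrt (real (cov_dim kind CARD('n))) *
            sqrt (ln (exp 1 * (1 + 4 * p_max * real (K * J * D + 1)
              * kappa A z_inf p_min p_max K J (r1 x) (r2 x) (y_max x) / c_max)))
          + (\<Sum>k=1..K. \<Sum>j=1..J. \<Sum>d=1..D.
               sqrt (real (\<alpha> d) * ln (exp 1 * (1 + 4 * \<omega> d * real (K * J * D + 1)
                 * kappa_par A z_inf p_max K J (r1 x) (r2 x) (r3 x) (y_max x) k j d / c_max)))))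
       + 4 * c * sqrt (2 * ln (4 / \<epsilon>) / real Ns))"
proof (cases "\<P> = {}")
  \<comment> \<open>An empty covariance class leaves no hypothesis to bound, and no dense sequence
    to choose.\<close>
  case True
  then have "\<H> = {}" by (simp add: \<H> cg_hypotheses_def)
  then show ?thesis
    using prob_space.prob_space[OF assms(15)] \<open>0 < \<epsilon>\<close> by (intro bexI[of _ "space M"]) auto
next
  case False
  interpret prob_space M by (rule assms(15))
  let ?I = "{1..Ns}"
  define W where "W = hyp_params \<P> \<T> K J"
  define hyp where "hyp = (\<lambda>w. cg_net A b z_inf c_max K J g (fst w) (snd w))"
  have hyp_\<H>: "hyp w \<in> \<H>" if "w \<in> W" for w
    unfolding \<H> cg_hypotheses_def hyp_def
    by (rule CollectI, rule exI[of _ "fst w"], rule exI[of _ "snd w"])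
      (use that in \<open>auto simp: W_def hyp_params_def\<close>)
  have \<H>_hyp: "\<exists>w\<in>W. h = hyp w" if h: "h \<in> \<H>" for h
  proof -
    obtain P \<theta> where "h = cg_net A b z_inf c_max K J g P \<theta>" "P \<in> \<P>" "\<forall>k\<in>{1..K}. \<forall>j\<in>{1..J}. \<theta> k j \<in> \<T>"
      using h by (auto simp: \<H> cg_hypotheses_def)
    then show ?thesis by (intro bexI[of _ "(P, \<theta>)"]) (auto simp: W_def hyp_def hyp_params_def)
  qed
  obtain h :: "nat \<Rightarrow> _" where hW: "\<And>n. h n \<in> W"
    and dense: "\<And>w. w \<in> W \<Longrightarrow> \<exists>f :: nat \<Rightarrow> nat. \<forall>m. onorm ((*v) (fst (h (f m)) - fst w)) \<le> 1 / real (Suc m) \<and>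
      (\<forall>k\<in>{1..K}. \<forall>j\<in>{1..J}. \<forall>d\<in>{1..D}. nrm d (\<lambda>i. snd (h (f m)) k j d i - snd w k j d i) \<le> 1 / real (Suc m))"
    using countable_dense_params[where K = K and J = J and D = D and \<alpha> = \<alpha> and nrm = nrm and \<omega> = \<omega>,
        OF False[unfolded \<P>] assms(10,11)]
    unfolding W_def \<P> \<T> by blast
  have I: "finite ?I" "?I \<noteq> {}" "1 \<in> ?I" using \<open>1 \<le> Ns\<close> by auto
  have lip: "\<bar>L a1 v - L a2 v\<bar> \<le> \<tau> * norm (a1 - a2)" and Lc: "\<bar>L a1 v\<bar> \<le> c" and \<tau>: "0 \<le> \<tau>" and c: "0 \<le> c" for a1 a2 v
    using assms(27) by (auto simp: loss_assumption_def)

  \<comment> \<open>The sample as one extensional tuple. Independence and equal laws say that its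
    law is the product measure to which \<open>uniform_deviation\<close> applies.\<close>
  define T where "T = (\<lambda>x. \<lambda>i\<in>?I. (Y i x, C i x))"
  have rv: "(\<lambda>x. (Y i x, C i x)) \<in> borel_measurable M" if "i \<in> ?I" for i
    using assms(21) that by (auto simp: indep_vars_def)
  have \<D>: "\<D> = distr M borel (\<lambda>x. (Y i x, C i x))" if "i \<in> ?I" for i
    using assms(22)[OF that] by simp
  have sets_\<D>: "sets \<D> = sets borel" by (simp add: \<D>[OF I(3)])
  interpret \<D>: prob_space \<D>
    unfolding \<D>[OF I(3)] by (rule prob_space_distr[OF rv[OF I(3)]])
  define F where "F = (\<lambda>n (y, s). L (hyp (h n) y) s)"
  interpret F: bounded_family \<D> F c
  proof
    show "F n \<in> borel_measurable \<D>" for n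
      unfolding F_def by (rule assms(28)[OF hyp_\<H>[OF hW]])
    show "\<bar>F n p\<bar> \<le> c" for n p by (cases p) (simp add: F_def Lc)
  qed
  have sets_P: "sets (PiM ?I (\<lambda>_. \<D>)) = sets (PiM ?I (\<lambda>_. borel))"
    by (rule sets_PiM_cong) (simp_all add: sets_\<D>)
  have "T \<in> measurable M (PiM ?I (\<lambda>_. borel))"
    unfolding T_def by (rule measurable_restrict) (rule rv)
  then have T: "T \<in> measurable M (PiM ?I (\<lambda>_. \<D>))"
    unfolding measurable_cong_sets[OF refl sets_P] .
  have "distr M (PiM ?I (\<lambda>_. borel)) T = PiM ?I (\<lambda>i. distr M borel (\<lambda>x. (Y i x, C i x)))"
    using assms(21) I(2) rv unfolding T_def by (subst (asm) indep_vars_iff_distr_eq_PiM') auto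
  also have "\<dots> = PiM ?I (\<lambda>_. \<D>)" by (rule PiM_cong) (simp_all add: assms(22))
  finally have distr_T: "distr M (PiM ?I (\<lambda>_. \<D>)) T = PiM ?I (\<lambda>_. \<D>)"
    by (subst distr_cong[OF refl sets_P refl])

  obtain E0 where E0: "E0 \<in> sets (PiM ?I (\<lambda>_. \<D>))" "1 - \<epsilon> \<le> measure (PiM ?I (\<lambda>_. \<D>)) E0"
    and dev: "\<And>v n. v \<in> E0 \<Longrightarrow> real Ns * F.mean n \<le> (\<Sum>i\<in>?I. F n (v i)) + 2 * F.emp_rad ?I v
          + real Ns * (3 * c * sqrt (2 * ln (1 / \<epsilon>) / real Ns))"
    using F.uniform_deviation[OF I(1,2) \<open>0 < \<epsilon>\<close> \<open>\<epsilon> < 1\<close>] by auto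

  \<comment> \<open>This set need not be measurable, nor determined by the sample, since
    \<open>r1\<close>, \<open>r2\<close>, \<open>r3\<close> depend on \<open>x\<close> arbitrarily.
    A null set \<open>N\<close> containing its complement is removed from the event instead.\<close>
  define good where "good = (\<lambda>x. \<forall>p\<in>?I.
      scale_update_assumption A z_inf K J D nrm g \<P> \<T> (r1 x) (r2 x) (r3 x) (Y p x)
      \<and> infnorm (init_scale A b (Y p x)) \<le> z_inf)"
  have "AE x in M. \<forall>p\<in>?I. infnorm (init_scale A b (Y p x)) \<le> z_inf"
    by (rule AE_finite_allI[OF I(1)]) (rule assms(26))
  then have good: "AE x in M. good x" using assms(29) by eventually_elim (simp add: good_def)
  then obtain N where N: "{x \<in> space M. \<not> good x} \<subseteq> N" "N \<in> null_sets M"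
    by (auto elim!: AE_E simp: null_sets_def)
  have nb: "network_bounds A p_min p_max z_inf (y_max x) (Y i x) K J D nrm g kind (tuple_space D \<alpha> nrm \<omega>)
      (r1 x) (r2 x) (r3 x) b c_max" if "good x" "i \<in> ?I" for x i
  proof unfold_locales
    show "norm (Y i x) \<le> y_max x" unfolding y_max using that(2) by (intro Max_ge) auto
  qed (use assms(1-7) that in \<open>auto simp: good_def \<P> \<T>\<close>)

  have lim: "(\<lambda>m. L (hyp (h (f m)) (Y i x)) (C i x)) \<longlonglongrightarrow> L (hyp w (Y i x)) (C i x)"
    if x: "good x" "i \<in> ?I" and w: "w \<in> W"
      and f: "\<And>m. onorm ((*v) (fst (h (f m)) - fst w)) \<le> 1 / real (Suc m) \<and>
      (\<forall>k\<in>{1..K}. \<forall>j\<in>{1..J}. \<forall>d\<in>{1..D}. nrm d (\<lambda>i. snd (h (f m)) k j d i - snd w k j d i) \<le> 1 / real (Suc m))"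
    for x i w and f :: "nat \<Rightarrow> nat"
  proof -
    interpret network_bounds A p_min p_max z_inf "y_max x" "Y i x" K J D nrm g kind "tuple_space D \<alpha> nrm \<omega>"
      "r1 x" "r2 x" "r3 x" b c_max by (rule nb[OF x])
    have "(\<lambda>m. net (h (f m))) \<longlonglongrightarrow> net w"
      by (rule net_tendsto) (use w hW f in \<open>auto simp: W_def \<P> \<T>\<close>)
    then have "(\<lambda>m. hyp (h (f m)) (Y i x)) \<longlonglongrightarrow> hyp w (Y i x)"
      by (simp add: net_def hyp_def)
    then have "(\<lambda>m. \<tau> * norm (hyp (h (f m)) (Y i x) - hyp w (Y i x))) \<longlonglongrightarrow> 0"
      by (intro tendsto_mult_right_zero tendsto_norm_zero) (simp add: LIM_zero)
    then have "(\<lambda>m. L (hyp (h (f m)) (Y i x)) (C i x) - L (hyp w (Y i x)) (C i x)) \<longlonglongrightarrow> 0"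
      by (rule Lim_null_comparison[rotated]) (simp add: lip)
    then show ?thesis by (rule LIM_zero_cancel)
  qed
  \<comment> \<open>The expected loss becomes an integral over \<open>M\<close> at the first sample,
    because convergence of the network is known only at training measurements, almost
    surely.\<close>
  have exp_loss: "expected_loss L \<D> (hyp w) = (\<integral>x. L (hyp w (Y 1 x)) (C 1 x) \<partial>M)"
    and loss_measurable: "(\<lambda>x. L (hyp w (Y 1 x)) (C 1 x)) \<in> borel_measurable M" if "w \<in> W" for w
  proof -
    have m: "(\<lambda>(y, s). L (hyp w y) s) \<in> borel_measurable borel"
      using assms(28)[OF hyp_\<H>[OF that]] unfolding measurable_cong_sets[OF sets_\<D> refl] .
    show "expected_loss L \<D> (hyp w) = (\<integral>x. L (hyp w (Y 1 x)) (C 1 x) \<partial>M)"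
      unfolding expected_loss_def \<D>[OF I(3)] by (subst integral_distr[OF rv[OF I(3)] m]) simp
    show "(\<lambda>x. L (hyp w (Y 1 x)) (C 1 x)) \<in> borel_measurable M"
      using measurable_comp[OF rv[OF I(3)] m] by (simp add: o_def)
  qed

  define E where "E = (T -` E0 \<inter> space M) - N"
  have pre: "T -` E0 \<inter> space M \<in> sets M" by (rule measurable_sets[OF T E0(1)])
  have "measure M E = measure M (T -` E0 \<inter> space M)"
    unfolding E_def by (rule measure_Diff_null_set[OF pre N(2)])
  also have "\<dots> = measure (PiM ?I (\<lambda>_. \<D>)) E0"
    using measure_distr[OF T E0(1)] distr_T by simp
  finally have measure_E: "1 - \<epsilon> \<le> measure M E" using E0(2) by simp
  have "expected_loss L \<D> k \<le> empirical_loss L Ns (\<lambda>i. Y i x) (\<lambda>i. C i x) k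
       + 8 * \<tau> * c_max / sqrt (real Ns)
         * complexity (cov_dim kind CARD('n)) p_max \<alpha> \<omega> K J D c_max
             (kappa A z_inf p_min p_max K J (r1 x) (r2 x) (y_max x))
             (kappa_par A z_inf p_max K J (r1 x) (r2 x) (r3 x) (y_max x))
       + 4 * c * sqrt (2 * ln (4 / \<epsilon>) / real Ns)" (is "_ \<le> _ + ?gap + ?tail")
    if x: "x \<in> E" and k: "k \<in> \<H>" for x k
  proof -
    have gx: "good x" using x N(1) by (auto simp: E_def)
    have Tx: "T x \<in> E0" using x by (simp add: E_def)
    have Ns: "0 < real Ns" using \<open>1 \<le> Ns\<close> by simp
    let ?cplx = "complexity (cov_dim kind CARD('n)) p_max \<alpha> \<omega> K J D c_max
             (kappa A z_inf p_min p_max K J (r1 x) (r2 x) (y_max x))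
             (kappa_par A z_inf p_max K J (r1 x) (r2 x) (r3 x) (y_max x))"
    have rad: "F.emp_rad ?I (T x) \<le> 4 * (\<tau> * c_max * sqrt (real Ns)) * ?cplx"
    proof -
      have "F.emp_rad ?I (T x) = sign_avg ?I (\<lambda>s. SUP n. \<Sum>i\<in>?I. s i
          * L (cg_net A b z_inf c_max K J g (fst (h n)) (snd (h n)) (Y i x)) (C i x))"
        unfolding F.emp_rad_def F.wsup_def by (simp add: F_def T_def hyp_def)
      also have "\<dots> \<le> 4 * (\<tau> * c_max * sqrt (real (card ?I))) * ?cplx"
        by (rule network_rademacher_bound[OF I(1,2) nb[OF gx] assms(27) assms(10,11)])
          (use hW in \<open>simp_all add: W_def \<P> \<T>\<close>)
      finally show ?thesis by simp
    qed
    \<comment> \<open>The single use of McDiarmid's inequality leaves room below the stated tail,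
      both in the factor and under the logarithm.\<close>
    have tail: "3 * c * sqrt (2 * ln (1 / \<epsilon>) / real Ns) \<le> ?tail"
    proof (rule mult_mono)
      have "1 / \<epsilon> \<le> 4 / \<epsilon>" using \<open>0 < \<epsilon>\<close> by (simp add: divide_right_mono)
      then have "ln (1 / \<epsilon>) \<le> ln (4 / \<epsilon>)" using \<open>0 < \<epsilon>\<close> by simp
      then show "sqrt (2 * ln (1 / \<epsilon>) / real Ns) \<le> sqrt (2 * ln (4 / \<epsilon>) / real Ns)"
        using Ns by (simp add: divide_right_mono)
      show "0 \<le> sqrt (2 * ln (1 / \<epsilon>) / real Ns)" using \<open>0 < \<epsilon>\<close> \<open>\<epsilon> < 1\<close> by simp
    qed (use c in auto)
    have countable_bound: "expected_loss L \<D> (hyp (h n))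
        \<le> empirical_loss L Ns (\<lambda>i. Y i x) (\<lambda>i. C i x) (hyp (h n)) + (?gap + ?tail)" for n
    proof -
      have mean: "F.mean n = expected_loss L \<D> (hyp (h n))"
        unfolding F.mean_def expected_loss_def by (simp add: F_def)
      have emp: "(\<Sum>i\<in>?I. F n (T x i)) = real Ns * empirical_loss L Ns (\<lambda>i. Y i x) (\<lambda>i. C i x) (hyp (h n))"
        using Ns by (simp add: F_def T_def empirical_loss_def)
      \<comment> \<open>The factor 4 of the Rademacher bound is doubled by symmetrization; dividing
        by \<open>real Ns\<close> turns \<open>sqrt (real Ns)\<close> into
        \<open>1 / sqrt (real Ns)\<close>.\<close>
      have gap: "8 * (\<tau> * c_max * sqrt (real Ns)) * ?cplx = real Ns * ?gap"
      proof -
        have "real Ns * ?gap = 8 * \<tau> * c_max * (real Ns / sqrt (real Ns)) * ?cplx" by simp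
        also have "real Ns / sqrt (real Ns) = sqrt (real Ns)" by (rule real_div_sqrt) simp
        finally show ?thesis by simp
      qed
      have "real Ns * expected_loss L \<D> (hyp (h n))
          \<le> real Ns * empirical_loss L Ns (\<lambda>i. Y i x) (\<lambda>i. C i x) (hyp (h n)) + 2 * F.emp_rad ?I (T x)
            + real Ns * (3 * c * sqrt (2 * ln (1 / \<epsilon>) / real Ns))"
        using dev[OF Tx, of n] unfolding mean emp .
      moreover have "2 * F.emp_rad ?I (T x) \<le> real Ns * ?gap"
        unfolding gap[symmetric] using rad by simp
      moreover have "real Ns * (3 * c * sqrt (2 * ln (1 / \<epsilon>) / real Ns)) \<le> real Ns * ?tail"
        by (rule mult_left_mono[OF tail]) simp
      ultimately have "real Ns * expected_loss L \<D> (hyp (h n))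
          \<le> real Ns * (empirical_loss L Ns (\<lambda>i. Y i x) (\<lambda>i. C i x) (hyp (h n)) + (?gap + ?tail))"
        unfolding distrib_left by linarith
      then show ?thesis using Ns by simp
    qed
    obtain w where w: "w \<in> W" "k = hyp w" using \<H>_hyp[OF k] by blast
    obtain f :: "nat \<Rightarrow> nat" where f: "\<And>m. onorm ((*v) (fst (h (f m)) - fst w)) \<le> 1 / real (Suc m) \<and>
      (\<forall>k\<in>{1..K}. \<forall>j\<in>{1..J}. \<forall>d\<in>{1..D}. nrm d (\<lambda>i. snd (h (f m)) k j d i - snd w k j d i) \<le> 1 / real (Suc m))"
      using dense[OF w(1)] by blast
    \<comment> \<open>From the dense sequence to all hypotheses: both sides of the bound converge
      along \<open>f\<close>, and the complexity and tail terms do not involve the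
      hypothesis.\<close>
    have "(\<lambda>m. expected_loss L \<D> (hyp (h (f m)))) \<longlonglongrightarrow> expected_loss L \<D> (hyp w)"
      unfolding exp_loss[OF w(1)] exp_loss[OF hW]
    proof (rule integral_dominated_convergence[where w = "\<lambda>_. c"])
      show "AE x in M. (\<lambda>m. L (hyp (h (f m)) (Y 1 x)) (C 1 x)) \<longlonglongrightarrow> L (hyp w (Y 1 x)) (C 1 x)"
        using good by eventually_elim (rule lim[OF _ I(3) w(1) f])
      show "(\<lambda>x. L (hyp w (Y 1 x)) (C 1 x)) \<in> borel_measurable M"
        by (rule loss_measurable[OF w(1)])
      show "(\<lambda>x. L (hyp (h (f m)) (Y 1 x)) (C 1 x)) \<in> borel_measurable M" for m
        by (rule loss_measurable[OF hW])
    qed (simp_all add: Lc)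
    moreover have "(\<lambda>m. empirical_loss L Ns (\<lambda>i. Y i x) (\<lambda>i. C i x) (hyp (h (f m))) + (?gap + ?tail))
        \<longlonglongrightarrow> empirical_loss L Ns (\<lambda>i. Y i x) (\<lambda>i. C i x) (hyp w) + (?gap + ?tail)"
      unfolding empirical_loss_def
      by (intro tendsto_add tendsto_mult tendsto_const tendsto_sum) (rule lim[OF gx _ w(1) f])
    ultimately have "expected_loss L \<D> (hyp w)
        \<le> empirical_loss L Ns (\<lambda>i. Y i x) (\<lambda>i. C i x) (hyp w) + (?gap + ?tail)"
      by (rule LIMSEQ_le) (use countable_bound in blast)
    then show ?thesis by (simp add: w(2))
  qed
  then show ?thesis
    unfolding complexity_def using measure_E pre N(2)
    by (intro bexI[of _ E]) (auto simp: E_def)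
qed

end
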